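(* Let $E$ be a Banach space, let $X$ be a compact topological space, and let $L:X\rightarrow\mathcal{BF}(E)$ be a norm continuous family of bounded Fredholm operators on $E$, regarded as a Fredholm morphism $\Theta(E)\to\Theta(E)$ of the product bundle $\Theta(E)=X\times E$. Let $E_1\subset E$ be a closed subspace of finite codimension such that $\ker L_\lambda\cap E_1=\{0\}$ for all $\lambda\in X$, and let $P:X\to\mathcal{L}(E)$ be a norm continuous family of projections such that $\operatorname{im}P_\lambda=L_\lambda(E_1)$ for all $\lambda\in X$. Then $$\operatorname{ind}(L)=[\Theta(E/E_1)]-[\operatorname{im}(I-P)]\in K(X),$$ that is, the index bundle of $L$ as a Fredholm morphism coincides with the classical index bundle of the family $L$.
   Context: Scalars are $\mathbb{K}=\mathbb{R}$ or $\mathbb{C}$; $K(X)$ denotes the Grothendieck group of finite dimensional $\mathbb{K}$-vector bundles over $X$ (so $K(X)$ means $KO(X)$ in the real case). Compact spaces are understood to be Hausdorff. $\Theta(V)=X\times V$ is the product bundle with fibre $V$; $\mathcal{L}(E)$ is the space of bounded operators on $E$ and $\mathcal{BF}(E)\subset\mathcal{L}(E)$ the subspace of bounded Fredholm operators, both with the norm topology. $\operatorname{im}(I-P)$ is the finite dimensional subbundle of $\Theta(E)$ with fibres $\operatorname{im}(I-P_\lambda)$. Index bundle of $L$ as a Fredholm morphism: there exist finite dimensional subbundles $\mathcal{V}\subset\Theta(E)$ transversal to the image of $L$, i.e. $\operatorname{im}(L_\lambda)+\mathcal{V}_\lambda=E$ for all $\lambda\in X$. For such $\mathcal{V}$, the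 spaces $E(L,\mathcal{V})_\lambda=\{u\in E:L_\lambda u\in\mathcal{V}_\lambda\}$ form a finite dimensional subbundle $E(L,\mathcal{V})$ of $\Theta(E)$, and $\operatorname{ind}(L):=[E(L,\mathcal{V})]-[\mathcal{V}]\in K(X)$, which does not depend on the choice of $\mathcal{V}$. Classical index bundle: one chooses $E_1$ and $P$ as in the claim (such choices exist) and takes the class $[\Theta(E/E_1)]-[\operatorname{im}(I-P)]\in K(X)$. *)

theory Defs
  imports "HOL-Analysis.Analysis" "HOL-Algebra.Group"
begin

section \<open>Scalars and Banach spaces over them\<close>

text \<open>The class contains exactly the fields that are isometrically isomorphic to the real or to the
  complex numbers.\<close>

class real_or_complex = real_normed_field +
  assumes ex_complex_embedding:
    "\<exists>f :: 'a \<Rightarrow> complex.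
       (\<forall>x y. f (x + y) = f x + f y) \<and> (\<forall>x y. f (x * y) = f x * f y) \<and>
       (\<forall>r x. f (r *\<^sub>R x) = r *\<^sub>R f x) \<and> (\<forall>x. norm (f x) = norm x) \<and>
       (range f = \<real> \<or> range f = UNIV)"

instance real :: real_or_complex
proof
  show "\<exists>f :: real \<Rightarrow> complex.
       (\<forall>x y. f (x + y) = f x + f y) \<and> (\<forall>x y. f (x * y) = f x * f y) \<and>
       (\<forall>r x. f (r *\<^sub>R x) = r *\<^sub>R f x) \<and> (\<forall>x. norm (f x) = norm x) \<and>
       (range f = \<real> \<or> range f = UNIV)"
    by (rule exI[of _ of_real]) (auto simp: Reals_def scaleR_conv_of_real)
qed

instance complex :: real_or_complex
proof
  show "\<exists>f :: complex \<Rightarrow> complex.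
       (\<forall>x y. f (x + y) = f x + f y) \<and> (\<forall>x y. f (x * y) = f x * f y) \<and>
       (\<forall>r x. f (r *\<^sub>R x) = r *\<^sub>R f x) \<and> (\<forall>x. norm (f x) = norm x) \<and>
       (range f = \<real> \<or> range f = UNIV)"
    by (rule exI[of _ id]) auto
qed

text \<open>A \<open>'k\<close>-Banach space is a type \<open>'e :: banach\<close> with such a scalar multiplication. The type
  \<open>'e \<Rightarrow>\<^sub>L 'e\<close> consists of the real-linear bounded operators, so linearity over \<open>'k\<close> has to be
  required separately; the bounded operators over \<open>'k\<close> form a subspace with the same norm.\<close>

locale normed_space_over = vector_space scaleK
  for scaleK :: "'k::real_or_complex \<Rightarrow> 'e::real_normed_vector \<Rightarrow> 'e" +
  assumes scale_of_real: "scaleK (of_real r) u = r *\<^sub>R u"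
    and norm_scale: "norm (scaleK c u) = norm c * norm u"

definition linear_over ::
    "('k::real_or_complex \<Rightarrow> 'e::real_normed_vector \<Rightarrow> 'e) \<Rightarrow> ('e \<Rightarrow>\<^sub>L 'e) \<Rightarrow> bool" where
  "linear_over scaleK T \<longleftrightarrow> (\<forall>c u. blinfun_apply T (scaleK c u) = scaleK c (blinfun_apply T u))"

definition finite_dim ::
    "('k::real_or_complex \<Rightarrow> 'e::real_normed_vector \<Rightarrow> 'e) \<Rightarrow> 'e set \<Rightarrow> bool" where
  "finite_dim scaleK S \<longleftrightarrow> (\<exists>B. finite B \<and> S = module.span scaleK B)"

definition finite_codim ::
    "('k::real_or_complex \<Rightarrow> 'e::real_normed_vector \<Rightarrow> 'e) \<Rightarrow> 'e set \<Rightarrow> bool" where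
  "finite_codim scaleK S \<longleftrightarrow>
     module.subspace scaleK S \<and>
     (\<exists>B. finite B \<and> (\<forall>u. \<exists>s\<in>S. \<exists>b\<in>module.span scaleK B. u = s + b))"

text \<open>On a Banach space the range of such an operator is automatically closed.\<close>

definition fredholm ::
    "('k::real_or_complex \<Rightarrow> 'e::banach \<Rightarrow> 'e) \<Rightarrow> ('e \<Rightarrow>\<^sub>L 'e) \<Rightarrow> bool" where
  "fredholm scaleK T \<longleftrightarrow>
     linear_over scaleK T \<and>
     finite_dim scaleK {u. blinfun_apply T u = 0} \<and>
     finite_codim scaleK (range (blinfun_apply T))"

section \<open>Vector bundles\<close>

text \<open>Addition and scalar multiplication are only meaningful inside the fibres; their values
  elsewhere are irrelevant.\<close>

record ('x, 'k, 'b) vbundle =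
  vtotal :: "'b topology"
  vproj :: "'b \<Rightarrow> 'x"
  vadd :: "'b \<Rightarrow> 'b \<Rightarrow> 'b"
  vscale :: "'k \<Rightarrow> 'b \<Rightarrow> 'b"

definition coord_space :: "nat \<Rightarrow> (nat \<Rightarrow> 'k::real_or_complex) topology" where
  "coord_space n =
     subtopology (product_topology (\<lambda>i. euclidean) UNIV) {a. \<forall>i\<ge>n. a i = 0}"

definition local_trivialization ::
    "'x topology \<Rightarrow> ('x, 'k::real_or_complex, 'b) vbundle \<Rightarrow> 'x set \<Rightarrow> nat \<Rightarrow>
     ('b \<Rightarrow> 'x \<times> (nat \<Rightarrow> 'k)) \<Rightarrow> bool" where
  "local_trivialization X \<xi> U n \<phi> \<longleftrightarrow>
     homeomorphic_map
       (subtopology (vtotal \<xi>) {e. vproj \<xi> e \<in> U})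
       (prod_topology (subtopology X U) (coord_space n)) \<phi> \<and>
     (\<forall>e \<in> topspace (vtotal \<xi>). vproj \<xi> e \<in> U \<longrightarrow>
        fst (\<phi> e) = vproj \<xi> e \<and>
        (\<forall>c. snd (\<phi> (vscale \<xi> c e)) = (\<lambda>i. c * snd (\<phi> e) i)) \<and>
        (\<forall>e' \<in> topspace (vtotal \<xi>). vproj \<xi> e' = vproj \<xi> e \<longrightarrow>
           snd (\<phi> (vadd \<xi> e e')) = (\<lambda>i. snd (\<phi> e) i + snd (\<phi> e') i)))"

text \<open>The vector space axioms in the fibres hold automatically, since a local trivialization restricts
  to linear bijections from fibres to coordinate spaces. The rank may vary between the components of
  the base.\<close>

definition vector_bundle ::
    "'x topology \<Rightarrow> ('x, 'k::real_or_complex, 'b) vbundle \<Rightarrow> bool" where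
  "vector_bundle X \<xi> \<longleftrightarrow>
     continuous_map (vtotal \<xi>) X (vproj \<xi>) \<and>
     (\<forall>e \<in> topspace (vtotal \<xi>).
        (\<forall>c. vscale \<xi> c e \<in> topspace (vtotal \<xi>) \<and> vproj \<xi> (vscale \<xi> c e) = vproj \<xi> e) \<and>
        (\<forall>e' \<in> topspace (vtotal \<xi>). vproj \<xi> e' = vproj \<xi> e \<longrightarrow>
           vadd \<xi> e e' \<in> topspace (vtotal \<xi>) \<and> vproj \<xi> (vadd \<xi> e e') = vproj \<xi> e)) \<and>
     (\<forall>x \<in> topspace X. \<exists>U n \<phi>. openin X U \<and> x \<in> U \<and> local_trivialization X \<xi> U n \<phi>)"

definition bundle_iso ::
    "('x, 'k::real_or_complex, 'b) vbundle \<Rightarrow> ('x, 'k, 'c) vbundle \<Rightarrow> ('b \<Rightarrow> 'c) \<Rightarrow> bool" where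
  "bundle_iso \<xi> \<eta> f \<longleftrightarrow>
     homeomorphic_map (vtotal \<xi>) (vtotal \<eta>) f \<and>
     (\<forall>e \<in> topspace (vtotal \<xi>).
        vproj \<eta> (f e) = vproj \<xi> e \<and>
        (\<forall>c. f (vscale \<xi> c e) = vscale \<eta> c (f e)) \<and>
        (\<forall>e' \<in> topspace (vtotal \<xi>). vproj \<xi> e' = vproj \<xi> e \<longrightarrow>
           f (vadd \<xi> e e') = vadd \<eta> (f e) (f e')))"

definition isomorphic_bundles ::
    "('x, 'k::real_or_complex, 'b) vbundle \<Rightarrow> ('x, 'k, 'c) vbundle \<Rightarrow> bool" where
  "isomorphic_bundles \<xi> \<eta> \<longleftrightarrow> (\<exists>f. bundle_iso \<xi> \<eta> f)"

definition direct_sum ::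
    "('x, 'k::real_or_complex, 'b) vbundle \<Rightarrow> ('x, 'k, 'c) vbundle \<Rightarrow> ('x, 'k, 'b \<times> 'c) vbundle" where
  "direct_sum \<xi> \<eta> =
     \<lparr>vtotal = subtopology (prod_topology (vtotal \<xi>) (vtotal \<eta>)) {(a, b). vproj \<xi> a = vproj \<eta> b},
      vproj = (\<lambda>(a, b). vproj \<xi> a),
      vadd = (\<lambda>(a, b) (a', b'). (vadd \<xi> a a', vadd \<eta> b b')),
      vscale = (\<lambda>c (a, b). (vscale \<xi> c a, vscale \<eta> c b))\<rparr>"

definition product_bundle ::
    "'x topology \<Rightarrow> 'v topology \<Rightarrow> ('v \<Rightarrow> 'v \<Rightarrow> 'v) \<Rightarrow> ('k::real_or_complex \<Rightarrow> 'v \<Rightarrow> 'v) \<Rightarrow>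
     ('x, 'k, 'x \<times> 'v) vbundle" where
  "product_bundle X T add scl =
     \<lparr>vtotal = prod_topology X T,
      vproj = fst,
      vadd = (\<lambda>(x, u) (y, v). (x, add u v)),
      vscale = (\<lambda>c (x, u). (x, scl c u))\<rparr>"

abbreviation \<Theta> ::
    "'x topology \<Rightarrow> ('k::real_or_complex \<Rightarrow> 'e::real_normed_vector \<Rightarrow> 'e) \<Rightarrow>
     ('x, 'k, 'x \<times> 'e) vbundle" where
  "\<Theta> X scaleK \<equiv> product_bundle X euclidean (+) scaleK"

text \<open>A family of subspaces of the fibres of the product bundle, with the induced structure.\<close>

definition restrict_bundle ::
    "'x topology \<Rightarrow> ('k::real_or_complex \<Rightarrow> 'e::real_normed_vector \<Rightarrow> 'e) \<Rightarrow> ('x \<Rightarrow> 'e set) \<Rightarrow>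
     ('x, 'k, 'x \<times> 'e) vbundle" where
  "restrict_bundle X scaleK V =
     (\<Theta> X scaleK)\<lparr>vtotal := subtopology (vtotal (\<Theta> X scaleK)) {(x, u). u \<in> V x}\<rparr>"

definition finite_dim_subbundle ::
    "'x topology \<Rightarrow> ('k::real_or_complex \<Rightarrow> 'e::real_normed_vector \<Rightarrow> 'e) \<Rightarrow> ('x \<Rightarrow> 'e set) \<Rightarrow> bool"
  where
  "finite_dim_subbundle X scaleK V \<longleftrightarrow>
     (\<forall>x \<in> topspace X. module.subspace scaleK (V x) \<and> finite_dim scaleK (V x)) \<and>
     vector_bundle X (restrict_bundle X scaleK V)"

section \<open>The product bundle of a quotient space\<close>

definition coset :: "'e::real_normed_vector set \<Rightarrow> 'e \<Rightarrow> 'e set" where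
  "coset F u = (\<lambda>w. u + w) ` F"

definition quotient_top :: "'e::real_normed_vector set \<Rightarrow> 'e set topology" where
  "quotient_top F = topology (\<lambda>W. W \<subseteq> range (coset F) \<and> open (coset F -` W))"

lemma openin_quotient_top:
  "openin (quotient_top F) W \<longleftrightarrow> W \<subseteq> range (coset F) \<and> open (coset F -` W)"
proof -
  have "istopology (\<lambda>W. W \<subseteq> range (coset F) \<and> open (coset F -` W))"
    by (auto simp: istopology_def vimage_Union intro!: open_Int open_UN)
  then show ?thesis
    by (simp add: quotient_top_def)
qed

definition quotient_add :: "'e::real_normed_vector set \<Rightarrow> 'e set \<Rightarrow> 'e set" where
  "quotient_add A B = {a + b | a b. a \<in> A \<and> b \<in> B}"

text \<open>The summand from \<open>F\<close> matters only for \<open>c = 0\<close>, where the result has to be \<open>F\<close> itself.\<close>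

definition quotient_scale ::
    "('k::real_or_complex \<Rightarrow> 'e::real_normed_vector \<Rightarrow> 'e) \<Rightarrow> 'e set \<Rightarrow> 'k \<Rightarrow> 'e set \<Rightarrow> 'e set" where
  "quotient_scale scaleK F c A = {scaleK c a + w | a w. a \<in> A \<and> w \<in> F}"

definition \<Theta>_quotient ::
    "'x topology \<Rightarrow> ('k::real_or_complex \<Rightarrow> 'e::real_normed_vector \<Rightarrow> 'e) \<Rightarrow> 'e set \<Rightarrow>
     ('x, 'k, 'x \<times> 'e set) vbundle" where
  "\<Theta>_quotient X scaleK F =
     product_bundle X (quotient_top F) quotient_add (quotient_scale scaleK F)"

section \<open>The Grothendieck group of a commutative monoid\<close>

text \<open>The class of \<open>(a, b)\<close> stands for the formal difference of \<open>a\<close> and \<open>b\<close>. Groups are written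
  multiplicatively, as in the library.\<close>

definition groth_rel :: "('a, 'm) monoid_scheme \<Rightarrow> (('a \<times> 'a) \<times> ('a \<times> 'a)) set" where
  "groth_rel M =
     {((a, b), (c, d)) | a b c d.
        a \<in> carrier M \<and> b \<in> carrier M \<and> c \<in> carrier M \<and> d \<in> carrier M \<and>
        (\<exists>k \<in> carrier M. a \<otimes>\<^bsub>M\<^esub> d \<otimes>\<^bsub>M\<^esub> k = c \<otimes>\<^bsub>M\<^esub> b \<otimes>\<^bsub>M\<^esub> k)}"

definition groth :: "('a, 'm) monoid_scheme \<Rightarrow> ('a \<times> 'a) set monoid" where
  "groth M =
     \<lparr>carrier = (carrier M \<times> carrier M) // groth_rel M,
      mult = (\<lambda>A B. \<Union>(a, b) \<in> A. \<Union>(c, d) \<in> B. groth_rel M `` {(a \<otimes>\<^bsub>M\<^esub> c, b \<otimes>\<^bsub>M\<^esub> d)}),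
      one = groth_rel M `` {(\<one>\<^bsub>M\<^esub>, \<one>\<^bsub>M\<^esub>)}\<rparr>"

definition groth_incl :: "('a, 'm) monoid_scheme \<Rightarrow> 'a \<Rightarrow> ('a \<times> 'a) set" where
  "groth_incl M a = groth_rel M `` {(a, \<one>\<^bsub>M\<^esub>)}"

context comm_monoid
begin

lemma groth_rel_iff:
  "((a, b), (c, d)) \<in> groth_rel G \<longleftrightarrow>
     a \<in> carrier G \<and> b \<in> carrier G \<and> c \<in> carrier G \<and> d \<in> carrier G \<and>
     (\<exists>k \<in> carrier G. a \<otimes> d \<otimes> k = c \<otimes> b \<otimes> k)"
  by (auto simp: groth_rel_def)

lemma equiv_groth_rel: "equiv (carrier G \<times> carrier G) (groth_rel G)"
proof (rule equivI)
  show "groth_rel G \<subseteq> (carrier G \<times> carrier G) \<times> carrier G \<times> carrier G"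
    by (auto simp: groth_rel_def)
  show "refl_on (carrier G \<times> carrier G) (groth_rel G)"
    by (auto simp: refl_on_def groth_rel_iff)
  show "sym (groth_rel G)"
    by (auto simp: sym_def groth_rel_iff intro: sym)
  show "trans (groth_rel G)"
  proof (rule transI, clarify)
    fix a b c d e f
    assume "((a, b), (c, d)) \<in> groth_rel G" "((c, d), (e, f)) \<in> groth_rel G"
    then obtain k l where
      car: "a \<in> carrier G" "b \<in> carrier G" "c \<in> carrier G" "d \<in> carrier G" "e \<in> carrier G"
        "f \<in> carrier G" "k \<in> carrier G" "l \<in> carrier G"
      and k: "a \<otimes> d \<otimes> k = c \<otimes> b \<otimes> k" and l: "c \<otimes> f \<otimes> l = e \<otimes> d \<otimes> l"
      by (auto simp: groth_rel_iff)
    have "a \<otimes> f \<otimes> (d \<otimes> k \<otimes> l) = (a \<otimes> d \<otimes> k) \<otimes> (f \<otimes> l)"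
      using car by (simp add: m_ac)
    also have "\<dots> = (c \<otimes> f \<otimes> l) \<otimes> (b \<otimes> k)"
      using car by (simp add: k m_ac)
    also have "\<dots> = e \<otimes> b \<otimes> (d \<otimes> k \<otimes> l)"
      using car by (simp add: l m_ac)
    finally show "((a, b), (e, f)) \<in> groth_rel G"
      using car by (auto simp: groth_rel_iff intro!: bexI[of _ "d \<otimes> k \<otimes> l"])
  qed
qed

lemma groth_mult_class:
  assumes "a \<in> carrier G" "b \<in> carrier G" "c \<in> carrier G" "d \<in> carrier G"
  shows "groth_rel G `` {(a, b)} \<otimes>\<^bsub>groth G\<^esub> groth_rel G `` {(c, d)} =
    groth_rel G `` {(a \<otimes> c, b \<otimes> d)}"
proof -
  let ?f = "\<lambda>(a, b) (c, d). groth_rel G `` {(a \<otimes> c, b \<otimes> d)}"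
  have "congruent2 (groth_rel G) (groth_rel G) ?f"
  proof (rule congruent2I', clarify)
    fix a b a' b' c d c' d'
    assume "((a, b), (a', b')) \<in> groth_rel G" "((c, d), (c', d')) \<in> groth_rel G"
    then obtain k l where
      car: "a \<in> carrier G" "b \<in> carrier G" "a' \<in> carrier G" "b' \<in> carrier G"
        "c \<in> carrier G" "d \<in> carrier G" "c' \<in> carrier G" "d' \<in> carrier G"
        "k \<in> carrier G" "l \<in> carrier G"
      and k: "a \<otimes> b' \<otimes> k = a' \<otimes> b \<otimes> k" and l: "c \<otimes> d' \<otimes> l = c' \<otimes> d \<otimes> l"
      by (auto simp: groth_rel_iff)
    have "(a \<otimes> c) \<otimes> (b' \<otimes> d') \<otimes> (k \<otimes> l) = (a \<otimes> b' \<otimes> k) \<otimes> (c \<otimes> d' \<otimes> l)"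
      using car by (simp add: m_ac)
    also have "\<dots> = (a' \<otimes> c') \<otimes> (b \<otimes> d) \<otimes> (k \<otimes> l)"
      unfolding k l using car by (simp add: m_ac)
    finally have "((a \<otimes> c, b \<otimes> d), (a' \<otimes> c', b' \<otimes> d')) \<in> groth_rel G"
      using car by (auto simp: groth_rel_iff intro!: bexI[of _ "k \<otimes> l"])
    then show "groth_rel G `` {(a \<otimes> c, b \<otimes> d)} = groth_rel G `` {(a' \<otimes> c', b' \<otimes> d')}"
      by (rule equiv_class_eq[OF equiv_groth_rel])
  qed
  then have "(\<Union>p \<in> groth_rel G `` {(a, b)}. \<Union>q \<in> groth_rel G `` {(c, d)}. ?f p q) =
      ?f (a, b) (c, d)"
    using assms by (intro UN_equiv_class2[OF equiv_groth_rel equiv_groth_rel]) auto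
  then show ?thesis
    by (simp add: groth_def case_prod_beta')
qed

lemma groth_comm_group: "comm_group (groth G)"
proof -
  have car: "\<exists>a b. a \<in> carrier G \<and> b \<in> carrier G \<and> A = groth_rel G `` {(a, b)}"
    if "A \<in> carrier (groth G)" for A
    using that by (auto simp: groth_def quotient_def)
  have class_car: "groth_rel G `` {(a, b)} \<in> carrier (groth G)"
    if "a \<in> carrier G" "b \<in> carrier G" for a b
    using that by (auto simp: groth_def quotient_def)
  have one: "\<one>\<^bsub>groth G\<^esub> = groth_rel G `` {(\<one>, \<one>)}"
    by (simp add: groth_def)
  show ?thesis
  proof (rule comm_groupI)
    fix A B assume "A \<in> carrier (groth G)" "B \<in> carrier (groth G)"
    then show "A \<otimes>\<^bsub>groth G\<^esub> B \<in> carrier (groth G)"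
      by (metis car class_car groth_mult_class m_closed)
  next
    show "\<one>\<^bsub>groth G\<^esub> \<in> carrier (groth G)"
      by (simp add: one class_car)
  next
    fix A B C
    assume "A \<in> carrier (groth G)" "B \<in> carrier (groth G)" "C \<in> carrier (groth G)"
    then obtain a b c d e f where
      "a \<in> carrier G" "b \<in> carrier G" "A = groth_rel G `` {(a, b)}"
      "c \<in> carrier G" "d \<in> carrier G" "B = groth_rel G `` {(c, d)}"
      "e \<in> carrier G" "f \<in> carrier G" "C = groth_rel G `` {(e, f)}"
      by (meson car)
    then show "A \<otimes>\<^bsub>groth G\<^esub> B \<otimes>\<^bsub>groth G\<^esub> C = A \<otimes>\<^bsub>groth G\<^esub> (B \<otimes>\<^bsub>groth G\<^esub> C)"
      by (simp add: groth_mult_class m_assoc)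
  next
    fix A B
    assume "A \<in> carrier (groth G)" "B \<in> carrier (groth G)"
    then obtain a b c d where
      "a \<in> carrier G" "b \<in> carrier G" "A = groth_rel G `` {(a, b)}"
      "c \<in> carrier G" "d \<in> carrier G" "B = groth_rel G `` {(c, d)}"
      by (meson car)
    then show "A \<otimes>\<^bsub>groth G\<^esub> B = B \<otimes>\<^bsub>groth G\<^esub> A"
      by (simp add: groth_mult_class m_comm)
  next
    fix A
    assume "A \<in> carrier (groth G)"
    then obtain a b where
      "a \<in> carrier G" "b \<in> carrier G" "A = groth_rel G `` {(a, b)}"
      by (meson car)
    then show "\<one>\<^bsub>groth G\<^esub> \<otimes>\<^bsub>groth G\<^esub> A = A"
      by (simp add: one groth_mult_class)
  next
    fix A
    assume "A \<in> carrier (groth G)"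
    then obtain a b where ab:
      "a \<in> carrier G" "b \<in> carrier G" "A = groth_rel G `` {(a, b)}"
      by (meson car)
    have "((b \<otimes> a, a \<otimes> b), (\<one>, \<one>)) \<in> groth_rel G"
      using ab by (auto simp: groth_rel_iff m_comm intro!: bexI[of _ "\<one>"])
    then have "groth_rel G `` {(b, a)} \<otimes>\<^bsub>groth G\<^esub> A = \<one>\<^bsub>groth G\<^esub>"
      using ab by (simp add: one groth_mult_class equiv_class_eq[OF equiv_groth_rel])
    then show "\<exists>B \<in> carrier (groth G). B \<otimes>\<^bsub>groth G\<^esub> A = \<one>\<^bsub>groth G\<^esub>"
      using ab class_car by blast
  qed
qed

end

section \<open>The group \<open>K(X)\<close>\<close>

text \<open>The isomorphism classes of all vector bundles over \<open>X\<close>, of whatever total space type, are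
  represented by bundles with total space in the type \<open>'x \<times> (nat \<Rightarrow> 'k)\<close>: choosing linear isomorphisms of the
  fibres with coordinate spaces embeds the total space as a set in that type, and the topology and
  the fibrewise operations can be transported. The total space of a representative is not required
  to carry the product topology.\<close>

type_synonym ('x, 'k) std_vbundle = "('x, 'k, 'x \<times> (nat \<Rightarrow> 'k)) vbundle"

definition iso_class ::
    "'x topology \<Rightarrow> ('x, 'k::real_or_complex, 'b) vbundle \<Rightarrow> ('x, 'k) std_vbundle set" where
  "iso_class X \<xi> = {\<eta>. vector_bundle X \<eta> \<and> isomorphic_bundles \<eta> \<xi>}"

definition Vect :: "'x topology \<Rightarrow> ('x, 'k::real_or_complex) std_vbundle set monoid" where
  "Vect X =
     \<lparr>carrier = {iso_class X \<xi> | \<xi> :: ('x, 'k) std_vbundle. vector_bundle X \<xi>},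
      mult = (\<lambda>A B. \<Union>\<xi> \<in> A. \<Union>\<eta> \<in> B. iso_class X (direct_sum \<xi> \<eta>)),
      one = iso_class X
        (product_bundle X (coord_space 0 :: (nat \<Rightarrow> 'k) topology)
          (\<lambda>a b i. a i + b i) (\<lambda>c a i. c * a i))\<rparr>"

type_synonym ('x, 'k) K_elem =
  "(('x, 'k) std_vbundle set \<times> ('x, 'k) std_vbundle set) set"

definition K_group :: "'x topology \<Rightarrow> ('x, 'k::real_or_complex) K_elem monoid" where
  "K_group X = groth (Vect X)"

definition K_class ::
    "'x topology \<Rightarrow> ('x, 'k::real_or_complex, 'b) vbundle \<Rightarrow> ('x, 'k) K_elem" where
  "K_class X \<xi> = groth_incl (Vect X) (iso_class X \<xi>)"

definition K_diff ::
    "'x topology \<Rightarrow> ('x, 'k::real_or_complex, 'b) vbundle \<Rightarrow> ('x, 'k, 'c) vbundle \<Rightarrow>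
     ('x, 'k) K_elem" where
  "K_diff X \<xi> \<eta> = K_class X \<xi> \<otimes>\<^bsub>K_group X\<^esub> inv\<^bsub>K_group X\<^esub> (K_class X \<eta>)"

section \<open>The index bundle of a Fredholm morphism\<close>

definition transversal_subbundle ::
    "'x topology \<Rightarrow> ('k::real_or_complex \<Rightarrow> 'e::banach \<Rightarrow> 'e) \<Rightarrow> ('x \<Rightarrow> 'e \<Rightarrow>\<^sub>L 'e) \<Rightarrow>
     ('x \<Rightarrow> 'e set) \<Rightarrow> bool" where
  "transversal_subbundle X scaleK L V \<longleftrightarrow>
     finite_dim_subbundle X scaleK V \<and>
     (\<forall>x \<in> topspace X. {blinfun_apply (L x) u + v | u v. v \<in> V x} = UNIV)"

definition preimage_family :: "('x \<Rightarrow> 'e::banach \<Rightarrow>\<^sub>L 'e) \<Rightarrow> ('x \<Rightarrow> 'e set) \<Rightarrow> 'x \<Rightarrow> 'e set" where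
  "preimage_family L V x = {u. blinfun_apply (L x) u \<in> V x}"

definition index_bundle ::
    "'x topology \<Rightarrow> ('k::real_or_complex \<Rightarrow> 'e::banach \<Rightarrow> 'e) \<Rightarrow> ('x \<Rightarrow> 'e \<Rightarrow>\<^sub>L 'e) \<Rightarrow>
     ('x, 'k) K_elem" where
  "index_bundle X scaleK L =
     (let V = (SOME V. transversal_subbundle X scaleK L V)
      in K_diff X (restrict_bundle X scaleK (preimage_family L V)) (restrict_bundle X scaleK V))"

end

theory Submission
  imports Defs
begin

text \<open>Let \<open>Q x = I - P x\<close>, and let \<open>S x\<close> be \<open>P x\<close> followed by the inverse of \<open>L x : E1 \<rightarrow> im (P x)\<close>; it is
  bounded by Baire's theorem and depends continuously on \<open>x\<close>. Then \<open>pr = I - S x1 \<circ> L x1\<close>, for any one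
  point \<open>x1\<close>, is a projection with kernel \<open>E1\<close>, so that \<open>\<Theta>(E/E1)\<close> is isomorphic to \<open>\<Theta>(im pr)\<close>.

  Given any transversal subbundle \<open>V\<close>, consider all triples \<open>(u, v, w)\<close> with \<open>L x u = v + w\<close>, \<open>v \<in> V x\<close> and
  \<open>w \<in> im (Q x)\<close>. The map \<open>(u, v, w) \<mapsto> (pr u, v)\<close> identifies them with \<open>\<Theta>(im pr) \<oplus> V\<close>, the inverse
  being given by \<open>u = r + S x (v - L x r)\<close>. On the other hand \<open>(u, v, w) \<mapsto> w\<close> is onto \<open>im Q\<close> with kernel
  \<open>E(L, V)\<close>, and it splits because local linear sections can be glued by a partition of unity. Hence
  \<open>E(L, V) \<oplus> im Q\<close> and \<open>\<Theta>(E/E1) \<oplus> V\<close> are isomorphic, which is the asserted identity in \<open>K(X)\<close>.\<close>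

section \<open>Charts and isomorphisms of vector bundles\<close>

text \<open>\<open>index_bundle\<close> picks its transversal subbundle by \<open>SOME\<close>, so
  the comparison has to work for every \<open>V\<close>, known only to be a transversal subbundle;
  the choice is legitimate because the ranges of \<open>Q x\<close> are themselves transversal, by
  \<open>u = L x (S x u) + Q x u\<close>. That E(L, V) is a vector bundle must be proved as well. It
  is identified with the kernel of the map \<open>(r, v) \<mapsto> Q x (L x r - v)\<close> on
  \<Theta>(im pr) \<oplus> V. Since \<open>Q x\<close> annihilates the image of \<open>E1\<close>
  under \<open>L x\<close>, replacing \<open>u\<close> by \<open>pr u\<close> does not change
  \<open>Q x (L x u - v)\<close>, so transversality makes this map onto im Q. One and the same
  selection of chart coordinates then gives charts of the kernel and local sections of the map. The
  point \<open>x1\<close> is fixed so that im pr does not vary with \<open>x\<close> and its bundle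
  is a product; an empty \<open>X\<close> has no such point and is treated separately.\<close>

lemma topspace_coord_space:
  "topspace (coord_space n :: (nat \<Rightarrow> 'k::real_or_complex) topology) = {a. \<forall>i\<ge>n. a i = 0}"
  by (simp add: coord_space_def)

lemma continuous_map_coord_space:
  "continuous_map Z (coord_space n :: (nat \<Rightarrow> 'k::real_or_complex) topology) f \<longleftrightarrow>
     (\<forall>i. continuous_map Z euclidean (\<lambda>z. f z i)) \<and> (\<forall>z\<in>topspace Z. \<forall>i\<ge>n. f z i = 0)"
  by (auto simp: coord_space_def continuous_map_in_subtopology continuous_map_componentwise_UNIV Pi_iff)

lemma continuous_map_coord:
  "continuous_map (coord_space n :: (nat \<Rightarrow> 'k::real_or_complex) topology) euclidean (\<lambda>a. a i)"
  using continuous_map_coord_space[of "coord_space n :: (nat \<Rightarrow> 'k) topology" n "\<lambda>a. a"] by simp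

lemma vproj_in_base:
  "vector_bundle X \<xi> \<Longrightarrow> e \<in> topspace (vtotal \<xi>) \<Longrightarrow> vproj \<xi> e \<in> topspace X"
  by (auto simp: vector_bundle_def continuous_map_def)

lemma vscale_closed:
  assumes "vector_bundle X \<xi>" "e \<in> topspace (vtotal \<xi>)"
  shows "vscale \<xi> c e \<in> topspace (vtotal \<xi>)" "vproj \<xi> (vscale \<xi> c e) = vproj \<xi> e"
  using assms by (auto simp: vector_bundle_def)

lemma vadd_closed:
  assumes "vector_bundle X \<xi>" "e \<in> topspace (vtotal \<xi>)" "e' \<in> topspace (vtotal \<xi>)"
    "vproj \<xi> e' = vproj \<xi> e"
  shows "vadd \<xi> e e' \<in> topspace (vtotal \<xi>)" "vproj \<xi> (vadd \<xi> e e') = vproj \<xi> e"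
  using assms by (auto simp: vector_bundle_def)

text \<open>A local trivialization with its inverse \<psi> made explicit. The base component is
  forced to be \<open>vproj\<close>, so only the fibre coordinates \<open>c\<close> are kept, and
  continuity can be checked one coordinate at a time. \<psi> is continuous into the whole total
  space; \<open>vproj_inv\<close> places its values over \<open>U\<close>.\<close>

locale bundle_chart =
  fixes X :: "'x topology" and \<xi> :: "('x, 'k::real_or_complex, 'b) vbundle" and U :: "'x set" and n :: nat
    and c :: "'b \<Rightarrow> nat \<Rightarrow> 'k" and \<psi> :: "'x \<times> (nat \<Rightarrow> 'k) \<Rightarrow> 'b"
  assumes base: "U \<subseteq> topspace X"
    and continuous_vproj: "continuous_map (vtotal \<xi>) X (vproj \<xi>)"
    and continuous_coord: "\<And>i. continuous_map (subtopology (vtotal \<xi>) {e. vproj \<xi> e \<in> U}) euclidean (\<lambda>e. c e i)"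
    and coord_zero: "\<And>e i. \<lbrakk>e \<in> topspace (vtotal \<xi>); vproj \<xi> e \<in> U; i \<ge> n\<rbrakk> \<Longrightarrow> c e i = 0"
    and continuous_inv: "continuous_map (prod_topology (subtopology X U) (coord_space n)) (vtotal \<xi>) \<psi>"
    and vproj_inv: "\<And>x a. \<lbrakk>x \<in> U; \<And>i. i \<ge> n \<Longrightarrow> a i = 0\<rbrakk> \<Longrightarrow> vproj \<xi> (\<psi> (x, a)) = x"
    and coord_inv: "\<And>x a. \<lbrakk>x \<in> U; \<And>i. i \<ge> n \<Longrightarrow> a i = 0\<rbrakk> \<Longrightarrow> c (\<psi> (x, a)) = a"
    and inv_coord: "\<And>e. \<lbrakk>e \<in> topspace (vtotal \<xi>); vproj \<xi> e \<in> U\<rbrakk> \<Longrightarrow> \<psi> (vproj \<xi> e, c e) = e"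
    and coord_scale: "\<And>e k. \<lbrakk>e \<in> topspace (vtotal \<xi>); vproj \<xi> e \<in> U\<rbrakk> \<Longrightarrow> c (vscale \<xi> k e) = (\<lambda>i. k * c e i)"
    and coord_add: "\<And>e e'. \<lbrakk>e \<in> topspace (vtotal \<xi>); e' \<in> topspace (vtotal \<xi>); vproj \<xi> e \<in> U; vproj \<xi> e' = vproj \<xi> e\<rbrakk>
       \<Longrightarrow> c (vadd \<xi> e e') = (\<lambda>i. c e i + c e' i)"
begin

lemma inv_in_total: "\<lbrakk>x \<in> U; \<And>i. i \<ge> n \<Longrightarrow> a i = 0\<rbrakk> \<Longrightarrow> \<psi> (x, a) \<in> topspace (vtotal \<xi>)"
  using continuous_inv base by (force simp: continuous_map_def topspace_coord_space)

lemma local_trivialization: "local_trivialization X \<xi> U n (\<lambda>e. (vproj \<xi> e, c e))"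
proof -
  let ?Z = "subtopology (vtotal \<xi>) {e. vproj \<xi> e \<in> U}"
  have "homeomorphic_maps ?Z (prod_topology (subtopology X U) (coord_space n)) (\<lambda>e. (vproj \<xi> e, c e)) \<psi>"
    unfolding homeomorphic_maps_def
  proof (intro conjI ballI)
    show "continuous_map ?Z (prod_topology (subtopology X U) (coord_space n)) (\<lambda>e. (vproj \<xi> e, c e))"
      using continuous_vproj continuous_coord coord_zero
      by (auto simp: continuous_map_pairwise o_def continuous_map_in_subtopology continuous_map_coord_space
          continuous_map_from_subtopology)
    show "continuous_map (prod_topology (subtopology X U) (coord_space n)) ?Z \<psi>"
      using continuous_inv vproj_inv by (auto simp: continuous_map_in_subtopology topspace_coord_space)
  qed (use vproj_inv coord_inv inv_coord in \<open>auto simp: topspace_coord_space\<close>)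
  then show ?thesis
    unfolding local_trivialization_def
    using coord_scale coord_add by (auto intro: homeomorphic_maps_imp_map)
qed

lemma restrict:
  assumes "U' \<subseteq> U"
  shows "bundle_chart X \<xi> U' n c \<psi>"
proof
  show "continuous_map (subtopology (vtotal \<xi>) {e. vproj \<xi> e \<in> U'}) euclidean (\<lambda>e. c e i)" for i
    by (rule continuous_map_from_subtopology_mono[OF continuous_coord]) (use assms in auto)
  have "prod_topology (subtopology X U') (coord_space n :: (nat \<Rightarrow> 'k) topology) =
      subtopology (prod_topology (subtopology X U) (coord_space n)) (U' \<times> UNIV)"
    by (simp add: subtopology_Times subtopology_subtopology Int_absorb1 assms)
  then show "continuous_map (prod_topology (subtopology X U') (coord_space n)) (vtotal \<xi>) \<psi>"
    using continuous_inv by (simp add: continuous_map_from_subtopology)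
qed (use assms base continuous_vproj coord_zero vproj_inv coord_inv inv_coord coord_scale coord_add in
    \<open>auto simp: subset_iff\<close>)

end

lemma vector_bundleI:
  fixes \<xi> :: "('x, 'k::real_or_complex, 'b) vbundle"
  assumes "continuous_map (vtotal \<xi>) X (vproj \<xi>)"
    and "\<And>c e. e \<in> topspace (vtotal \<xi>) \<Longrightarrow> vscale \<xi> c e \<in> topspace (vtotal \<xi>) \<and> vproj \<xi> (vscale \<xi> c e) = vproj \<xi> e"
    and "\<And>e e'. \<lbrakk>e \<in> topspace (vtotal \<xi>); e' \<in> topspace (vtotal \<xi>); vproj \<xi> e' = vproj \<xi> e\<rbrakk> \<Longrightarrow>
        vadd \<xi> e e' \<in> topspace (vtotal \<xi>) \<and> vproj \<xi> (vadd \<xi> e e') = vproj \<xi> e"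
    and "\<And>x. x \<in> topspace X \<Longrightarrow> \<exists>U n c \<psi>. openin X U \<and> x \<in> U \<and> bundle_chart X \<xi> U n c \<psi>"
  shows "vector_bundle X \<xi>"
  unfolding vector_bundle_def
proof (intro conjI ballI)
  fix x assume "x \<in> topspace X"
  from assms(4)[OF this] obtain U n c \<psi> where "openin X U" "x \<in> U" "bundle_chart X \<xi> U n c \<psi>"
    by blast
  then show "\<exists>U n \<phi>. openin X U \<and> x \<in> U \<and> local_trivialization X \<xi> U n \<phi>"
    using bundle_chart.local_trivialization by meson
qed (use assms(1-3) in auto)

lemma vector_bundle_chartE:
  fixes \<xi> :: "('x, 'k::real_or_complex, 'b) vbundle"
  assumes \<xi>: "vector_bundle X \<xi>" and x: "x \<in> topspace X"
  obtains U n c \<psi> where "openin X U" "x \<in> U" "bundle_chart X \<xi> U n c \<psi>"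
proof -
  obtain U n \<phi> where oU: "openin X U" "x \<in> U" and lt: "local_trivialization X \<xi> U n \<phi>"
    using \<xi> x by (auto simp: vector_bundle_def)
  have U: "U \<subseteq> topspace X" using oU by (simp add: openin_subset)
  let ?Z = "subtopology (vtotal \<xi>) {e. vproj \<xi> e \<in> U}"
  let ?T = "prod_topology (subtopology X U) (coord_space n) :: ('x \<times> (nat \<Rightarrow> 'k)) topology"
  from lt have hm: "homeomorphic_map ?Z ?T \<phi>"
    and lin: "\<And>e. \<lbrakk>e \<in> topspace (vtotal \<xi>); vproj \<xi> e \<in> U\<rbrakk> \<Longrightarrow>
        fst (\<phi> e) = vproj \<xi> e \<and>
        (\<forall>c. snd (\<phi> (vscale \<xi> c e)) = (\<lambda>i. c * snd (\<phi> e) i)) \<and>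
        (\<forall>e' \<in> topspace (vtotal \<xi>). vproj \<xi> e' = vproj \<xi> e \<longrightarrow>
           snd (\<phi> (vadd \<xi> e e')) = (\<lambda>i. snd (\<phi> e) i + snd (\<phi> e') i))"
    by (auto simp: local_trivialization_def)
  from hm obtain \<psi> where h: "homeomorphic_maps ?Z ?T \<phi> \<psi>"
    by (auto simp: homeomorphic_map_maps)
  then have cphi: "continuous_map ?Z ?T \<phi>" and cpsi: "continuous_map ?T ?Z \<psi>"
    and i1: "\<And>e. e \<in> topspace ?Z \<Longrightarrow> \<psi> (\<phi> e) = e"
    and i2: "\<And>p. p \<in> topspace ?T \<Longrightarrow> \<phi> (\<psi> p) = p"
    by (auto simp: homeomorphic_maps_def)
  have csnd: "continuous_map ?Z (coord_space n) (\<lambda>e. snd (\<phi> e))"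
    using continuous_map_snd_of[OF cphi] by (simp add: o_def)
  have tZ: "e \<in> topspace ?Z \<longleftrightarrow> e \<in> topspace (vtotal \<xi>) \<and> vproj \<xi> e \<in> U" for e
    by auto
  have inv: "vproj \<xi> (\<psi> (x, a)) = x" "snd (\<phi> (\<psi> (x, a))) = a"
    if "x \<in> U" "\<And>i. i \<ge> n \<Longrightarrow> a i = 0" for x a
  proof -
    have t: "(x, a) \<in> topspace ?T"
      using that U by (auto simp: topspace_coord_space)
    have "\<psi> (x, a) \<in> topspace ?Z"
      using cpsi t by (auto simp: continuous_map_def)
    then show "vproj \<xi> (\<psi> (x, a)) = x" "snd (\<phi> (\<psi> (x, a))) = a"
      using lin i2[OF t] tZ by (metis fst_conv snd_conv)+
  qed
  have "bundle_chart X \<xi> U n (\<lambda>e. snd (\<phi> e)) \<psi>"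
  proof
    show "continuous_map ?T (vtotal \<xi>) \<psi>"
      using cpsi by (simp add: continuous_map_in_subtopology)
    show "\<psi> (vproj \<xi> e, snd (\<phi> e)) = e"
      if "e \<in> topspace (vtotal \<xi>)" "vproj \<xi> e \<in> U" for e
      using i1 tZ that lin by (metis prod.collapse)
    show "continuous_map (vtotal \<xi>) X (vproj \<xi>)" using \<xi> by (simp add: vector_bundle_def)
    show "continuous_map ?Z euclidean (\<lambda>e. snd (\<phi> e) i)" for i
      using csnd by (simp add: continuous_map_coord_space)
    show "snd (\<phi> e) i = 0" if "e \<in> topspace (vtotal \<xi>)" "vproj \<xi> e \<in> U" "i \<ge> n" for e i
      using csnd that by (simp add: continuous_map_coord_space)
  qed (use U lin inv in auto)
  then show thesis using that oU by blast
qed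

text \<open>Nothing is assumed about \<eta> beyond the isomorphism, so even the closure of its
  operations has to be derived: they are the operations of \<xi> conjugated by \<open>f\<close> and
  its inverse \<open>g\<close>. Charts are carried over by composing with \<open>g\<close>.\<close>

lemma vector_bundle_transport:
  assumes \<xi>: "vector_bundle X \<xi>" and f: "bundle_iso \<xi> \<eta> f"
  shows "vector_bundle X \<eta>"
proof -
  from f have hm: "homeomorphic_map (vtotal \<xi>) (vtotal \<eta>) f" by (simp add: bundle_iso_def)
  then obtain g where h: "homeomorphic_maps (vtotal \<xi>) (vtotal \<eta>) f g"
    by (auto simp: homeomorphic_map_maps)
  note fD = f[unfolded bundle_iso_def]
  have cg: "continuous_map (vtotal \<eta>) (vtotal \<xi>) g"
    and fg: "\<And>e. e \<in> topspace (vtotal \<eta>) \<Longrightarrow> f (g e) = e"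
    and gf: "\<And>e. e \<in> topspace (vtotal \<xi>) \<Longrightarrow> g (f e) = e"
    and cf: "continuous_map (vtotal \<xi>) (vtotal \<eta>) f"
    using h by (auto simp: homeomorphic_maps_def)
  have gt: "g e \<in> topspace (vtotal \<xi>)" if "e \<in> topspace (vtotal \<eta>)" for e
    using cg that by (auto simp: continuous_map_def)
  have ft: "f e \<in> topspace (vtotal \<eta>)" if "e \<in> topspace (vtotal \<xi>)" for e
    using cf that by (auto simp: continuous_map_def)
  have gp: "vproj \<xi> (g e) = vproj \<eta> e" if "e \<in> topspace (vtotal \<eta>)" for e
    using fD gt[OF that] fg[OF that] by metis
  have sc: "vscale \<eta> c e = f (vscale \<xi> c (g e))" if "e \<in> topspace (vtotal \<eta>)" for c e
    using fD gt[OF that] fg[OF that] by metis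
  have ad: "vadd \<eta> e e' = f (vadd \<xi> (g e) (g e'))"
    if "e \<in> topspace (vtotal \<eta>)" "e' \<in> topspace (vtotal \<eta>)" "vproj \<eta> e' = vproj \<eta> e" for e e'
    using fD gt[OF that(1)] fg[OF that(1)] gt[OF that(2)] fg[OF that(2)] that gp by metis
  have cont: "continuous_map (vtotal \<eta>) X (vproj \<eta>)"
    by (rule continuous_map_eq[of _ _ "vproj \<xi> \<circ> g"])
      (use \<xi> cg gp in \<open>auto simp: vector_bundle_def intro: continuous_map_compose\<close>)
  have sc': "vscale \<eta> c e \<in> topspace (vtotal \<eta>)" "vproj \<eta> (vscale \<eta> c e) = vproj \<eta> e"
      "g (vscale \<eta> c e) = vscale \<xi> c (g e)"
    if e: "e \<in> topspace (vtotal \<eta>)" for c e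
  proof -
    have 1: "vscale \<xi> c (g e) \<in> topspace (vtotal \<xi>)" "vproj \<xi> (vscale \<xi> c (g e)) = vproj \<xi> (g e)"
      using vscale_closed[OF \<xi> gt[OF e]] by auto
    then show "vscale \<eta> c e \<in> topspace (vtotal \<eta>)" "vproj \<eta> (vscale \<eta> c e) = vproj \<eta> e"
      "g (vscale \<eta> c e) = vscale \<xi> c (g e)"
      using sc[OF e, of c] ft gf gp[OF e] fD by auto
  qed
  have ad': "vadd \<eta> e e' \<in> topspace (vtotal \<eta>)" "vproj \<eta> (vadd \<eta> e e') = vproj \<eta> e"
      "g (vadd \<eta> e e') = vadd \<xi> (g e) (g e')"
    if e: "e \<in> topspace (vtotal \<eta>)" "e' \<in> topspace (vtotal \<eta>)" "vproj \<eta> e' = vproj \<eta> e" for e e'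
  proof -
    have 1: "vadd \<xi> (g e) (g e') \<in> topspace (vtotal \<xi>)" "vproj \<xi> (vadd \<xi> (g e) (g e')) = vproj \<xi> (g e)"
      using vadd_closed[OF \<xi> gt[OF e(1)] gt[OF e(2)]] gp e by auto
    then show "vadd \<eta> e e' \<in> topspace (vtotal \<eta>)" "vproj \<eta> (vadd \<eta> e e') = vproj \<eta> e"
      "g (vadd \<eta> e e') = vadd \<xi> (g e) (g e')"
      using ad[OF e] ft gf gp[OF e(1)] fD by auto
  qed
  have "\<exists>U n \<phi>. openin X U \<and> x \<in> U \<and> local_trivialization X \<eta> U n \<phi>" if x: "x \<in> topspace X" for x
  proof -
    obtain U n \<phi> where U: "openin X U" "x \<in> U" and lt: "local_trivialization X \<xi> U n \<phi>"
      using \<xi> x by (auto simp: vector_bundle_def)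
    have hm2: "homeomorphic_map (subtopology (vtotal \<eta>) {e. vproj \<eta> e \<in> U})
       (subtopology (vtotal \<xi>) {e. vproj \<xi> e \<in> U}) g"
    proof (rule homeomorphic_map_subtopologies_alt)
      show "homeomorphic_map (vtotal \<eta>) (vtotal \<xi>) g"
        using h homeomorphic_maps_imp_map homeomorphic_maps_sym by blast
    qed (use gp in auto)
    have "local_trivialization X \<eta> U n (\<phi> \<circ> g)"
      unfolding local_trivialization_def
    proof (intro conjI ballI impI allI)
      show "homeomorphic_map (subtopology (vtotal \<eta>) {e. vproj \<eta> e \<in> U})
        (prod_topology (subtopology X U) (coord_space n)) (\<phi> \<circ> g)"
        using hm2 lt by (auto simp: local_trivialization_def intro: homeomorphic_map_compose)
    qed (use lt gt gp sc' ad' in \<open>simp_all add: local_trivialization_def\<close>)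
    then show ?thesis using U by blast
  qed
  then show ?thesis
    unfolding vector_bundle_def using cont sc'(1,2) ad'(1,2) by (intro conjI ballI allI impI) auto
qed

section \<open>Isomorphism of bundles as an equivalence relation\<close>

lemma isomorphic_bundles_refl: "isomorphic_bundles \<xi> \<xi>"
  unfolding isomorphic_bundles_def bundle_iso_def by (rule exI[of _ id]) auto

text \<open>Compatibility of the inverse with the operations uses that sums and multiples stay in
  the total space of \<xi>, where \<open>g\<close> cancels \<open>f\<close>; this is what the bundle
  hypothesis supplies.\<close>

lemma isomorphic_bundles_sym:
  assumes \<xi>: "vector_bundle X \<xi>" and iso: "isomorphic_bundles \<xi> \<eta>"
  shows "isomorphic_bundles \<eta> \<xi>"
proof -
  from iso obtain f where f: "bundle_iso \<xi> \<eta> f" by (auto simp: isomorphic_bundles_def)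
  then obtain g where h: "homeomorphic_maps (vtotal \<xi>) (vtotal \<eta>) f g"
    by (auto simp: homeomorphic_map_maps bundle_iso_def)
  note fD = f[unfolded bundle_iso_def]
  have fg: "\<And>e. e \<in> topspace (vtotal \<eta>) \<Longrightarrow> f (g e) = e"
    and gf: "\<And>e. e \<in> topspace (vtotal \<xi>) \<Longrightarrow> g (f e) = e"
    and gt: "\<And>e. e \<in> topspace (vtotal \<eta>) \<Longrightarrow> g e \<in> topspace (vtotal \<xi>)"
    using h by (auto simp: homeomorphic_maps_def continuous_map_def)
  have gp: "vproj \<xi> (g e) = vproj \<eta> e" if "e \<in> topspace (vtotal \<eta>)" for e
    using fD gt[OF that] fg[OF that] by metis
  have "bundle_iso \<eta> \<xi> g"
    unfolding bundle_iso_def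
  proof (intro conjI ballI allI impI)
    show "homeomorphic_map (vtotal \<eta>) (vtotal \<xi>) g"
      using h homeomorphic_maps_imp_map homeomorphic_maps_sym by blast
    fix e assume e: "e \<in> topspace (vtotal \<eta>)"
    show "vproj \<xi> (g e) = vproj \<eta> e" using gp e by simp
    show "g (vscale \<eta> c e) = vscale \<xi> c (g e)" for c
      using fD gt[OF e] fg[OF e] gf vscale_closed[OF \<xi> gt[OF e]] by metis
    fix e' assume e': "e' \<in> topspace (vtotal \<eta>)" "vproj \<eta> e' = vproj \<eta> e"
    have "vproj \<xi> (g e') = vproj \<xi> (g e)" using gp e e' by simp
    then show "g (vadd \<eta> e e') = vadd \<xi> (g e) (g e')"
      using fD gt[OF e] fg[OF e] gf vadd_closed[OF \<xi> gt[OF e] gt[OF e'(1)]] gt[OF e'(1)] fg[OF e'(1)]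
      by metis
  qed
  then show ?thesis by (auto simp: isomorphic_bundles_def)
qed

lemma isomorphic_bundles_trans:
  assumes "isomorphic_bundles \<xi> \<eta>" "isomorphic_bundles \<eta> \<zeta>"
  shows "isomorphic_bundles \<xi> \<zeta>"
proof -
  from assms obtain f g where f: "bundle_iso \<xi> \<eta> f" and g: "bundle_iso \<eta> \<zeta> g"
    by (auto simp: isomorphic_bundles_def)
  have ft: "f e \<in> topspace (vtotal \<eta>)" if "e \<in> topspace (vtotal \<xi>)" for e
    using f that by (auto simp: bundle_iso_def homeomorphic_map_maps homeomorphic_maps_def continuous_map_def)
  have "bundle_iso \<xi> \<zeta> (g \<circ> f)"
    unfolding bundle_iso_def
    using f g ft by (auto simp: bundle_iso_def intro: homeomorphic_map_compose)
  then show ?thesis by (auto simp: isomorphic_bundles_def)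
qed

lemma vector_bundle_isomorphic:
  "vector_bundle X \<xi> \<Longrightarrow> isomorphic_bundles \<xi> \<eta> \<Longrightarrow> vector_bundle X \<eta>"
  by (auto simp: isomorphic_bundles_def intro: vector_bundle_transport)

lemma iso_class_cong:
  assumes "vector_bundle X \<xi>" "isomorphic_bundles \<xi> \<eta>"
  shows "iso_class X \<xi> = iso_class X \<eta>"
  using assms isomorphic_bundles_sym[OF assms]
  by (auto simp: iso_class_def intro: isomorphic_bundles_trans)

section \<open>Representatives with the standard total space\<close>

lemma ex_std_vbundle:
  fixes \<xi> :: "('x, 'k::real_or_complex, 'b) vbundle"
  assumes \<xi>: "vector_bundle X \<xi>"
  shows "\<exists>\<eta> :: ('x, 'k) std_vbundle. vector_bundle X \<eta> \<and> isomorphic_bundles \<eta> \<xi>"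
proof -
  have "\<forall>x \<in> topspace X. \<exists>p. openin X (fst p) \<and> x \<in> fst p \<and> local_trivialization X \<xi> (fst p) (fst (snd p)) (snd (snd p))"
    using \<xi> by (auto simp: vector_bundle_def)
  then obtain p where p: "\<And>x. x \<in> topspace X \<Longrightarrow>
     openin X (fst (p x)) \<and> x \<in> fst (p x) \<and> local_trivialization X \<xi> (fst (p x)) (fst (snd (p x))) (snd (snd (p x)))"
    by metis
  \<comment> \<open>The chart is chosen separately for each base point, with no continuity in the
    choice. Within one fibre a single chart is used, which is what injectivity and linearity of
    \<open>j\<close> rest on.\<close>
  define j where "j e = (vproj \<xi> e, snd (snd (snd (p (vproj \<xi> e))) e))" for e
  let ?T = "topspace (vtotal \<xi>)"
  have inj: "inj_on j ?T"
  proof (rule inj_onI)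
    fix e e' assume e: "e \<in> ?T" "e' \<in> ?T" "j e = j e'"
    define x where "x = vproj \<xi> e"
    have x': "vproj \<xi> e' = x" using e by (auto simp: j_def x_def)
    have x: "x \<in> topspace X" using vproj_in_base[OF \<xi> e(1)] x_def by simp
    let ?\<phi> = "snd (snd (p x))"
    have lt: "local_trivialization X \<xi> (fst (p x)) (fst (snd (p x))) ?\<phi>" and xU: "x \<in> fst (p x)"
      using p[OF x] by auto
    then have hm: "inj_on ?\<phi> (?T \<inter> {e. vproj \<xi> e \<in> fst (p x)})"
      using homeomorphic_imp_injective_map by (fastforce simp: local_trivialization_def)
    have "fst (?\<phi> e) = fst (?\<phi> e')"
      using lt e xU x' by (auto simp: local_trivialization_def x_def)
    moreover have "snd (?\<phi> e) = snd (?\<phi> e')"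
      using e x' by (auto simp: j_def x_def)
    ultimately have "?\<phi> e = ?\<phi> e'" by (rule prod_eqI)
    then show "e = e'"
      using hm e xU x' by (auto simp: inj_on_def x_def)
  qed
  \<comment> \<open>The topology is carried over along \<open>j\<close>, which becomes a
    homeomorphism onto its image by construction; injectivity makes these images closed under
    intersection.\<close>
  define S where "S = topology (\<lambda>W. \<exists>O'. openin (vtotal \<xi>) O' \<and> W = j ` O')"
  have ist: "istopology (\<lambda>W. \<exists>O'. openin (vtotal \<xi>) O' \<and> W = j ` O')"
    unfolding istopology_def
  proof (intro conjI allI impI)
    fix W W' assume "\<exists>O'. openin (vtotal \<xi>) O' \<and> W = j ` O'" "\<exists>O'. openin (vtotal \<xi>) O' \<and> W' = j ` O'"
    then obtain A B where "openin (vtotal \<xi>) A" "W = j ` A" "openin (vtotal \<xi>) B" "W' = j ` B" by auto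
    moreover then have "j ` A \<inter> j ` B = j ` (A \<inter> B)"
      using inj by (metis inj_on_image_Int openin_subset)
    ultimately show "\<exists>O'. openin (vtotal \<xi>) O' \<and> W \<inter> W' = j ` O'" by auto
  next
    fix \<K> assume "\<forall>K\<in>\<K>. \<exists>O'. openin (vtotal \<xi>) O' \<and> K = j ` O'"
    then obtain F where F: "\<And>K. K \<in> \<K> \<Longrightarrow> openin (vtotal \<xi>) (F K) \<and> j ` F K = K" by metis
    then have "\<Union>\<K> = j ` (\<Union>K\<in>\<K>. F K)" by (simp add: image_UN)
    then show "\<exists>O'. openin (vtotal \<xi>) O' \<and> \<Union>\<K> = j ` O'"
      using F by (intro exI[of _ "\<Union>K\<in>\<K>. F K"]) auto
  qed
  have oS: "openin S W \<longleftrightarrow> (\<exists>O'. openin (vtotal \<xi>) O' \<and> W = j ` O')" for W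
    using ist by (simp add: S_def)
  have tS: "topspace S = j ` ?T"
  proof
    show "topspace S \<subseteq> j ` ?T"
      using openin_topspace[of S] oS openin_subset by (metis image_mono)
    show "j ` ?T \<subseteq> topspace S"
      by (rule openin_subset) (use oS in auto)
  qed
  have hj: "homeomorphic_map (vtotal \<xi>) S j"
  proof (rule bijective_open_imp_homeomorphic_map)
    show "continuous_map (vtotal \<xi>) S j"
      unfolding continuous_map_alt
    proof (intro conjI allI impI)
      fix W assume "openin S W"
      then obtain A where A: "openin (vtotal \<xi>) A" "W = j ` A" using oS by auto
      have "A \<subseteq> ?T" by (simp add: A openin_subset)
      then have "j -` W \<inter> ?T = A" using inj_on_image_mem_iff[OF inj] A(2) by blast
      then show "openin (vtotal \<xi>) (j -` W \<inter> ?T)" using A by simp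
    qed (use tS in auto)
    show "open_map (vtotal \<xi>) S j" using oS by (auto simp: open_map_def)
  qed (use tS inj in auto)
  define \<eta> :: "('x, 'k) std_vbundle" where
    "\<eta> = \<lparr>vtotal = S, vproj = fst, vadd = (\<lambda>(x, a) (y, b). (x, \<lambda>i. a i + b i)),
        vscale = (\<lambda>c (x, a). (x, \<lambda>i. c * a i))\<rparr>"
  have iso: "bundle_iso \<xi> \<eta> j"
    unfolding bundle_iso_def
  proof (intro conjI ballI allI impI)
    show "homeomorphic_map (vtotal \<xi>) (vtotal \<eta>) j" using hj by (simp add: \<eta>_def)
    fix e assume e: "e \<in> ?T"
    have lt: "local_trivialization X \<xi> (fst (p (vproj \<xi> e))) (fst (snd (p (vproj \<xi> e)))) (snd (snd (p (vproj \<xi> e))))"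
      and xU: "vproj \<xi> e \<in> fst (p (vproj \<xi> e))"
      using p[OF vproj_in_base[OF \<xi> e]] by auto
    show "vproj \<eta> (j e) = vproj \<xi> e" by (simp add: \<eta>_def j_def)
    show "j (vscale \<xi> c e) = vscale \<eta> c (j e)" for c
      using lt xU e vscale_closed[OF \<xi> e] by (simp add: j_def \<eta>_def local_trivialization_def)
    fix e' assume e': "e' \<in> ?T" "vproj \<xi> e' = vproj \<xi> e"
    show "j (vadd \<xi> e e') = vadd \<eta> (j e) (j e')"
      using lt xU e e' vadd_closed[OF \<xi> e e'(1)] by (simp add: j_def \<eta>_def local_trivialization_def)
  qed
  have "vector_bundle X \<eta>" using vector_bundle_transport[OF \<xi> iso] .
  moreover have "isomorphic_bundles \<eta> \<xi>"
    using isomorphic_bundles_sym[OF \<xi>] iso by (auto simp: isomorphic_bundles_def)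
  ultimately show ?thesis by blast
qed

section \<open>Direct sums and the monoid of isomorphism classes\<close>

lemma topspace_direct_sum:
  "topspace (vtotal (direct_sum \<xi> \<eta>)) =
     {(a, b). a \<in> topspace (vtotal \<xi>) \<and> b \<in> topspace (vtotal \<eta>) \<and> vproj \<xi> a = vproj \<eta> b}"
  by (auto simp: direct_sum_def)

lemma direct_sum_simps [simp]:
  "vproj (direct_sum \<xi> \<eta>) (a, b) = vproj \<xi> a"
  "vadd (direct_sum \<xi> \<eta>) (a, b) (a', b') = (vadd \<xi> a a', vadd \<eta> b b')"
  "vscale (direct_sum \<xi> \<eta>) c (a, b) = (vscale \<xi> c a, vscale \<eta> c b)"
  by (simp_all add: direct_sum_def)

lemma vproj_direct_sum: "vproj (direct_sum \<xi> \<eta>) = (\<lambda>p. vproj \<xi> (fst p))"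
  by (auto simp: direct_sum_def)

lemma continuous_map_into_direct_sum:
  "continuous_map Z (vtotal (direct_sum \<xi> \<eta>)) f \<longleftrightarrow>
     continuous_map Z (vtotal \<xi>) (\<lambda>z. fst (f z)) \<and> continuous_map Z (vtotal \<eta>) (\<lambda>z. snd (f z)) \<and>
     (\<forall>z \<in> topspace Z. vproj \<xi> (fst (f z)) = vproj \<eta> (snd (f z)))"
  by (auto simp: direct_sum_def continuous_map_in_subtopology continuous_map_pairwise o_def
      split_beta Pi_iff image_subset_iff)

lemma continuous_map_from_direct_sum:
  "continuous_map (vtotal (direct_sum \<xi> \<eta>)) (vtotal \<xi>) fst"
  "continuous_map (vtotal (direct_sum \<xi> \<eta>)) (vtotal \<eta>) snd"
  by (auto simp: direct_sum_def intro: continuous_map_subtopology_fst continuous_map_subtopology_snd)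

lemma vector_bundle_direct_sum:
  fixes \<xi> :: "('x, 'k::real_or_complex, 'b) vbundle" and \<eta> :: "('x, 'k, 'c) vbundle"
  assumes \<xi>: "vector_bundle X \<xi>" and \<eta>: "vector_bundle X \<eta>"
  shows "vector_bundle X (direct_sum \<xi> \<eta>)"
proof -
  let ?D = "direct_sum \<xi> \<eta>"
  have cp: "continuous_map (vtotal ?D) X (vproj ?D)"
    unfolding vproj_direct_sum
    using continuous_map_compose[OF continuous_map_from_direct_sum(1), of \<xi> X "vproj \<xi>"] \<xi>
    by (simp add: vector_bundle_def o_def)
  show ?thesis
  proof (rule vector_bundleI[OF cp])
    fix x assume x: "x \<in> topspace X"
    obtain U n c1 \<psi>1 where U: "openin X U" "x \<in> U" and ch1: "bundle_chart X \<xi> U n c1 \<psi>1"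
      using \<xi> x by (rule vector_bundle_chartE)
    obtain U' m c2 \<psi>2 where U': "openin X U'" "x \<in> U'" and ch2: "bundle_chart X \<eta> U' m c2 \<psi>2"
      using \<eta> x by (rule vector_bundle_chartE)
    define W where "W = U \<inter> U'"
    have W: "openin X W" "x \<in> W" using U U' by (auto simp: W_def)
    interpret c1: bundle_chart X \<xi> W n c1 \<psi>1
      by (rule bundle_chart.restrict[OF ch1]) (simp add: W_def)
    interpret c2: bundle_chart X \<eta> W m c2 \<psi>2
      by (rule bundle_chart.restrict[OF ch2]) (simp add: W_def)
    \<comment> \<open>Coordinates are concatenated: indices below \<open>n\<close> belong to \<xi>,
      index \<open>n + i\<close> is index \<open>i\<close> of \<eta>. The truncation in \<psi> is
      needed because \<open>\<psi>1\<close> is only controlled on sequences vanishing from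
      \<open>n\<close> on.\<close>
    define c where "c p i = (if i < n then c1 (fst p) i else c2 (snd p) (i - n))" for p i
    define \<psi> where "\<psi> q = (\<psi>1 (fst q, \<lambda>i. if i < n then snd q i else 0), \<psi>2 (fst q, \<lambda>i. snd q (n + i)))" for q
    let ?Z = "subtopology (vtotal ?D) {e. vproj ?D e \<in> W}"
    let ?T = "prod_topology (subtopology X W) (coord_space (n + m)) :: ('x \<times> (nat \<Rightarrow> 'k)) topology"
    have tZ: "p \<in> topspace ?Z \<longleftrightarrow> fst p \<in> topspace (vtotal \<xi>) \<and> snd p \<in> topspace (vtotal \<eta>)
        \<and> vproj \<xi> (fst p) = vproj \<eta> (snd p) \<and> vproj \<xi> (fst p) \<in> W" for p
      by (cases p) (auto simp: topspace_direct_sum)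
    have cf: "continuous_map ?Z (subtopology (vtotal \<xi>) {e. vproj \<xi> e \<in> W}) fst"
      using continuous_map_from_direct_sum(1)[of \<xi> \<eta>] tZ
      by (auto simp: continuous_map_in_subtopology continuous_map_from_subtopology)
    have cs: "continuous_map ?Z (subtopology (vtotal \<eta>) {e. vproj \<eta> e \<in> W}) snd"
      using continuous_map_from_direct_sum(2)[of \<xi> \<eta>]
      by (auto simp: topspace_direct_sum continuous_map_in_subtopology continuous_map_from_subtopology)
    have cc: "continuous_map ?Z euclidean (\<lambda>e. c e i)" for i
      using continuous_map_compose[OF cf c1.continuous_coord[of i]] continuous_map_compose[OF cs c2.continuous_coord[of "i - n"]]
      by (auto simp: c_def o_def)
    have csn: "continuous_map ?T euclidean (\<lambda>q. snd q i)" for i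
      using continuous_map_compose[OF continuous_map_snd continuous_map_coord, of "subtopology X W" "n + m" i]
      by (simp add: o_def)
    have p1: "continuous_map ?T (vtotal \<xi>) (\<lambda>q. \<psi>1 (fst q, \<lambda>i. if i < n then snd q i else 0))"
    proof (rule continuous_map_compose[OF _ c1.continuous_inv, unfolded o_def])
      show "continuous_map ?T (prod_topology (subtopology X W) (coord_space n)) (\<lambda>q. (fst q, \<lambda>i. if i < n then snd q i else 0))"
        using csn
        by (auto simp: continuous_map_pairwise o_def continuous_map_coord_space continuous_map_fst)
    qed
    have p2: "continuous_map ?T (vtotal \<eta>) (\<lambda>q. \<psi>2 (fst q, \<lambda>i. snd q (n + i)))"
    proof (rule continuous_map_compose[OF _ c2.continuous_inv, unfolded o_def])
      show "continuous_map ?T (prod_topology (subtopology X W) (coord_space m)) (\<lambda>q. (fst q, \<lambda>i. snd q (n + i)))"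
        using csn
        by (auto simp: continuous_map_pairwise o_def continuous_map_coord_space continuous_map_fst
            topspace_coord_space)
    qed
    have "bundle_chart X ?D W (n + m) c \<psi>"
    proof
      show "W \<subseteq> topspace X" by (rule c1.base)
      show "continuous_map (vtotal ?D) X (vproj ?D)" by (rule cp)
      show "continuous_map ?Z euclidean (\<lambda>e. c e i)" for i by (rule cc)
      show "c e i = 0" if "e \<in> topspace (vtotal ?D)" "vproj ?D e \<in> W" "i \<ge> n + m" for e i
        using that c2.coord_zero[of "snd e" "i - n"] by (auto simp: c_def topspace_direct_sum)
      show "continuous_map ?T (vtotal ?D) \<psi>"
        unfolding continuous_map_into_direct_sum
        using p1 p2 c1.vproj_inv c2.vproj_inv by (auto simp: \<psi>_def topspace_coord_space)
      show "vproj ?D (\<psi> (x, a)) = x" if "x \<in> W" "\<And>i. i \<ge> n + m \<Longrightarrow> a i = 0" for x a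
        using c1.vproj_inv[of x "\<lambda>i. if i < n then a i else 0"] that by (auto simp: \<psi>_def cong: if_cong)
      show "c (\<psi> (x, a)) = a" if "x \<in> W" "\<And>i. i \<ge> n + m \<Longrightarrow> a i = 0" for x a
        using c1.coord_inv[of x "\<lambda>i. if i < n then a i else 0"] c2.coord_inv[of x "\<lambda>i. a (n + i)"] that
        by (auto simp: \<psi>_def c_def fun_eq_iff cong: if_cong)
      show "\<psi> (vproj ?D e, c e) = e" if e: "e \<in> topspace (vtotal ?D)" "vproj ?D e \<in> W" for e
      proof -
        obtain a b where ab: "e = (a, b)" by (cases e)
        have t: "a \<in> topspace (vtotal \<xi>)" "b \<in> topspace (vtotal \<eta>)" "vproj \<eta> b = vproj \<xi> a" "vproj \<xi> a \<in> W"
          using e by (auto simp: ab topspace_direct_sum)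
        have "(\<lambda>i. if i < n then c e i else 0) = c1 a"
          using c1.coord_zero[OF t(1,4)] by (auto simp: c_def ab fun_eq_iff)
        moreover have "(\<lambda>i. c e (n + i)) = c2 b" by (auto simp: c_def ab fun_eq_iff)
        ultimately show ?thesis using c1.inv_coord[OF t(1,4)] c2.inv_coord[OF t(2)] t by (simp add: \<psi>_def ab cong: if_cong)
      qed
      show "c (vscale ?D k e) = (\<lambda>i. k * c e i)" if "e \<in> topspace (vtotal ?D)" "vproj ?D e \<in> W" for e k
        using that c1.coord_scale[of "fst e" k] c2.coord_scale[of "snd e" k]
        by (auto simp: c_def topspace_direct_sum fun_eq_iff)
      show "c (vadd ?D e e') = (\<lambda>i. c e i + c e' i)"
        if "e \<in> topspace (vtotal ?D)" "e' \<in> topspace (vtotal ?D)" "vproj ?D e \<in> W" "vproj ?D e' = vproj ?D e" for e e'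
        using that c1.coord_add[of "fst e" "fst e'"] c2.coord_add[of "snd e" "snd e'"]
        by (auto simp: c_def topspace_direct_sum fun_eq_iff)
    qed
    then show "\<exists>U n c \<psi>. openin X U \<and> x \<in> U \<and> bundle_chart X ?D U n c \<psi>" using W by blast
  next
    show "vscale ?D c e \<in> topspace (vtotal ?D) \<and> vproj ?D (vscale ?D c e) = vproj ?D e"
      if "e \<in> topspace (vtotal ?D)" for c e
      using that vscale_closed[OF \<xi>] vscale_closed[OF \<eta>] by (auto simp: topspace_direct_sum)
    show "vadd ?D e e' \<in> topspace (vtotal ?D) \<and> vproj ?D (vadd ?D e e') = vproj ?D e"
      if "e \<in> topspace (vtotal ?D)" "e' \<in> topspace (vtotal ?D)" "vproj ?D e' = vproj ?D e" for e e'
      using that vadd_closed[OF \<xi>] vadd_closed[OF \<eta>] by (auto simp: topspace_direct_sum)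
  qed
qed

lemma bundle_isoI:
  assumes "homeomorphic_maps (vtotal \<xi>) (vtotal \<eta>) f g"
    and "\<And>e. e \<in> topspace (vtotal \<xi>) \<Longrightarrow> vproj \<eta> (f e) = vproj \<xi> e"
    and "\<And>c e. e \<in> topspace (vtotal \<xi>) \<Longrightarrow> f (vscale \<xi> c e) = vscale \<eta> c (f e)"
    and "\<And>e e'. \<lbrakk>e \<in> topspace (vtotal \<xi>); e' \<in> topspace (vtotal \<xi>); vproj \<xi> e' = vproj \<xi> e\<rbrakk> \<Longrightarrow>
       f (vadd \<xi> e e') = vadd \<eta> (f e) (f e')"
  shows "isomorphic_bundles \<xi> \<eta>"
  unfolding isomorphic_bundles_def bundle_iso_def
  using assms homeomorphic_maps_imp_map by (intro exI[of _ f]) auto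

lemma isomorphic_direct_sum:
  assumes "isomorphic_bundles \<xi> \<xi>'" "isomorphic_bundles \<eta> \<eta>'"
  shows "isomorphic_bundles (direct_sum \<xi> \<eta>) (direct_sum \<xi>' \<eta>')"
proof -
  from assms obtain f g where f: "bundle_iso \<xi> \<xi>' f" and g: "bundle_iso \<eta> \<eta>' g"
    by (auto simp: isomorphic_bundles_def)
  then obtain f' g' where ff': "homeomorphic_maps (vtotal \<xi>) (vtotal \<xi>') f f'"
    and gg': "homeomorphic_maps (vtotal \<eta>) (vtotal \<eta>') g g'"
    by (auto simp: homeomorphic_map_maps bundle_iso_def)
  have ft: "f a \<in> topspace (vtotal \<xi>')" if "a \<in> topspace (vtotal \<xi>)" for a
    using ff' that by (auto simp: homeomorphic_maps_def continuous_map_def)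
  have gt: "g a \<in> topspace (vtotal \<eta>')" if "a \<in> topspace (vtotal \<eta>)" for a
    using gg' that by (auto simp: homeomorphic_maps_def continuous_map_def)
  have ft': "f' a \<in> topspace (vtotal \<xi>)" "f (f' a) = a" if "a \<in> topspace (vtotal \<xi>')" for a
    using ff' that by (auto simp: homeomorphic_maps_def continuous_map_def)
  have gt': "g' a \<in> topspace (vtotal \<eta>)" "g (g' a) = a" if "a \<in> topspace (vtotal \<eta>')" for a
    using gg' that by (auto simp: homeomorphic_maps_def continuous_map_def)
  have fp': "vproj \<xi> (f' a) = vproj \<xi>' a" if "a \<in> topspace (vtotal \<xi>')" for a
    using f ft'[OF that] by (metis bundle_iso_def)
  have gp': "vproj \<eta> (g' a) = vproj \<eta>' a" if "a \<in> topspace (vtotal \<eta>')" for a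
    using g gt'[OF that] by (metis bundle_iso_def)
  show ?thesis
  proof (rule bundle_isoI)
    have cf: "continuous_map (vtotal (direct_sum \<xi> \<eta>)) (vtotal \<xi>') (\<lambda>p. f (fst p))"
      "continuous_map (vtotal (direct_sum \<xi> \<eta>)) (vtotal \<eta>') (\<lambda>p. g (snd p))"
      using ff' gg' continuous_map_compose[OF continuous_map_from_direct_sum(1), of \<xi> "vtotal \<xi>'" f \<eta>]
        continuous_map_compose[OF continuous_map_from_direct_sum(2), of \<eta> "vtotal \<eta>'" g \<xi>]
      by (simp_all add: homeomorphic_maps_def o_def)
    have cf': "continuous_map (vtotal (direct_sum \<xi>' \<eta>')) (vtotal \<xi>) (\<lambda>p. f' (fst p))"
      "continuous_map (vtotal (direct_sum \<xi>' \<eta>')) (vtotal \<eta>) (\<lambda>p. g' (snd p))"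
      using ff' gg' continuous_map_compose[OF continuous_map_from_direct_sum(1), of \<xi>' "vtotal \<xi>" f' \<eta>']
        continuous_map_compose[OF continuous_map_from_direct_sum(2), of \<eta>' "vtotal \<eta>" g' \<xi>']
      by (simp_all add: homeomorphic_maps_def o_def)
    show "homeomorphic_maps (vtotal (direct_sum \<xi> \<eta>)) (vtotal (direct_sum \<xi>' \<eta>')) (map_prod f g) (map_prod f' g')"
      unfolding homeomorphic_maps_def continuous_map_into_direct_sum
      using cf cf' f g fp' gp' ff' gg'
      by (auto simp: topspace_direct_sum bundle_iso_def homeomorphic_maps_def)
  qed (use f g in \<open>auto simp: bundle_iso_def topspace_direct_sum\<close>)
qed

lemma isomorphic_direct_sum_commute: "isomorphic_bundles (direct_sum \<xi> \<eta>) (direct_sum \<eta> \<xi>)"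
proof (rule bundle_isoI)
  show "homeomorphic_maps (vtotal (direct_sum \<xi> \<eta>)) (vtotal (direct_sum \<eta> \<xi>)) prod.swap prod.swap"
    unfolding homeomorphic_maps_def continuous_map_into_direct_sum
    by (auto simp: topspace_direct_sum continuous_map_from_direct_sum)
qed (auto simp: topspace_direct_sum)

lemma isomorphic_direct_sum_assoc:
  "isomorphic_bundles (direct_sum (direct_sum \<xi> \<eta>) \<zeta>) (direct_sum \<xi> (direct_sum \<eta> \<zeta>))"
proof (rule bundle_isoI)
  let ?f = "\<lambda>p. (fst (fst p), snd (fst p), snd p)"
  let ?g = "\<lambda>p. ((fst p, fst (snd p)), snd (snd p))"
  let ?A = "vtotal (direct_sum (direct_sum \<xi> \<eta>) \<zeta>)" and ?B = "vtotal (direct_sum \<xi> (direct_sum \<eta> \<zeta>))"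
  have 1: "continuous_map ?A (vtotal \<xi>) (\<lambda>p. fst (fst p))" "continuous_map ?A (vtotal \<eta>) (\<lambda>p. snd (fst p))"
    "continuous_map ?A (vtotal \<zeta>) snd"
    using continuous_map_compose[OF continuous_map_from_direct_sum(1) continuous_map_from_direct_sum(1)]
      continuous_map_compose[OF continuous_map_from_direct_sum(1) continuous_map_from_direct_sum(2)]
    by (auto simp: o_def continuous_map_from_direct_sum)
  have 2: "continuous_map ?B (vtotal \<zeta>) (\<lambda>p. snd (snd p))" "continuous_map ?B (vtotal \<eta>) (\<lambda>p. fst (snd p))"
    "continuous_map ?B (vtotal \<xi>) fst"
    using continuous_map_compose[OF continuous_map_from_direct_sum(2) continuous_map_from_direct_sum(2)]
      continuous_map_compose[OF continuous_map_from_direct_sum(2) continuous_map_from_direct_sum(1)]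
    by (auto simp: o_def continuous_map_from_direct_sum)
  show "homeomorphic_maps ?A ?B ?f ?g"
    unfolding homeomorphic_maps_def continuous_map_into_direct_sum
    using 1 2 by (auto simp: topspace_direct_sum)
qed (auto simp: topspace_direct_sum)

section \<open>The unit and the monoid laws of \<open>Vect X\<close>\<close>

definition zero_bundle :: "'x topology \<Rightarrow> ('x, 'k::real_or_complex) std_vbundle" where
  "zero_bundle X = product_bundle X (coord_space 0) (\<lambda>a b i. a i + b i) (\<lambda>c a i. c * a i)"

lemma zero_bundle_simps:
  "vtotal (zero_bundle X) = prod_topology X (coord_space 0)" "vproj (zero_bundle X) = fst"
  "vadd (zero_bundle X) (x, a) (y, b) = (x, \<lambda>i. a i + b i)"
  "vscale (zero_bundle X) c (x, a) = (x, \<lambda>i. c * a i)"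
  by (simp_all add: zero_bundle_def product_bundle_def)

lemma vector_bundle_zero: "vector_bundle X (zero_bundle X :: ('x, 'k::real_or_complex) std_vbundle)"
proof (rule vector_bundleI)
  have "bundle_chart X (zero_bundle X :: ('x, 'k) std_vbundle) (topspace X) 0 snd id"
    by unfold_locales
      (auto simp: zero_bundle_simps topspace_coord_space continuous_map_fst
        intro!: continuous_map_from_subtopology continuous_map_compose[OF continuous_map_snd continuous_map_coord, unfolded o_def])
  then show "\<exists>U n c \<psi>. openin X U \<and> x \<in> U \<and> bundle_chart X (zero_bundle X :: ('x, 'k) std_vbundle) U n c \<psi>"
    if "x \<in> topspace X" for x
    using that by blast
qed (auto simp: zero_bundle_simps topspace_coord_space continuous_map_fst)

lemma isomorphic_direct_sum_zero:
  fixes \<xi> :: "('x, 'k::real_or_complex, 'b) vbundle"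
  assumes \<xi>: "vector_bundle X \<xi>"
  shows "isomorphic_bundles (direct_sum (zero_bundle X :: ('x, 'k) std_vbundle) \<xi>) \<xi>"
proof (rule bundle_isoI)
  show "homeomorphic_maps (vtotal (direct_sum (zero_bundle X :: ('x, 'k) std_vbundle) \<xi>)) (vtotal \<xi>)
      snd (\<lambda>e. ((vproj \<xi> e, \<lambda>i. 0), e))"
    unfolding homeomorphic_maps_def continuous_map_into_direct_sum
    using \<xi> by (auto simp: topspace_direct_sum continuous_map_from_direct_sum zero_bundle_simps
       topspace_coord_space fun_eq_iff vector_bundle_def continuous_map_pairwise o_def continuous_map_coord_space)
qed (auto simp: topspace_direct_sum zero_bundle_simps)

text \<open>The carrier lists only classes of bundles with standard total space;
  \<open>ex_std_vbundle\<close> brings bundles over arbitrary total space types into it.\<close>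

lemma iso_class_in_carrier:
  fixes \<xi> :: "('x, 'k::real_or_complex, 'b) vbundle"
  assumes "vector_bundle X \<xi>"
  shows "iso_class X \<xi> \<in> carrier (Vect X)"
proof -
  from ex_std_vbundle[OF assms] obtain \<eta> :: "('x, 'k) std_vbundle" where
    "vector_bundle X \<eta>" "isomorphic_bundles \<eta> \<xi>" by blast
  then have "iso_class X \<xi> = iso_class X \<eta>" by (simp add: iso_class_cong)
  with \<open>vector_bundle X \<eta>\<close> show ?thesis by (auto simp: Vect_def)
qed

text \<open>The union defining the product runs over a nonempty set of pairs of representatives, all
  of which contribute the same class.\<close>

lemma Vect_mult:
  fixes \<xi> :: "('x, 'k::real_or_complex, 'b) vbundle" and \<eta> :: "('x, 'k, 'c) vbundle"
  assumes "vector_bundle X \<xi>" "vector_bundle X \<eta>"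
  shows "iso_class X \<xi> \<otimes>\<^bsub>Vect X\<^esub> iso_class X \<eta> = iso_class X (direct_sum \<xi> \<eta>)"
proof -
  have "iso_class X (direct_sum \<xi>' \<eta>') = iso_class X (direct_sum \<xi> \<eta>)"
    if "\<xi>' \<in> iso_class X \<xi>" "\<eta>' \<in> iso_class X \<eta>" for \<xi>' \<eta>'
    using that by (intro iso_class_cong) (auto simp: iso_class_def intro: vector_bundle_direct_sum isomorphic_direct_sum)
  moreover have "iso_class X \<xi> \<noteq> {}" "iso_class X \<eta> \<noteq> {}"
    using ex_std_vbundle assms by (fastforce simp: iso_class_def)+
  ultimately show ?thesis by (simp add: Vect_def)
qed

lemma comm_monoid_Vect: "comm_monoid (Vect X :: ('x, 'k::real_or_complex) std_vbundle set monoid)"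
proof -
  let ?V = "Vect X :: ('x, 'k) std_vbundle set monoid"
  have car: "\<exists>\<xi> :: ('x, 'k) std_vbundle. vector_bundle X \<xi> \<and> A = iso_class X \<xi>" if "A \<in> carrier ?V" for A
    using that by (auto simp: Vect_def)
  have one: "\<one>\<^bsub>?V\<^esub> = iso_class X (zero_bundle X)" by (simp add: Vect_def zero_bundle_def)
  show ?thesis
  proof (rule comm_monoidI)
    fix A B assume "A \<in> carrier ?V" "B \<in> carrier ?V"
    then obtain \<xi> \<eta> :: "('x, 'k) std_vbundle" where "vector_bundle X \<xi>" "A = iso_class X \<xi>"
      "vector_bundle X \<eta>" "B = iso_class X \<eta>" using car by meson
    then show "A \<otimes>\<^bsub>?V\<^esub> B \<in> carrier ?V" "A \<otimes>\<^bsub>?V\<^esub> B = B \<otimes>\<^bsub>?V\<^esub> A"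
      by (auto simp: Vect_mult vector_bundle_direct_sum
          intro!: iso_class_in_carrier iso_class_cong isomorphic_direct_sum_commute)
  next
    show "\<one>\<^bsub>?V\<^esub> \<in> carrier ?V" by (simp add: one iso_class_in_carrier vector_bundle_zero)
  next
    fix A B C assume "A \<in> carrier ?V" "B \<in> carrier ?V" "C \<in> carrier ?V"
    then obtain \<xi> \<eta> \<zeta> :: "('x, 'k) std_vbundle" where "vector_bundle X \<xi>" "A = iso_class X \<xi>"
      "vector_bundle X \<eta>" "B = iso_class X \<eta>" "vector_bundle X \<zeta>" "C = iso_class X \<zeta>" using car by meson
    then show "A \<otimes>\<^bsub>?V\<^esub> B \<otimes>\<^bsub>?V\<^esub> C = A \<otimes>\<^bsub>?V\<^esub> (B \<otimes>\<^bsub>?V\<^esub> C)"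
      by (auto simp: Vect_mult vector_bundle_direct_sum intro!: iso_class_cong isomorphic_direct_sum_assoc)
  next
    fix A assume "A \<in> carrier ?V"
    then obtain \<xi> :: "('x, 'k) std_vbundle" where "vector_bundle X \<xi>" "A = iso_class X \<xi>" using car by meson
    then show "\<one>\<^bsub>?V\<^esub> \<otimes>\<^bsub>?V\<^esub> A = A"
      by (auto simp: one Vect_mult vector_bundle_zero vector_bundle_direct_sum
          intro!: iso_class_cong isomorphic_direct_sum_zero)
  qed
qed

section \<open>Formal differences in K(X)\<close>

lemma K_diff_conv:
  fixes \<xi> :: "('x, 'k::real_or_complex, 'b) vbundle" and \<eta> :: "('x, 'k, 'c) vbundle"
  assumes "vector_bundle X \<xi>" "vector_bundle X \<eta>"
  shows "K_diff X \<xi> \<eta> = groth_rel (Vect X) `` {(iso_class X \<xi>, iso_class X \<eta>)}"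
    and "K_diff X \<xi> \<eta> \<in> carrier (K_group X)"
proof -
  let ?V = "Vect X :: ('x, 'k) std_vbundle set monoid"
  interpret V: comm_monoid ?V by (rule comm_monoid_Vect)
  interpret K: comm_group "groth ?V" by (rule V.groth_comm_group)
  have a: "iso_class X \<xi> \<in> carrier ?V" and b: "iso_class X \<eta> \<in> carrier ?V"
    using assms by (auto intro: iso_class_in_carrier)
  have car: "groth_rel ?V `` {(A, B)} \<in> carrier (groth ?V)" if "A \<in> carrier ?V" "B \<in> carrier ?V" for A B
    using that by (auto simp: groth_def quotient_def)
  \<comment> \<open>The class of \<open>(\<one>, b)\<close> is the inverse of the class of
    \<open>(b, \<one>)\<close>: their product \<open>(b, b)\<close> is equivalent to
    \<open>(\<one>, \<one>)\<close>. Hence a formal difference is represented by the pair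
    itself.\<close>
  have "groth_rel ?V `` {(\<one>\<^bsub>?V\<^esub>, iso_class X \<eta>)} \<otimes>\<^bsub>groth ?V\<^esub> groth_incl ?V (iso_class X \<eta>) = \<one>\<^bsub>groth ?V\<^esub>"
    unfolding groth_incl_def
  proof (subst V.groth_mult_class)
    have "((\<one>\<^bsub>?V\<^esub> \<otimes>\<^bsub>?V\<^esub> iso_class X \<eta>, iso_class X \<eta> \<otimes>\<^bsub>?V\<^esub> \<one>\<^bsub>?V\<^esub>), \<one>\<^bsub>?V\<^esub>, \<one>\<^bsub>?V\<^esub>) \<in> groth_rel ?V"
      using b by (auto simp: V.groth_rel_iff intro!: bexI[of _ "\<one>\<^bsub>?V\<^esub>"])
    then show "groth_rel ?V `` {(\<one>\<^bsub>?V\<^esub> \<otimes>\<^bsub>?V\<^esub> iso_class X \<eta>, iso_class X \<eta> \<otimes>\<^bsub>?V\<^esub> \<one>\<^bsub>?V\<^esub>)} = \<one>\<^bsub>groth ?V\<^esub>"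
      by (simp add: groth_def equiv_class_eq[OF V.equiv_groth_rel])
  qed (use b in auto)
  then have inv: "inv\<^bsub>groth ?V\<^esub> (groth_incl ?V (iso_class X \<eta>)) = groth_rel ?V `` {(\<one>\<^bsub>?V\<^esub>, iso_class X \<eta>)}"
    by (rule K.inv_equality) (use b car in \<open>auto simp: groth_incl_def\<close>)
  show 1: "K_diff X \<xi> \<eta> = groth_rel ?V `` {(iso_class X \<xi>, iso_class X \<eta>)}"
    unfolding K_diff_def K_class_def K_group_def inv
    using a b by (simp add: groth_incl_def V.groth_mult_class)
  show "K_diff X \<xi> \<eta> \<in> carrier (K_group X)"
    unfolding 1 K_group_def using a b by (rule car)
qed

text \<open>The passage from K(X) to bundles: an honest isomorphism of the crossed sums suffices,
  because equal products in \<open>Vect X\<close> remain equal after multiplication by any further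
  class.\<close>

lemma K_diff_eqI:
  fixes \<xi> :: "('x, 'k::real_or_complex, 'b) vbundle" and \<eta> :: "('x, 'k, 'c) vbundle"
    and \<xi>' :: "('x, 'k, 'd) vbundle" and \<eta>' :: "('x, 'k, 'e) vbundle"
  assumes vb: "vector_bundle X \<xi>" "vector_bundle X \<eta>" "vector_bundle X \<xi>'" "vector_bundle X \<eta>'"
    and iso: "isomorphic_bundles (direct_sum \<xi> \<eta>') (direct_sum \<xi>' \<eta>)"
  shows "K_diff X \<xi> \<eta> = K_diff X \<xi>' \<eta>'"
proof -
  let ?V = "Vect X :: ('x, 'k) std_vbundle set monoid"
  interpret V: comm_monoid ?V by (rule comm_monoid_Vect)
  have "iso_class X \<xi> \<otimes>\<^bsub>?V\<^esub> iso_class X \<eta>' = iso_class X \<xi>' \<otimes>\<^bsub>?V\<^esub> iso_class X \<eta>"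
    using vb iso by (simp add: Vect_mult iso_class_cong vector_bundle_direct_sum)
  then have "((iso_class X \<xi>, iso_class X \<eta>), (iso_class X \<xi>', iso_class X \<eta>')) \<in> groth_rel ?V"
    using vb by (auto simp: V.groth_rel_iff iso_class_in_carrier)
  then show ?thesis
    using vb by (simp add: K_diff_conv equiv_class_eq[OF V.equiv_groth_rel])
qed

section \<open>Bounded partial inverses\<close>

lemma continuous_map_euclidean_tendsto:
  "continuous_map X euclidean f \<longleftrightarrow> (\<forall>x \<in> topspace X. (f \<longlongrightarrow> f x) (atin X x))"
  by (simp add: continuous_map_atin)

lemma continuous_map_bilinear:
  assumes "bounded_bilinear h" "continuous_map Z euclidean f" "continuous_map Z euclidean g"
  shows "continuous_map Z euclidean (\<lambda>z. h (f z) (g z))"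
  using assms by (auto simp: continuous_map_euclidean_tendsto intro: bounded_bilinear.tendsto)

lemmas continuous_map_blinfun_apply = continuous_map_bilinear[OF bounded_bilinear_blinfun_apply]
lemmas continuous_map_blinfun_compose = continuous_map_bilinear[OF bounded_bilinear_blinfun_compose]
lemmas continuous_map_scaleR = continuous_map_bilinear[OF bounded_bilinear_scaleR]

lemma continuous_map_bounded_linear:
  assumes "bounded_linear h" "continuous_map Z euclidean f"
  shows "continuous_map Z euclidean (\<lambda>z. h (f z))"
  using assms by (auto simp: continuous_map_euclidean_tendsto intro: bounded_linear.tendsto)

text \<open>The open mapping argument, carried out on sets because \<open>E\<close> and
  \<open>F\<close> are subspaces and not types. By Baire, the closure of the image of some ball has
  interior points in \<open>F\<close>; differences of points near such a point give preimages up to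
  half the error. Iterating and summing yields an exact preimage of controlled norm, which
  injectivity identifies with \<open>u\<close>.\<close>

lemma bounded_inverse_on_subspace:
  fixes T :: "'a::banach \<Rightarrow>\<^sub>L 'b::banach"
  assumes E: "closed E" "subspace E" and F: "closed F" and img: "blinfun_apply T ` E = F"
    and inj: "\<And>u. u \<in> E \<Longrightarrow> T u = 0 \<Longrightarrow> u = 0"
  obtains C where "C > 0" "\<And>u. u \<in> E \<Longrightarrow> norm u \<le> C * norm (T u)"
proof -
  have sF: "subspace F"
    unfolding img[symmetric] by (rule linear_subspace_image[OF blinfun.bounded_linear_right[THEN bounded_linear.linear] E(2)])
  define A where "A n = closure (blinfun_apply T ` (E \<inter> cball 0 (real n)))" for n :: nat
  have AF: "A n \<subseteq> F" for n
    unfolding A_def by (rule closure_minimal[OF _ F]) (use img in auto)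
  have cover: "\<Union>(range A) = F"
  proof
    show "F \<subseteq> \<Union>(range A)"
    proof
      fix y assume "y \<in> F"
      then obtain u where u: "u \<in> E" "y = T u" using img by auto
      obtain n where "norm u \<le> real n" using real_arch_simple by blast
      then have "y \<in> A n" unfolding A_def using u by (intro closure_subset[THEN subsetD]) auto
      then show "y \<in> \<Union>(range A)" by auto
    qed
  qed (use AF in auto)
  have "\<exists>n. (top_of_set F) interior_of (A n) \<noteq> {}"
  proof (rule ccontr)
    assume none: "\<not> ?thesis"
    have "(top_of_set F) interior_of \<Union>(range A) = {}"
    proof (intro Baire_category_alt)
      show "completely_metrizable_space (top_of_set F) \<or> locally_compact_space (top_of_set F) \<and> regular_space (top_of_set F)"
        using F by (simp add: completely_metrizable_space_closedin completely_metrizable_space_euclidean)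
      show "closedin (top_of_set F) S \<and> (top_of_set F) interior_of S = {}" if "S \<in> range A" for S
        using that none AF by (auto simp: A_def intro!: closed_subset)
    qed auto
    moreover have "0 \<in> F" using sF by (rule subspace_0)
    ultimately show False using cover by (metis empty_iff interior_of_topspace topspace_euclidean_subtopology)
  qed
  then obtain n y where "y \<in> (top_of_set F) interior_of (A n)" by auto
  then obtain W where W: "openin (top_of_set F) W" "W \<subseteq> A n" "y \<in> W"
    by (auto simp: interior_of_def)
  then obtain r where r: "r > 0" "ball y r \<inter> F \<subseteq> W"
    unfolding openin_contains_ball by auto
  have y: "y \<in> F" using W AF by auto
  \<comment> \<open>Below, \<open>z\<close> is scaled by \<open>s = r / (2 * norm z)\<close>, and
    the two approximate preimages have norm at most \<open>n\<close>. Dividing their difference by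
    \<open>s\<close> gives a factor \<open>4 * n / r\<close>; \<open>n + 1\<close> in place of
    \<open>n\<close> keeps \<open>M\<close> positive.\<close>
  define M where "M = 4 * (real n + 1) / r"
  have M: "M > 0" using r by (simp add: M_def)
  have approx: "\<exists>u\<in>E. norm u \<le> M * norm z \<and> norm (z - T u) \<le> norm z / 2" if z: "z \<in> F" for z
  proof (cases "z = 0")
    case True then show ?thesis using E(2) by (intro bexI[of _ 0]) (auto simp: subspace_0)
  next
    case False
    define s where "s = r / (2 * norm z)"
    have s: "s > 0" using False r by (simp add: s_def)
    have szF: "s *\<^sub>R z \<in> F" using sF z by (rule subspace_scale)
    have "y + s *\<^sub>R z \<in> F" using sF y szF by (rule subspace_add)
    moreover have "norm (s *\<^sub>R z) < r" using False r by (simp add: s_def)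
    then have "y + s *\<^sub>R z \<in> ball y r" by (simp add: dist_norm)
    ultimately have "y + s *\<^sub>R z \<in> A n" using r W by auto
    \<comment> \<open>Two errors of \<open>r / 8\<close> add up to \<open>r / 4\<close>, which is
      half of \<open>s * norm z\<close>.\<close>
    then obtain p where p: "p \<in> E" "norm p \<le> real n" "norm (T p - (y + s *\<^sub>R z)) < r / 8"
      using closure_approachableD[of "y + s *\<^sub>R z" "blinfun_apply T ` (E \<inter> cball 0 (real n))" "r / 8"] r
      by (auto simp: A_def dist_norm norm_minus_commute)
    have "y \<in> A n" using W by auto
    then obtain q where q: "q \<in> E" "norm q \<le> real n" "norm (T q - y) < r / 8"
      using closure_approachableD[of y "blinfun_apply T ` (E \<inter> cball 0 (real n))" "r / 8"] r
      by (auto simp: A_def dist_norm norm_minus_commute)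
    define u where "u = (1 / s) *\<^sub>R (p - q)"
    have "u \<in> E" using p q E(2) by (auto simp: u_def intro: subspace_scale subspace_diff)
    moreover have "norm u \<le> M * norm z"
    proof -
      have "norm (p - q) \<le> 2 * (real n + 1)"
        using order_trans[OF norm_triangle_ineq4[of p q] add_mono[OF p(2) q(2)]] by simp
      then have "(1 / s) * norm (p - q) \<le> (1 / s) * (2 * (real n + 1))"
        using s by (intro mult_left_mono) auto
      also have "\<dots> = M * norm z" using False r by (simp add: s_def M_def field_simps)
      finally show ?thesis using s by (simp add: u_def)
    qed
    moreover have "norm (z - T u) \<le> norm z / 2"
    proof -
      have "s *\<^sub>R (z - T u) = (T q - y) - (T p - (y + s *\<^sub>R z))"
        using s by (simp add: u_def blinfun.bilinear_simps algebra_simps)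
      then have "norm (s *\<^sub>R (z - T u)) \<le> r / 8 + r / 8"
        using order_trans[OF norm_triangle_ineq4 add_mono[OF less_imp_le[OF q(3)] less_imp_le[OF p(3)]]] by simp
      then have "s * norm (z - T u) \<le> r / 4" using s by simp
      then show ?thesis using False r by (simp add: s_def field_simps)
    qed
    ultimately show ?thesis by blast
  qed
  then obtain v where v: "\<And>z. z \<in> F \<Longrightarrow> v z \<in> E \<and> norm (v z) \<le> M * norm z \<and> norm (z - T (v z)) \<le> norm z / 2"
    by metis
  show thesis
  proof (rule that[of "2 * M"])
    show "2 * M > 0" using M by simp
    fix u assume u: "u \<in> E"
    \<comment> \<open>\<open>Z k\<close> is the residual after \<open>k\<close> corrections, so the
      first \<open>N\<close> corrections have image \<open>T u - Z N\<close>. Residuals halve at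
      each step; the geometric series accounts for the factor 2 in \<open>2 * M\<close>.\<close>
    define Z where "Z k = ((\<lambda>z. z - T (v z)) ^^ k) (T u)" for k
    have Z0: "Z 0 = T u" and ZS: "Z (Suc k) = Z k - T (v (Z k))" for k by (simp_all add: Z_def)
    have ZF: "Z k \<in> F" for k
    proof (induction k)
      case 0 then show ?case using u img by (auto simp: Z0)
    next
      case (Suc k)
      have "T (v (Z k)) \<in> F" using v[OF Suc] img by auto
      then show ?case using Suc sF by (simp add: ZS subspace_diff)
    qed
    have Zn: "norm (Z k) \<le> norm (T u) * (1/2) ^ k" for k
    proof (induction k)
      case (Suc k)
      have "norm (Z (Suc k)) \<le> norm (Z k) / 2" using v[OF ZF] by (simp add: ZS)
      then show ?case using Suc by simp
    qed (simp add: Z0)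
    have vn: "norm (v (Z k)) \<le> M * norm (T u) * (1/2) ^ k" for k
    proof -
      have "norm (v (Z k)) \<le> M * norm (Z k)" using v[OF ZF] by blast
      also have "\<dots> \<le> M * (norm (T u) * (1/2) ^ k)" using Zn M by (intro mult_left_mono) auto
      finally show ?thesis by simp
    qed
    have sg: "summable (\<lambda>k. M * norm (T u) * (1/2::real) ^ k)"
      by (intro summable_mult summable_geometric) auto
    have sn: "summable (\<lambda>k. norm (v (Z k)))"
      using vn by (intro summable_comparison_test[OF _ sg]) auto
    then have sv: "summable (\<lambda>k. v (Z k))" by (rule summable_norm_cancel)
    define S where "S = (\<Sum>k. v (Z k))"
    have "norm S \<le> (\<Sum>k. norm (v (Z k)))" unfolding S_def by (rule summable_norm[OF sn])
    also have "\<dots> \<le> (\<Sum>k. M * norm (T u) * (1/2) ^ k)" by (rule suminf_le[OF vn sn sg])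
    also have "\<dots> = 2 * M * norm (T u)"
      by (subst suminf_mult) (auto simp: suminf_geometric)
    finally have nS: "norm S \<le> 2 * M * norm (T u)" .
    have "S \<in> E"
    proof (rule closed_sequentially[OF E(1)])
      show "(\<lambda>N. \<Sum>k<N. v (Z k)) \<longlonglongrightarrow> S" unfolding S_def by (rule summable_LIMSEQ[OF sv])
      show "(\<Sum>k<N. v (Z k)) \<in> E" for N using v[OF ZF] E(2) by (intro subspace_sum) auto
    qed
    have "(\<lambda>N. T (\<Sum>k<N. v (Z k))) \<longlonglongrightarrow> T S"
      unfolding S_def by (intro tendsto_intros summable_LIMSEQ[OF sv])
    moreover have "T (\<Sum>k<N. v (Z k)) = T u - Z N" for N
      by (induction N) (simp_all add: Z0 ZS blinfun.bilinear_simps)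
    moreover have "Z \<longlonglongrightarrow> 0"
    proof (rule Lim_null_comparison)
      show "\<forall>\<^sub>F k in sequentially. norm (Z k) \<le> norm (T u) * (1/2) ^ k" using Zn by simp
      show "(\<lambda>k. norm (T u) * (1/2::real) ^ k) \<longlonglongrightarrow> 0"
        by (intro tendsto_mult_right_zero LIMSEQ_power_zero) auto
    qed
    then have "(\<lambda>N. T u - Z N) \<longlonglongrightarrow> T u - 0" by (intro tendsto_intros)
    ultimately have "T S = T u" using LIMSEQ_unique by fastforce
    then have "S = u"
      using inj[of "S - u"] \<open>S \<in> E\<close> u E(2) by (simp add: blinfun.bilinear_simps subspace_diff)
    then show "norm u \<le> 2 * M * norm (T u)" using nS by simp
  qed
qed

text \<open>Precomposing the inverse of \<open>T\<close> on \<open>E\<close> with \<open>P\<close>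
  defines it on the whole space, so that the inverses at different points lie in one space of
  operators and can be compared in norm. The range of \<open>P\<close> is closed because it is the
  set of fixed points of \<open>P\<close>, so the previous bound applies.\<close>

lemma ex_partial_inverse:
  fixes T P :: "'e::banach \<Rightarrow>\<^sub>L 'e"
  assumes E: "closed E" "subspace E" and inj: "{u. T u = 0} \<inter> E = {0}"
    and P: "P o\<^sub>L P = P" and rP: "range (blinfun_apply P) = blinfun_apply T ` E"
  shows "\<exists>S :: 'e \<Rightarrow>\<^sub>L 'e. (\<forall>w. S w \<in> E \<and> T (S w) = P w) \<and> (\<forall>e \<in> E. S (T e) = e)"
proof -
  have PP: "P (P w) = P w" for w using P by (metis blinfun_apply_blinfun_compose)
  have inj': "u = v" if "u \<in> E" "v \<in> E" "T u = T v" for u v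
  proof -
    have "u - v \<in> {u. T u = 0} \<inter> E" using that E(2) by (simp add: blinfun.diff_right subspace_diff)
    then show ?thesis unfolding inj by simp
  qed
  have clP: "closed (range (blinfun_apply P))"
  proof -
    have "range (blinfun_apply P) = {w. P w = w}" using PP by (auto simp: image_iff) metis
    moreover have "closed {w. P w = w}" by (intro closed_Collect_eq continuous_intros)
    ultimately show ?thesis by simp
  qed
  have "u = 0" if "u \<in> E" "T u = 0" for u using inj that by blast
  from bounded_inverse_on_subspace[OF E clP rP[symmetric] this]
  obtain C where C: "C > 0" "\<And>u. u \<in> E \<Longrightarrow> norm u \<le> C * norm (T u)"
    by metis
  have "\<exists>u. u \<in> E \<and> T u = P w" for w using rP by (metis imageE rangeI)
  then obtain s where s: "\<And>w. s w \<in> E \<and> T (s w) = P w" by metis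
  have "bounded_linear s"
  proof (rule bounded_linear_intro)
    show "s (v + w) = s v + s w" for v w
      by (rule inj') (use s E in \<open>auto simp: blinfun.bilinear_simps subspace_add\<close>)
    show "s (r *\<^sub>R w) = r *\<^sub>R s w" for r w
      by (rule inj') (use s E in \<open>auto simp: blinfun.bilinear_simps subspace_scale\<close>)
    show "norm (s w) \<le> norm w * (norm P * C)" for w
    proof -
      have "norm (s w) \<le> C * norm (P w)" using C(2) s by metis
      also have "\<dots> \<le> C * (norm P * norm w)" using C(1) by (intro mult_left_mono norm_blinfun) auto
      finally show ?thesis by (simp add: algebra_simps)
    qed
  qed
  moreover have "s (T e) = e" if "e \<in> E" for e
  proof (rule inj')
    have "T e \<in> range (blinfun_apply P)" using rP that by auto
    then show "T (s (T e)) = T e" using s PP by auto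
  qed (use s that in auto)
  ultimately show ?thesis
    using s by (intro exI[of _ "Blinfun s"]) (auto simp: bounded_linear_Blinfun_apply)
qed

text \<open>An identity of resolvent type is used twice: first to bound \<open>S\<close> near
  \<open>y\<close>, then to make \<open>S x - S y\<close> small.\<close>

lemma continuous_partial_inverse:
  fixes L P S :: "'x \<Rightarrow> 'e::banach \<Rightarrow>\<^sub>L 'e"
  assumes L: "continuous_map X euclidean L" and P: "continuous_map X euclidean P"
    and PP: "\<And>x. x \<in> topspace X \<Longrightarrow> P x o\<^sub>L P x = P x"
    and S: "\<And>x w. x \<in> topspace X \<Longrightarrow> S x w \<in> E \<and> L x (S x w) = P x w"
    and SL: "\<And>x e. x \<in> topspace X \<Longrightarrow> e \<in> E \<Longrightarrow> S x (L x e) = e"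
  shows "continuous_map X euclidean S"
  unfolding continuous_map_euclidean_tendsto
proof
  fix y assume y: "y \<in> topspace X"
  let ?F = "atin X y"
  let ?d = "\<lambda>x. norm (S y) * norm (L y - L x)"
  have ev: "\<forall>\<^sub>F x in ?F. x \<in> topspace X"
    using y by (simp add: eventually_atin) (metis openin_topspace Diff_iff)
  have Lt: "(L \<longlongrightarrow> L y) ?F" and Pt: "(P \<longlongrightarrow> P y) ?F"
    using L P y by (auto simp: continuous_map_euclidean_tendsto)
  have "((\<lambda>x. norm (S y) * norm (L y - L x)) \<longlongrightarrow> norm (S y) * norm (L y - L y)) ?F"
    by (intro tendsto_intros Lt)
  then have d0: "(?d \<longlongrightarrow> 0) ?F" by simp
  then have d1: "\<forall>\<^sub>F x in ?F. ?d x < 1/2" by (rule order_tendstoD) simp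
  \<comment> \<open>This lets \<open>S y\<close> be written as \<open>S y o\<^sub>L P y\<close>, so
    that the difference from \<open>S y o\<^sub>L P x\<close> is controlled by
    \<open>P x - P y\<close>.\<close>
  have SP: "S y o\<^sub>L P y = S y"
  proof (rule blinfun_eqI)
    fix w
    have "S y (L y (S y (P y w))) = S y (P y (P y w))" using S y by simp
    moreover have "P y (P y w) = P y w" using PP[OF y] by (metis blinfun_apply_blinfun_compose)
    moreover have "S y (L y (S y w)) = S y w" using S SL y by blast
    moreover have "S y (P y w) = S y (L y (S y w))" using S y by simp
    ultimately show "(S y o\<^sub>L P y) w = S y w" by simp
  qed
  \<comment> \<open>\<open>S y\<close> inverts \<open>L y\<close> on \<open>E\<close>, so \<open>S x = S y L y S x\<close>; since \<open>L x S x = P x\<close>, replacing \<open>L y\<close> by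
    \<open>L x\<close> costs only the small term \<open>S y (L y - L x) S x\<close>.\<close>
  have eq: "S x = (S y o\<^sub>L P x) + (S y o\<^sub>L ((L y - L x) o\<^sub>L S x))" if x: "x \<in> topspace X" for x
  proof (rule blinfun_eqI)
    fix w
    have "S y (L y (S x w)) = S x w" using SL[OF y] S[OF x] by blast
    moreover have "S y (L x (S x w)) = S y (P x w)" using S[OF x] by simp
    ultimately show "S x w = ((S y o\<^sub>L P x) + (S y o\<^sub>L ((L y - L x) o\<^sub>L S x))) w"
      by (simp add: blinfun.bilinear_simps)
  qed
  have nc: "norm (S y o\<^sub>L ((L y - L x) o\<^sub>L S x)) \<le> ?d x * norm (S x)" for x
  proof -
    have "norm (S y o\<^sub>L ((L y - L x) o\<^sub>L S x)) \<le> norm (S y) * norm ((L y - L x) o\<^sub>L S x)"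
      by (rule norm_blinfun_compose)
    also have "\<dots> \<le> norm (S y) * (norm (L y - L x) * norm (S x))"
      by (intro mult_left_mono norm_blinfun_compose) auto
    finally show ?thesis by (simp add: mult.assoc)
  qed
  \<comment> \<open>The correction term is at most half of \<open>norm (S x)\<close> and is absorbed
    on the left, which costs the factor 2.\<close>
  have bd: "norm (S x) \<le> 2 * norm (S y) * norm (P x)" if x: "x \<in> topspace X" and d: "?d x < 1/2" for x
  proof -
    have "norm (S x) \<le> norm (S y o\<^sub>L P x) + norm (S y o\<^sub>L ((L y - L x) o\<^sub>L S x))"
      using eq[OF x] norm_triangle_ineq by metis
    also have "\<dots> \<le> norm (S y) * norm (P x) + ?d x * norm (S x)"
      by (intro add_mono nc norm_blinfun_compose)
    also have "?d x * norm (S x) \<le> 1/2 * norm (S x)" using d by (intro mult_right_mono) auto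
    finally show ?thesis by simp
  qed
  let ?B = "\<lambda>x. norm (S y) * norm (P x - P y) + ?d x * (2 * norm (S y) * norm (P x))"
  have "\<forall>\<^sub>F x in ?F. norm (S x - S y) \<le> ?B x"
    using ev d1
  proof eventually_elim
    case (elim x)
    have "S x - S y = (S y o\<^sub>L (P x - P y)) + (S y o\<^sub>L ((L y - L x) o\<^sub>L S x))"
      using eq[OF elim(1)] SP by (simp add: bounded_bilinear.diff_right[OF bounded_bilinear_blinfun_compose])
    then have "norm (S x - S y) \<le> norm (S y o\<^sub>L (P x - P y)) + norm (S y o\<^sub>L ((L y - L x) o\<^sub>L S x))"
      using norm_triangle_ineq by metis
    also have "\<dots> \<le> norm (S y) * norm (P x - P y) + ?d x * norm (S x)"
      by (intro add_mono nc norm_blinfun_compose)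
    also have "?d x * norm (S x) \<le> ?d x * (2 * norm (S y) * norm (P x))"
      using bd[OF elim] by (intro mult_left_mono) auto
    finally show ?case by simp
  qed
  moreover have "(?B \<longlongrightarrow> norm (S y) * norm (P y - P y) + 0 * (2 * norm (S y) * norm (P y))) ?F"
    by (intro tendsto_intros d0 Pt)
  then have "(?B \<longlongrightarrow> 0) ?F" by simp
  ultimately have "((\<lambda>x. S x - S y) \<longlongrightarrow> 0) ?F" by (rule Lim_null_comparison)
  then show "(S \<longlongrightarrow> S y) ?F" by (rule LIM_zero_cancel)
qed

text \<open>On the ball of radius 1/2 around the identity, operators are invertible with inverse of
  norm at most 2. This uniform bound gives continuity of the inverse through
  \<open>\<tau> x - \<tau> z = \<tau> x (T z - T x) \<tau> z\<close>.\<close>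

lemma local_inverse_near_id:
  fixes T :: "'x \<Rightarrow> 'e::banach \<Rightarrow>\<^sub>L 'e"
  assumes T: "continuous_map X euclidean T" and y: "y \<in> topspace X" "T y = id_blinfun"
  shows "\<exists>U \<tau>. openin X U \<and> y \<in> U \<and> continuous_map (subtopology X U) euclidean \<tau> \<and>
    (\<forall>x\<in>U. \<tau> x o\<^sub>L T x = id_blinfun \<and> T x o\<^sub>L \<tau> x = id_blinfun)"
proof -
  define U where "U = {x \<in> topspace X. T x \<in> ball id_blinfun (1/2)}"
  have oU: "openin X U" unfolding U_def by (rule openin_continuous_map_preimage[OF T]) simp
  have yU: "y \<in> U" using y by (simp add: U_def)
  have inv: "\<exists>R. R o\<^sub>L T x = id_blinfun \<and> T x o\<^sub>L R = id_blinfun \<and> norm R \<le> 2" if x: "x \<in> U" for x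
  proof -
    have n: "norm (id_blinfun - T x) \<le> 1/2" using x by (auto simp: U_def dist_norm)
    have d: "norm (v - T x v) \<le> 1/2 * norm v" for v
    proof -
      have "v - T x v = (id_blinfun - T x) v" by (simp add: blinfun.bilinear_simps)
      also have "norm \<dots> \<le> norm (id_blinfun - T x) * norm v" by (rule norm_blinfun)
      also have "\<dots> \<le> 1/2 * norm v" using n by (intro mult_right_mono) auto
      finally show ?thesis .
    qed
    have lb: "norm v \<le> 2 * norm (T x v)" for v
      using d[of v] norm_triangle_ineq2[of v "T x v"] norm_triangle_sub[of v "T x v"] by simp
    have "\<exists>v. T x v = w" for w
    proof -
      \<comment> \<open>Fixed points of this map are the solutions of \<open>T x v = w\<close>, and
        \<open>d\<close> makes it a contraction with factor 1/2.\<close>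
      have "\<exists>!v. w + (v - T x v) = v"
      proof (rule banach_fix_type[of "1/2"], safe)
        fix u v :: 'e
        have "dist (w + (u - T x u)) (w + (v - T x v)) = norm ((u - v) - T x (u - v))"
          by (simp add: dist_norm blinfun.bilinear_simps algebra_simps)
        also have "\<dots> \<le> 1/2 * dist u v" using d[of "u - v"] by (simp add: dist_norm)
        finally show "dist (w + (u - T x u)) (w + (v - T x v)) \<le> 1/2 * dist u v" .
      qed auto
      then obtain v where "w + (v - T x v) = v" by auto
      then have "T x v = w" by (simp add: algebra_simps)
      then show ?thesis ..
    qed
    then obtain s where s: "\<And>w. T x (s w) = w" by metis
    have inj: "u = v" if "T x u = T x v" for u v
      using lb[of "u - v"] that by (simp add: blinfun.bilinear_simps)
    have "bounded_linear s"
    proof (rule bounded_linear_intro)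
      show "s (v + w) = s v + s w" for v w by (rule inj) (simp add: s blinfun.bilinear_simps)
      show "s (r *\<^sub>R w) = r *\<^sub>R s w" for r w by (rule inj) (simp add: s blinfun.bilinear_simps)
      show "norm (s w) \<le> norm w * 2" for w using lb[of "s w"] by (simp add: s)
    qed
    then have ap: "blinfun_apply (Blinfun s) = s" by (rule bounded_linear_Blinfun_apply)
    have "norm (Blinfun s) \<le> 2"
      by (rule norm_blinfun_bound) (use lb[of "s _"] in \<open>simp_all add: ap s\<close>)
    moreover have "Blinfun s o\<^sub>L T x = id_blinfun" by (rule blinfun_eqI) (simp add: ap, rule inj, simp add: s)
    moreover have "T x o\<^sub>L Blinfun s = id_blinfun" by (rule blinfun_eqI) (simp add: ap s)
    ultimately show ?thesis by blast
  qed
  then obtain \<tau> where \<tau>: "\<And>x. x \<in> U \<Longrightarrow> \<tau> x o\<^sub>L T x = id_blinfun \<and> T x o\<^sub>L \<tau> x = id_blinfun \<and> norm (\<tau> x) \<le> 2"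
    by metis
  have "continuous_map (subtopology X U) euclidean \<tau>"
    unfolding continuous_map_euclidean_tendsto
  proof
    fix z assume z: "z \<in> topspace (subtopology X U)"
    let ?F = "atin (subtopology X U) z"
    have ev: "\<forall>\<^sub>F x in ?F. x \<in> topspace (subtopology X U)"
      using z by (simp add: eventually_atin) (metis Int_iff openin_topspace topspace_subtopology Diff_iff)
    have "continuous_map (subtopology X U) euclidean T" using T by (rule continuous_map_from_subtopology)
    then have Tt: "(T \<longlongrightarrow> T z) ?F" using z by (simp add: continuous_map_euclidean_tendsto)
    have "\<forall>\<^sub>F x in ?F. norm (\<tau> x - \<tau> z) \<le> 4 * norm (T z - T x)"
      using ev
    proof eventually_elim
      case (elim x)
      have "\<tau> x - \<tau> z = \<tau> x o\<^sub>L ((T z - T x) o\<^sub>L \<tau> z)"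
      proof (rule blinfun_eqI)
        fix w
        have "T z (\<tau> z w) = w" "\<tau> x (T x (\<tau> z w)) = \<tau> z w"
          using \<tau> z elim by (metis (no_types) Int_iff topspace_subtopology blinfun_apply_blinfun_compose blinfun_apply_id_blinfun id_apply)+
        then show "(\<tau> x - \<tau> z) w = (\<tau> x o\<^sub>L ((T z - T x) o\<^sub>L \<tau> z)) w"
          by (simp add: blinfun.bilinear_simps)
      qed
      also have "norm \<dots> \<le> norm (\<tau> x) * norm ((T z - T x) o\<^sub>L \<tau> z)" by (rule norm_blinfun_compose)
      also have "\<dots> \<le> norm (\<tau> x) * (norm (T z - T x) * norm (\<tau> z))"
        by (intro mult_left_mono norm_blinfun_compose) auto
      also have "\<dots> \<le> 2 * (norm (T z - T x) * 2)"
        using \<tau>[of x] \<tau>[of z] z elim by (intro mult_mono) auto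
      finally show ?case by simp
    qed
    moreover have "((\<lambda>x. 4 * norm (T z - T x)) \<longlongrightarrow> 4 * norm (T z - T z)) ?F" by (intro tendsto_intros Tt)
    then have "((\<lambda>x. 4 * norm (T z - T x)) \<longlongrightarrow> 0) ?F" by simp
    ultimately have "((\<lambda>x. \<tau> x - \<tau> z) \<longlongrightarrow> 0) ?F" by (rule Lim_null_comparison)
    then show "(\<tau> \<longlongrightarrow> \<tau> z) ?F" by (rule LIM_zero_cancel)
  qed
  then show ?thesis using oU yU \<tau> by blast
qed

section \<open>Local frames for ranges of projections\<close>

text \<open>Completeness is not an axiom of the class; it is pulled back along the isometry onto a
  closed subset of the complex numbers.\<close>

lemma complete_real_or_complex: "complete (UNIV :: 'k::real_or_complex set)"
  unfolding complete_def
proof (intro allI impI)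
  fix X :: "nat \<Rightarrow> 'k" assume "(\<forall>n. X n \<in> UNIV) \<and> Cauchy X"
  then have X: "Cauchy X" by simp
  obtain f :: "'k \<Rightarrow> complex" where add: "\<And>x y. f (x + y) = f x + f y"
    and nf: "\<And>x. norm (f x) = norm x" and rf: "range f = \<real> \<or> range f = UNIV"
    using ex_complex_embedding[where 'a = 'k] by blast
  have diff: "f (x - y) = f x - f y" for x y using add[of "x - y" y] by simp
  have df: "dist (f x) (f y) = dist x y" for x y by (simp add: dist_norm nf flip: diff)
  have "Cauchy (\<lambda>n. f (X n))" using X by (simp add: Cauchy_def df)
  then obtain l where l: "(\<lambda>n. f (X n)) \<longlonglongrightarrow> l" using convergent_def Cauchy_convergent by blast
  have "closed (range f)" using rf by (metis closed_UNIV closed_complex_Reals)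
  then have "l \<in> range f" using l closed_sequentially by (metis rangeI)
  then obtain y where "l = f y" by auto
  then have "X \<longlonglongrightarrow> y" using l by (simp add: tendsto_iff df)
  then show "\<exists>l\<in>UNIV. X \<longlonglongrightarrow> l" by blast
qed

section \<open>Finite dimensional subspaces over the scalar field\<close>

context normed_space_over
begin

lemma bounded_bilinear_scale: "bounded_bilinear scaleK"
proof
  show "scaleK (r *\<^sub>R a) b = r *\<^sub>R scaleK a b" for r a b
    by (metis scaleR_conv_of_real scale_of_real scale_scale)
  show "scaleK a (r *\<^sub>R b) = r *\<^sub>R scaleK a b" for r a b
    by (metis scale_of_real scale_left_commute)
  show "\<exists>K. \<forall>a b. norm (scaleK a b) \<le> norm a * norm b * K"
    by (rule exI[of _ 1]) (simp add: norm_scale)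
qed (simp_all add: scale_left_distrib scale_right_distrib)

lemmas continuous_map_scale = continuous_map_bilinear[OF bounded_bilinear_scale]

lemma subspace_imp_real_subspace:
  assumes "module.subspace scaleK V" shows "Real_Vector_Spaces.subspace V"
  using assms unfolding Real_Vector_Spaces.subspace_def subspace_def scale_of_real[symmetric] by auto

text \<open>Controls the coefficient of a new basis vector by the norm of the whole combination: for
  nonzero \<open>k\<close>, dividing by \<open>k\<close> turns \<open>s\<close> into a point of the
  span up to sign, and its distance from \<open>b\<close> is at least the infimum.\<close>

lemma norm_add_span_ge:
  assumes "closed (module.span scaleK B)" "b \<notin> module.span scaleK B" "s \<in> module.span scaleK B"
  shows "norm k * infdist b (module.span scaleK B) \<le> norm (scaleK k b + s)"
proof (cases "k = 0")
  case False
  have "scaleK k b + s = scaleK k (b - scaleK (- (1 / k)) s)"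
    using False by (simp add: scale_right_distrib)
  then have "norm (scaleK k b + s) = norm k * dist b (scaleK (- (1 / k)) s)"
    by (simp only: norm_scale dist_norm)
  moreover have "infdist b (module.span scaleK B) \<le> dist b (scaleK (- (1 / k)) s)"
    by (intro infdist_le span_scale assms)
  ultimately show ?thesis by (simp add: mult_left_mono)
qed (use assms in simp)

text \<open>Along a convergent sequence the coefficients of \<open>b\<close> are Cauchy by
  \<open>norm_add_span_ge\<close>. Completeness of the scalars gives their limit, and the remainders
  converge inside the smaller, closed span.\<close>

lemma closed_span_insert:
  assumes cl: "closed (module.span scaleK B)"
  shows "closed (module.span scaleK (insert b B))"
proof (cases "b \<in> module.span scaleK B")
  case True
  then show ?thesis using cl by (simp add: span_redundant)
next
  case False
  define d where "d = infdist b (module.span scaleK B)"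
  have d: "d > 0" unfolding d_def
    by (rule infdist_pos_not_in_closed[OF cl _ False]) (use span_zero in blast)
  show ?thesis
    unfolding closed_sequential_limits
  proof (intro allI impI, elim conjE)
    fix x l assume "\<forall>n. x n \<in> module.span scaleK (insert b B)" and xl: "x \<longlonglongrightarrow> l"
    then have "\<forall>n. \<exists>k. x n - scaleK k b \<in> module.span scaleK B"
      unfolding span_insert by simp
    then obtain c where c: "\<And>n. x n - scaleK (c n) b \<in> module.span scaleK B" by metis
    have lb: "norm (c m - c n) * d \<le> norm (x m - x n)" for m n
    proof -
      have "(x m - scaleK (c m) b) - (x n - scaleK (c n) b) \<in> module.span scaleK B"
        by (intro span_diff c)
      from norm_add_span_ge[OF cl False this, of "c m - c n"] show ?thesis
        by (simp add: d_def scale_left_diff_distrib algebra_simps)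
    qed
    have "Cauchy c"
    proof (rule metric_CauchyI)
      fix e :: real assume e: "e > 0"
      have "Cauchy x" using xl LIMSEQ_imp_Cauchy by blast
      then obtain M where M: "\<And>m n. m \<ge> M \<Longrightarrow> n \<ge> M \<Longrightarrow> dist (x m) (x n) < e * d"
        using metric_CauchyD[of x "e * d"] e d by auto
      have "dist (c m) (c n) < e" if "m \<ge> M" "n \<ge> M" for m n
      proof -
        have "norm (c m - c n) * d < e * d"
          using lb[of m n] M[OF that] by (simp add: dist_norm)
        then show ?thesis using d by (simp add: dist_norm)
      qed
      then show "\<exists>M. \<forall>m\<ge>M. \<forall>n\<ge>M. dist (c m) (c n) < e" by blast
    qed
    then obtain c' where c': "c \<longlonglongrightarrow> c'"
      using complete_real_or_complex[where 'k = 'k] unfolding complete_def by blast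
    have "(\<lambda>n. x n - scaleK (c n) b) \<longlonglongrightarrow> l - scaleK c' b"
      by (intro tendsto_diff xl bounded_bilinear.tendsto[OF bounded_bilinear_scale] c' tendsto_const)
    then have "l - scaleK c' b \<in> module.span scaleK B"
      by (rule closed_sequentially[OF cl c])
    then show "l \<in> module.span scaleK (insert b B)" unfolding span_insert by blast
  qed
qed

lemma closed_finite_span: "finite B \<Longrightarrow> closed (module.span scaleK B)"
  by (induction B rule: finite_induct) (simp_all add: closed_span_insert span_empty)

text \<open>Equivalence of norms in finite dimension, by induction on the basis: the distance of the
  new vector from the old span bounds its own coefficient, and subtracting its contribution reduces
  the rest to the old basis.\<close>

lemma independent_coord_bound:
  assumes "finite B" "\<not> module.dependent scaleK B"
  shows "\<exists>C>0. \<forall>a. \<forall>b\<in>B. norm (a b) \<le> C * norm (\<Sum>b\<in>B. scaleK (a b) b)"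
  using assms
proof (induction B rule: finite_induct)
  case empty then show ?case by (intro exI[of _ 1]) auto
next
  case (insert v B)
  have ind: "\<not> module.dependent scaleK B" and v: "v \<notin> module.span scaleK B"
    using insert independent_insert by auto
  obtain C where C: "C > 0" "\<And>a b. b \<in> B \<Longrightarrow> norm (a b) \<le> C * norm (\<Sum>b\<in>B. scaleK (a b) b)"
    using insert.IH[OF ind] by blast
  have cl: "closed (module.span scaleK B)" by (rule closed_finite_span[OF insert.hyps(1)])
  define d where "d = infdist v (module.span scaleK B)"
  have d: "d > 0" unfolding d_def
    by (rule infdist_pos_not_in_closed[OF cl _ v]) (use span_zero in blast)
  \<comment> \<open>The summand \<open>1 / d\<close> serves the coefficient of \<open>v\<close>. For
    the others, the combination of the old vectors has norm at most \<open>1 + norm v / d\<close>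
    times that of the whole, to which the old constant \<open>C\<close> applies.\<close>
  define C' where "C' = 1 / d + C * (1 + norm v / d)"
  have C': "C' > 0" using C d by (simp add: C'_def add_pos_nonneg)
  have "norm (a b) \<le> C' * norm (\<Sum>b\<in>insert v B. scaleK (a b) b)" if b: "b \<in> insert v B" for a b
  proof -
    define s where "s = (\<Sum>b\<in>B. scaleK (a b) b)"
    have w: "(\<Sum>b\<in>insert v B. scaleK (a b) b) = scaleK (a v) v + s"
      using insert.hyps by (simp add: s_def)
    let ?w = "scaleK (a v) v + s"
    have "s \<in> module.span scaleK B" unfolding s_def by (intro span_sum span_scale span_base)
    from norm_add_span_ge[OF cl v this, of "a v"] have "norm (a v) * d \<le> norm ?w" by (simp add: d_def)
    then have av: "norm (a v) \<le> 1 / d * norm ?w" using d by (simp add: field_simps)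
    show ?thesis
    proof (cases "b = v")
      case True
      have "1 / d * norm ?w \<le> C' * norm ?w"
        unfolding C'_def using C d by (intro mult_right_mono) auto
      then show ?thesis using av True w by simp
    next
      case False
      then have "norm (a b) \<le> C * norm s" using C(2)[of b a] b by (simp add: s_def)
      also have "norm s \<le> norm ?w + norm (scaleK (a v) v)"
        using norm_triangle_ineq4[of ?w "scaleK (a v) v"] by simp
      also have "norm (scaleK (a v) v) \<le> 1 / d * norm ?w * norm v"
        unfolding norm_scale using av by (intro mult_right_mono) auto
      finally have "norm (a b) \<le> C * (norm ?w + 1 / d * norm ?w * norm v)" using C(1) by simp
      also have "\<dots> = C * (1 + norm v / d) * norm ?w" by (simp add: algebra_simps)
      also have "\<dots> \<le> C' * norm ?w"
        unfolding C'_def using d by (intro mult_right_mono) auto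
      finally show ?thesis using w by simp
    qed
  qed
  then show ?case using C' by blast
qed

text \<open>Coordinates are defined only on the span of the basis; composing them with
  \<open>Q\<close> extends them to the whole space, and \<open>independent_coord_bound\<close> makes
  the extensions bounded.\<close>

lemma ex_coord_functionals:
  fixes b :: "'i \<Rightarrow> 'e" and Q :: "'e \<Rightarrow>\<^sub>L 'e"
  assumes I: "finite I" "inj_on b I" and ind: "\<not> module.dependent scaleK (b ` I)"
    and Q: "linear_over scaleK Q" and rQ: "range (blinfun_apply Q) \<subseteq> module.span scaleK (b ` I)"
    and Qb: "\<And>i. i \<in> I \<Longrightarrow> Q (b i) = b i"
  shows "\<exists>\<alpha>. (\<forall>i\<in>I. bounded_linear (\<alpha> i)) \<and> (\<forall>w. Q w = (\<Sum>i\<in>I. scaleK (\<alpha> i w) (b i))) \<and>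
    (\<forall>a. \<forall>i\<in>I. \<alpha> i (\<Sum>j\<in>I. scaleK (a j) (b j)) = a i)"
proof -
  let ?B = "b ` I"
  define \<alpha> where "\<alpha> i w = representation ?B (Q w) (b i)" for i w
  have sp: "Q w \<in> module.span scaleK ?B" for w using rQ by auto
  have fB: "finite ?B" using I by simp
  have eqB: "Q w = (\<Sum>v\<in>?B. scaleK (representation ?B (Q w) v) v)" for w
    by (rule sum_representation_eq[symmetric, OF ind sp fB order_refl])
  have eq: "Q w = (\<Sum>i\<in>I. scaleK (\<alpha> i w) (b i))" for w
    using eqB[of w] by (simp add: sum.reindex[OF I(2)] \<alpha>_def)
  obtain C where C: "C > 0" "\<And>a v. v \<in> ?B \<Longrightarrow> norm (a v) \<le> C * norm (\<Sum>v\<in>?B. scaleK (a v) v)"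
    using independent_coord_bound[OF fB ind] by blast
  have "bounded_linear (\<alpha> i)" if i: "i \<in> I" for i
  proof (rule bounded_linear_intro)
    show "\<alpha> i (v + w) = \<alpha> i v + \<alpha> i w" for v w
      unfolding \<alpha>_def blinfun.add_right by (simp add: representation_add[OF ind sp sp])
    show "\<alpha> i (r *\<^sub>R w) = r *\<^sub>R \<alpha> i w" for r w
    proof -
      have "Q (r *\<^sub>R w) = scaleK (of_real r) (Q w)"
        by (simp add: blinfun.scaleR_right scale_of_real)
      then show ?thesis
        unfolding \<alpha>_def by (simp add: representation_scale[OF ind sp] scaleR_conv_of_real)
    qed
    show "norm (\<alpha> i w) \<le> norm w * (C * norm Q)" for w
    proof -
      have "norm (\<alpha> i w) \<le> C * norm (Q w)"
        using C(2)[of "b i" "representation ?B (Q w)"] i eqB[of w] by (simp add: \<alpha>_def)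
      also have "\<dots> \<le> C * (norm Q * norm w)" using C by (intro mult_left_mono norm_blinfun) auto
      finally show ?thesis by (simp add: algebra_simps)
    qed
  qed
  moreover have "\<alpha> i (\<Sum>j\<in>I. scaleK (a j) (b j)) = a i" if i: "i \<in> I" for a i
  proof -
    have "Q (\<Sum>j\<in>I. scaleK (a j) (b j)) = (\<Sum>j\<in>I. scaleK (a j) (b j))"
      using Q Qb by (simp add: blinfun.sum_right linear_over_def)
    then have "\<alpha> i (\<Sum>j\<in>I. scaleK (a j) (b j)) = representation ?B (\<Sum>j\<in>I. scaleK (a j) (b j)) (b i)"
      by (simp add: \<alpha>_def)
    also have "\<dots> = (\<Sum>j\<in>I. representation ?B (scaleK (a j) (b j)) (b i))"
      by (subst representation_sum[OF ind]) (auto intro: span_scale span_base)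
    also have "\<dots> = (\<Sum>j\<in>I. if j = i then a j else 0)"
    proof (rule sum.cong)
      fix j assume j: "j \<in> I"
      then show "representation ?B (scaleK (a j) (b j)) (b i) = (if j = i then a j else 0)"
        using i I(2) by (auto simp: representation_scale[OF ind] span_base representation_basis[OF ind] inj_on_def)
    qed simp
    also have "\<dots> = a i" using i I by simp
    finally show ?thesis .
  qed
  ultimately show ?thesis using eq by blast
qed

end

text \<open>The coefficients \<beta> of \<open>Q x w\<close> in the moving frame
  \<open>g i x\<close> take an arbitrary vector \<open>w\<close> of the ambient space, so that their
  continuity can be stated on an ordinary product. \<open>coeff_combination\<close> expresses the
  independence of the frame at every point of \<open>U\<close>.\<close>

locale frame_coords =
  fixes scaleK :: "'k::real_or_complex \<Rightarrow> 'e::banach \<Rightarrow> 'e" and X :: "'x topology"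
    and Q :: "'x \<Rightarrow> 'e \<Rightarrow>\<^sub>L 'e" and g :: "'i \<Rightarrow> 'x \<Rightarrow> 'e" and I :: "'i set" and U :: "'x set"
    and \<beta> :: "'i \<Rightarrow> 'x \<Rightarrow> 'e \<Rightarrow> 'k"
  assumes continuous_coeff: "\<And>i. i \<in> I \<Longrightarrow>
      continuous_map (prod_topology (subtopology X U) euclidean) euclidean (\<lambda>p. \<beta> i (fst p) (snd p))"
    and expansion: "\<And>x w. x \<in> U \<Longrightarrow> Q x w = (\<Sum>i\<in>I. scaleK (\<beta> i x w) (g i x))"
    and coeff_combination: "\<And>x a i. \<lbrakk>x \<in> U; i \<in> I\<rbrakk> \<Longrightarrow> \<beta> i x (\<Sum>j\<in>I. scaleK (a j) (g j x)) = a i"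
    and coeff_add: "\<And>x v w i. \<lbrakk>x \<in> U; i \<in> I\<rbrakk> \<Longrightarrow> \<beta> i x (v + w) = \<beta> i x v + \<beta> i x w"
    and coeff_scale: "\<And>x k w i. \<lbrakk>x \<in> U; i \<in> I\<rbrakk> \<Longrightarrow> \<beta> i x (scaleK k w) = k * \<beta> i x w"

text \<open>The vectors are required to form a basis at \<open>y\<close> only. The property spreads
  to a neighbourhood because the operator comparing the frames at \<open>y\<close> and at
  \<open>x\<close> depends continuously on \<open>x\<close> and is the identity at
  \<open>y\<close>.\<close>

lemma local_frame:
  fixes scaleK :: "'k::real_or_complex \<Rightarrow> 'e::banach \<Rightarrow> 'e"
    and Q :: "'x \<Rightarrow> 'e \<Rightarrow>\<^sub>L 'e" and g :: "'i \<Rightarrow> 'x \<Rightarrow> 'e"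
  assumes ns: "normed_space_over scaleK" and y: "y \<in> topspace X"
    and Q: "continuous_map X euclidean Q"
    and lin: "\<forall>x \<in> topspace X. linear_over scaleK (Q x) \<and> Q x o\<^sub>L Q x = Q x"
    and I: "finite I" and gcont: "\<forall>i\<in>I. continuous_map X euclidean (g i)"
    and g_in: "\<forall>i\<in>I. \<forall>x \<in> topspace X. Q x (g i x) = g i x"
    and inj: "inj_on (\<lambda>i. g i y) I" and ind: "\<not> module.dependent scaleK ((\<lambda>i. g i y) ` I)"
    and span: "range (blinfun_apply (Q y)) \<subseteq> module.span scaleK ((\<lambda>i. g i y) ` I)"
  shows "\<exists>U \<beta>. openin X U \<and> y \<in> U \<and> frame_coords scaleK X Q g I U \<beta>"
proof -
  interpret normed_space_over scaleK by (rule ns)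
  note Qlin = bspec[OF lin] and g = bspec[OF gcont] and gQ = bspec[OF bspec[OF g_in]]
  have QQ: "Q x (Q x w) = Q x w" if "x \<in> topspace X" for x w
    using Qlin[OF that] by (metis blinfun_apply_blinfun_compose)
  have Qk: "Q x (scaleK k w) = scaleK k (Q x w)" if "x \<in> topspace X" for x k w
    using Qlin[OF that] by (simp add: linear_over_def)
  have Qy: "linear_over scaleK (Q y)" using Qlin y by simp
  obtain \<alpha> where \<alpha>: "\<And>i. i \<in> I \<Longrightarrow> bounded_linear (\<alpha> i)"
    and Q\<alpha>: "\<And>w. Q y w = (\<Sum>i\<in>I. scaleK (\<alpha> i w) (g i y))"
    and \<alpha>b: "\<And>a i. i \<in> I \<Longrightarrow> \<alpha> i (\<Sum>j\<in>I. scaleK (a j) (g j y)) = a i"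
    using ex_coord_functionals[OF I inj ind Qy span] gQ[OF _ y] by blast
  \<comment> \<open>The operator \<open>R i v\<close> has range in the line through \<open>v\<close>
    and depends boundedly and linearly on \<open>v\<close>; hence \<open>R i (g i x)\<close> is norm
    continuous in \<open>x\<close>.\<close>
  define R where "R i v = Blinfun (\<lambda>w. scaleK (\<alpha> i w) v)" for i v
  have bb: "bounded_bilinear (\<lambda>v w. scaleK (\<alpha> i w) v)" if "i \<in> I" for i
    using bounded_bilinear.flip[OF bounded_bilinear.comp1[OF bounded_bilinear_scale \<alpha>[OF that]]] .
  have Rap: "R i v w = scaleK (\<alpha> i w) v" if "i \<in> I" for i v w
    unfolding R_def using bounded_bilinear.bounded_linear_right[OF bb[OF that]] by (simp add: bounded_linear_Blinfun_apply)
  have bR: "bounded_linear (R i)" if "i \<in> I" for i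
    using transfer_bounded_bilinear_bounded_linearI[of "\<lambda>v w. scaleK (\<alpha> i w) v" "R i"] bb[OF that]
    by (simp add: Rap[OF that])
  \<comment> \<open>\<open>T y\<close> is the identity, and \<open>T x\<close> sends the basis \<open>g i y\<close> to \<open>g i x\<close> and \<open>ker (Q y)\<close> into
    \<open>ker (Q x)\<close>; so its inverse transports the coordinates at \<open>y\<close> to nearby points.\<close>
  define T where "T x = (\<Sum>i\<in>I. R i (g i x)) + ((id_blinfun - Q x) o\<^sub>L (id_blinfun - Q y))" for x
  have Tap: "T x v = (\<Sum>i\<in>I. scaleK (\<alpha> i v) (g i x)) + (v - Q y v - Q x (v - Q y v))" for x v
    by (simp add: T_def blinfun.bilinear_simps blinfun.sum_left Rap)
  have Tc: "continuous_map X euclidean T"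
    unfolding T_def
    by (intro continuous_map_add continuous_map_sum I continuous_map_bounded_linear[OF bR] g
        continuous_map_blinfun_compose continuous_map_diff Q continuous_map_canonical_const)
  have Ty: "T y = id_blinfun"
    by (rule blinfun_eqI) (simp add: Tap Q\<alpha>[symmetric] QQ[OF y] blinfun.diff_right)
  obtain U \<tau> where U: "openin X U" "y \<in> U" and \<tau>c: "continuous_map (subtopology X U) euclidean \<tau>"
    and \<tau>: "\<forall>x\<in>U. \<tau> x o\<^sub>L T x = id_blinfun \<and> T x o\<^sub>L \<tau> x = id_blinfun"
    using local_inverse_near_id[OF Tc y Ty] by blast
  have \<tau>T: "\<tau> x (T x w) = w" "T x (\<tau> x w) = w" if "x \<in> U" for x w
    using \<tau> that by (metis blinfun_apply_blinfun_compose blinfun_apply_id_blinfun id_apply)+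
  have Ut: "x \<in> topspace X" if "x \<in> U" for x using U that openin_subset by blast
  have QT: "Q x (T x v) = (\<Sum>i\<in>I. scaleK (\<alpha> i v) (g i x))" if x: "x \<in> topspace X" for x v
    using gQ[OF _ x] by (simp add: Tap blinfun.bilinear_simps blinfun.sum_right Qk[OF x] QQ[OF x])
  \<comment> \<open>\<open>\<tau> x (Q x w)\<close> is the vector that \<open>T x\<close> carries to
    \<open>Q x w\<close>; \<beta> reads off its coordinates at \<open>y\<close>, and
    \<open>QT\<close> turns them into coefficients with respect to the frame at
    \<open>x\<close>.\<close>
  define \<beta> where "\<beta> i x w = \<alpha> i (\<tau> x (Q x w))" for i x w
  have Q\<beta>: "Q x w = (\<Sum>i\<in>I. scaleK (\<beta> i x w) (g i x))" if x: "x \<in> U" for x w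
    using QT[OF Ut[OF x], of "\<tau> x (Q x w)"] by (simp add: \<tau>T[OF x] QQ[OF Ut[OF x]] \<beta>_def)
  have \<beta>g: "\<beta> i x (\<Sum>j\<in>I. scaleK (a j) (g j x)) = a i" if x: "x \<in> U" and i: "i \<in> I" for x a i
  proof -
    let ?s = "\<Sum>j\<in>I. scaleK (a j) (g j x)" and ?t = "\<Sum>j\<in>I. scaleK (a j) (g j y)"
    have "Q x ?s = ?s" using gQ[OF _ Ut[OF x]] by (simp add: blinfun.sum_right Qk[OF Ut[OF x]])
    moreover have "Q y ?t = ?t" using gQ[OF _ y] by (simp add: blinfun.sum_right Qk[OF y])
    then have "T x ?t = ?s" by (simp add: Tap \<alpha>b)
    ultimately show ?thesis using \<tau>T(1)[OF x, of ?t] \<alpha>b[OF i] by (simp add: \<beta>_def)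
  qed
  have \<beta>Q: "\<beta> i x (Q x w) = \<beta> i x w" if "x \<in> U" for i x w
    by (simp add: \<beta>_def QQ[OF Ut[OF that]])
  have "frame_coords scaleK X Q g I U \<beta>"
  proof
    show "continuous_map (prod_topology (subtopology X U) euclidean) euclidean (\<lambda>p. \<beta> i (fst p) (snd p))"
      if i: "i \<in> I" for i
      unfolding \<beta>_def
      by (intro continuous_map_bounded_linear[OF \<alpha>[OF i]] continuous_map_blinfun_apply continuous_map_snd
          continuous_map_compose[OF continuous_map_fst \<tau>c, unfolded o_def]
          continuous_map_compose[OF continuous_map_fst continuous_map_from_subtopology[OF Q], unfolded o_def])
    show "\<beta> i x (v + w) = \<beta> i x v + \<beta> i x w" if x: "x \<in> U" and i: "i \<in> I" for x i v w
    proof -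
      have "Q x (v + w) = (\<Sum>j\<in>I. scaleK (\<beta> j x v + \<beta> j x w) (g j x))"
        using Q\<beta>[OF x, of v] Q\<beta>[OF x, of w] by (simp add: blinfun.add_right scale_left_distrib sum.distrib)
      then show ?thesis using \<beta>g[OF x i, of "\<lambda>j. \<beta> j x v + \<beta> j x w"] \<beta>Q[OF x, of i "v + w"] by simp
    qed
    \<comment> \<open>The functionals \<alpha> are only known to be real linear, so homogeneity over
      the scalar field is derived from the uniqueness of the coefficients.\<close>
    show "\<beta> i x (scaleK k w) = k * \<beta> i x w" if x: "x \<in> U" and i: "i \<in> I" for x i k w
    proof -
      have "Q x (scaleK k w) = (\<Sum>j\<in>I. scaleK (k * \<beta> j x w) (g j x))"
        using Q\<beta>[OF x, of w] by (simp add: Qk[OF Ut[OF x]] scale_sum_right)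
      then show ?thesis using \<beta>g[OF x i, of "\<lambda>j. k * \<beta> j x w"] \<beta>Q[OF x, of i "scaleK k w"] by simp
    qed
  qed (auto intro: Q\<beta> \<beta>g)
  then show ?thesis using U by blast
qed

section \<open>Ranges of projections and kernels as vector bundles\<close>

lemma restrict_bundle_simps:
  "vtotal (restrict_bundle X scaleK V) = subtopology (prod_topology X euclidean) {(x, u). u \<in> V x}"
  "vproj (restrict_bundle X scaleK V) = fst"
  "vadd (restrict_bundle X scaleK V) p q = (fst p, snd p + snd q)"
  "vscale (restrict_bundle X scaleK V) c p = (fst p, scaleK c (snd p))"
  by (auto simp: restrict_bundle_def product_bundle_def split_beta)

lemma topspace_restrict_bundle:
  "topspace (vtotal (restrict_bundle X scaleK V)) = {(x, u). x \<in> topspace X \<and> u \<in> V x}"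
  by (auto simp: restrict_bundle_simps)

lemma continuous_map_into_restrict_bundle:
  "continuous_map Z (vtotal (restrict_bundle X scaleK V)) f \<longleftrightarrow>
     continuous_map Z X (\<lambda>z. fst (f z)) \<and> continuous_map Z euclidean (\<lambda>z. snd (f z)) \<and>
     (\<forall>z \<in> topspace Z. snd (f z) \<in> V (fst (f z)))"
  by (auto simp: restrict_bundle_simps continuous_map_in_subtopology continuous_map_pairwise o_def
      split_beta image_subset_iff Pi_iff)

lemma continuous_map_from_restrict_bundle:
  "continuous_map (vtotal (restrict_bundle X scaleK V)) X fst"
  "continuous_map (vtotal (restrict_bundle X scaleK V)) euclidean snd"
  by (auto simp: restrict_bundle_simps intro: continuous_map_subtopology_fst continuous_map_subtopology_snd)

lemma (in normed_space_over) finite_dim_basis: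
  assumes "finite_dim scaleK S"
  obtains B where "finite B" "\<not> module.dependent scaleK B" "S = module.span scaleK B"
proof -
  from assms obtain B0 where B0: "finite B0" "S = module.span scaleK B0" by (auto simp: finite_dim_def)
  obtain B where B: "B \<subseteq> B0" "\<not> module.dependent scaleK B" "B0 \<subseteq> module.span scaleK B"
    by (rule maximal_independent_subset)
  have "module.span scaleK B0 = module.span scaleK B"
  proof
    show "module.span scaleK B0 \<subseteq> module.span scaleK B"
      by (rule span_minimal[OF B(3) subspace_span])
    show "module.span scaleK B \<subseteq> module.span scaleK B0" by (rule span_mono[OF B(1)])
  qed
  then show thesis using that B B0 finite_subset by blast
qed

text \<open>A basis of the range at \<open>y\<close>, moved into the neighbouring ranges by
  \<open>Q x\<close>, is a frame near \<open>y\<close>; its coefficients are the fibre coordinates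
  of a chart.\<close>

lemma vector_bundle_range_projection:
  fixes scaleK :: "'k::real_or_complex \<Rightarrow> 'e::banach \<Rightarrow> 'e" and Q :: "'x \<Rightarrow> 'e \<Rightarrow>\<^sub>L 'e"
  assumes ns: "normed_space_over scaleK"
    and Q: "continuous_map X euclidean Q"
    and Qlin: "\<And>x. x \<in> topspace X \<Longrightarrow> linear_over scaleK (Q x) \<and> Q x o\<^sub>L Q x = Q x"
    and fin: "\<And>x. x \<in> topspace X \<Longrightarrow> finite_dim scaleK (range (blinfun_apply (Q x)))"
  shows "vector_bundle X (restrict_bundle X scaleK (\<lambda>x. range (blinfun_apply (Q x))))"
proof -
  interpret normed_space_over scaleK by (rule ns)
  let ?R = "restrict_bundle X scaleK (\<lambda>x. range (blinfun_apply (Q x)))"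
  have QQ: "Q x (Q x w) = Q x w" if "x \<in> topspace X" for x w
    using Qlin[OF that] by (metis blinfun_apply_blinfun_compose)
  have Qk: "Q x (scaleK k w) = scaleK k (Q x w)" if "x \<in> topspace X" for x k w
    using Qlin[OF that] by (simp add: linear_over_def)
  show ?thesis
  proof (rule vector_bundleI)
    show "continuous_map (vtotal ?R) X (vproj ?R)"
      unfolding restrict_bundle_simps(2) by (rule continuous_map_from_restrict_bundle)
  next
    fix e and k :: 'k assume e: "e \<in> topspace (vtotal ?R)"
    then obtain v where "snd e = Q (fst e) v" by (auto simp: topspace_restrict_bundle)
    then have "scaleK k (snd e) = Q (fst e) (scaleK k v)" using e Qk by (auto simp: topspace_restrict_bundle)
    then show "vscale ?R k e \<in> topspace (vtotal ?R) \<and> vproj ?R (vscale ?R k e) = vproj ?R e"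
      using e by (auto simp: topspace_restrict_bundle restrict_bundle_simps(2-4))
  next
    fix e e' assume "e \<in> topspace (vtotal ?R)" "e' \<in> topspace (vtotal ?R)" "vproj ?R e' = vproj ?R e"
    then show "vadd ?R e e' \<in> topspace (vtotal ?R) \<and> vproj ?R (vadd ?R e e') = vproj ?R e"
      by (auto simp: topspace_restrict_bundle restrict_bundle_simps(2-4) image_iff simp flip: blinfun.add_right)
  next
    fix y assume y: "y \<in> topspace X"
    obtain B where B: "finite B" "\<not> module.dependent scaleK B" "range (blinfun_apply (Q y)) = module.span scaleK B"
      using finite_dim_basis[OF fin[OF y]] by blast
    define n where "n = card B"
    obtain b where b: "bij_betw b {..<n} B"
      using ex_bij_betw_nat_finite[OF B(1)] by (auto simp: n_def atLeast0LessThan)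
    have bB: "b ` {..<n} = B" "inj_on b {..<n}" using b by (auto simp: bij_betw_def)
    have Qb: "Q y (b i) = b i" if "i < n" for i
    proof -
      have "b i \<in> range (blinfun_apply (Q y))" unfolding B(3) using bB that by (intro span_base) auto
      then show ?thesis using QQ[OF y] by auto
    qed
    define g where "g i x = Q x (b i)" for i x
    have gy: "(\<lambda>i. g i y) ` {..<n} = B" "inj_on (\<lambda>i. g i y) {..<n}"
      using bB Qb by (auto simp: g_def inj_on_def)
    have gc: "continuous_map X euclidean (g i)" for i
      unfolding g_def by (intro continuous_map_blinfun_apply Q continuous_map_canonical_const)
    have 1: "\<forall>x \<in> topspace X. linear_over scaleK (Q x) \<and> Q x o\<^sub>L Q x = Q x"
      "\<forall>i\<in>{..<n}. continuous_map X euclidean (g i)"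
      "\<forall>i\<in>{..<n}. \<forall>x \<in> topspace X. Q x (g i x) = g i x"
      using Qlin gc QQ by (auto simp: g_def)
    from local_frame[OF ns y Q 1(1) finite_lessThan 1(2,3) gy(2), unfolded gy(1), OF B(2) equalityD1[OF B(3)]]
    obtain U \<beta> where U: "openin X U" "y \<in> U" and "frame_coords scaleK X Q g {..<n} U \<beta>" by blast
    then interpret frame_coords scaleK X Q g "{..<n}" U \<beta> by simp
    note \<beta>c = continuous_coeff[OF lessThan_iff[THEN iffD2]] and Q\<beta> = expansion
      and \<beta>g = coeff_combination[OF _ lessThan_iff[THEN iffD2]] and \<beta>a = coeff_add[OF _ lessThan_iff[THEN iffD2]]
      and \<beta>s = coeff_scale[OF _ lessThan_iff[THEN iffD2]]
    have Ut: "U \<subseteq> topspace X" using U by (simp add: openin_subset)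
    have Qg: "Q x (\<Sum>i<n. scaleK (a i) (g i x)) = (\<Sum>i<n. scaleK (a i) (g i x))" if "x \<in> U" for x a
      using that Ut QQ by (simp add: blinfun.sum_right Qk subset_iff g_def)
    define c where "c e i = (if i < n then \<beta> i (fst e) (snd e) else 0)" for e :: "'x \<times> 'e" and i
    define \<psi> where "\<psi> q = (fst q, \<Sum>i<n. scaleK (snd q i) (g i (fst q)))" for q
    have "bundle_chart X ?R U n c \<psi>"
    proof
      show "U \<subseteq> topspace X" by (rule Ut)
      show "continuous_map (vtotal ?R) X (vproj ?R)"
        unfolding restrict_bundle_simps(2) by (rule continuous_map_from_restrict_bundle)
      let ?Z = "subtopology (vtotal ?R) {e. vproj ?R e \<in> U}"
      have "continuous_map ?Z (prod_topology (subtopology X U) euclidean) (\<lambda>e. e)"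
        using continuous_map_from_restrict_bundle[of X scaleK "\<lambda>x. range (blinfun_apply (Q x))"]
        by (auto simp: continuous_map_pairwise o_def continuous_map_in_subtopology restrict_bundle_simps(2)
            intro!: continuous_map_from_subtopology)
      from continuous_map_compose[OF this \<beta>c] show "continuous_map ?Z euclidean (\<lambda>e. c e i)" for i
        by (cases "i < n") (auto simp: c_def o_def)
      let ?T = "prod_topology (subtopology X U) (coord_space n) :: ('x \<times> (nat \<Rightarrow> 'k)) topology"
      have "continuous_map ?T euclidean (\<lambda>q. snd q i)" for i
        using continuous_map_compose[OF continuous_map_snd continuous_map_coord, of "subtopology X U" n i]
        by (simp add: o_def)
      moreover have "continuous_map ?T X fst"
        using continuous_map_fst[of "subtopology X U" "coord_space n :: (nat \<Rightarrow> 'k) topology"]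
        by (simp add: continuous_map_in_subtopology)
      moreover have "continuous_map ?T euclidean (\<lambda>q. g i (fst q))" for i
        using continuous_map_compose[OF calculation(2) gc] by (simp add: o_def)
      moreover have "(\<Sum>i<n. scaleK (a i) (g i x)) \<in> range (blinfun_apply (Q x))" if "x \<in> U" for x a
        by (rule range_eqI) (rule Qg[OF that, symmetric])
      ultimately show "continuous_map ?T (vtotal ?R) \<psi>"
        unfolding continuous_map_into_restrict_bundle
        by (auto simp: \<psi>_def intro!: continuous_map_sum continuous_map_scale)
      show "\<psi> (vproj ?R e, c e) = e" if e: "e \<in> topspace (vtotal ?R)" "vproj ?R e \<in> U" for e
      proof -
        have "Q (fst e) (snd e) = snd e" using e QQ by (auto simp: topspace_restrict_bundle)
        then show ?thesis using Q\<beta>[of "fst e" "snd e"] e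
          by (simp add: \<psi>_def c_def restrict_bundle_simps(2))
      qed
    qed (auto simp: restrict_bundle_simps(2-4) c_def \<psi>_def \<beta>g \<beta>a \<beta>s fun_eq_iff)
    then show "\<exists>U n c \<psi>. openin X U \<and> y \<in> U \<and> bundle_chart X ?R U n c \<psi>" using U by blast
  qed
qed

section \<open>Kernels and local splittings of surjective bundle maps\<close>

definition kernel_bundle :: "('x, 'k::real_or_complex, 'b) vbundle \<Rightarrow> ('b \<Rightarrow> 'e::zero) \<Rightarrow> ('x, 'k, 'b) vbundle" where
  "kernel_bundle \<zeta> h = \<zeta>\<lparr>vtotal := subtopology (vtotal \<zeta>) {e. h e = 0}\<rparr>"

lemma kernel_bundle_simps [simp]:
  "vtotal (kernel_bundle \<zeta> h) = subtopology (vtotal \<zeta>) {e. h e = 0}"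
  "vproj (kernel_bundle \<zeta> h) = vproj \<zeta>" "vadd (kernel_bundle \<zeta> h) = vadd \<zeta>"
  "vscale (kernel_bundle \<zeta> h) = vscale \<zeta>"
  by (simp_all add: kernel_bundle_def)

text \<open>Surjectivity in the fibre over \<open>y\<close> allows some of the chart coordinates to
  be selected whose unit vectors are mapped by \<open>h\<close> to a basis of the range of
  \<open>Q y\<close>. They stay a frame nearby, and then serve twice: using only these coordinates
  gives the linear section \<open>s\<close>, and solving for them parametrises the kernel by the
  others. Hence both conclusions are obtained together.\<close>

lemma local_kernel_splitting:
  fixes scaleK :: "'k::real_or_complex \<Rightarrow> 'e::banach \<Rightarrow> 'e" and Q :: "'x \<Rightarrow> 'e \<Rightarrow>\<^sub>L 'e"
    and \<zeta> :: "('x, 'k, 'b) vbundle" and h :: "'b \<Rightarrow> 'e"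
  assumes ns: "normed_space_over scaleK" and \<zeta>: "vector_bundle X \<zeta>" and y: "y \<in> topspace X"
    and Q: "continuous_map X euclidean Q"
    and Qlin: "\<And>x. x \<in> topspace X \<Longrightarrow> linear_over scaleK (Q x) \<and> Q x o\<^sub>L Q x = Q x"
    and h: "continuous_map (vtotal \<zeta>) euclidean h"
    and hscale: "\<And>e k. e \<in> topspace (vtotal \<zeta>) \<Longrightarrow> h (vscale \<zeta> k e) = scaleK k (h e)"
    and hadd: "\<And>e e'. \<lbrakk>e \<in> topspace (vtotal \<zeta>); e' \<in> topspace (vtotal \<zeta>); vproj \<zeta> e' = vproj \<zeta> e\<rbrakk> \<Longrightarrow>
       h (vadd \<zeta> e e') = h e + h e'"
    and hQ: "\<And>e. e \<in> topspace (vtotal \<zeta>) \<Longrightarrow> Q (vproj \<zeta> e) (h e) = h e"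
    and surj: "\<And>x w. x \<in> topspace X \<Longrightarrow> \<exists>e \<in> topspace (vtotal \<zeta>). vproj \<zeta> e = x \<and> h e = Q x w"
  shows "\<exists>U. openin X U \<and> y \<in> U \<and> (\<exists>n c \<psi>. bundle_chart X (kernel_bundle \<zeta> h) U n c \<psi>) \<and>
    (\<exists>s. continuous_map (prod_topology (subtopology X U) euclidean) (vtotal \<zeta>) s \<and>
      (\<forall>x\<in>U. \<forall>w. vproj \<zeta> (s (x, w)) = x \<and> h (s (x, w)) = Q x w) \<and>
      (\<forall>x\<in>U. \<forall>v w. s (x, v + w) = vadd \<zeta> (s (x, v)) (s (x, w))) \<and>
      (\<forall>x\<in>U. \<forall>k w. s (x, scaleK k w) = vscale \<zeta> k (s (x, w))))"
proof -
  interpret normed_space_over scaleK by (rule ns)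
  obtain U N c \<psi> where U: "openin X U" "y \<in> U" and ch: "bundle_chart X \<zeta> U N c \<psi>"
    using \<zeta> y by (rule vector_bundle_chartE)
  interpret bundle_chart X \<zeta> U N c \<psi> by (rule ch)
  have QQ: "Q x (Q x w) = Q x w" if "x \<in> topspace X" for x w
    using Qlin[OF that] by (metis blinfun_apply_blinfun_compose)
  have Qk: "Q x (scaleK k w) = scaleK k (Q x w)" if "x \<in> topspace X" for x k w
    using Qlin[OF that] by (simp add: linear_over_def)
  have \<psi>add: "\<psi> (x, \<lambda>i. a i + b i) = vadd \<zeta> (\<psi> (x, a)) (\<psi> (x, b))"
    if x: "x \<in> U" and a: "\<And>i. i \<ge> N \<Longrightarrow> a i = 0" and b: "\<And>i. i \<ge> N \<Longrightarrow> b i = 0" for x a b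
  proof -
    let ?a = "\<psi> (x, a)" and ?b = "\<psi> (x, b)"
    have t: "?a \<in> topspace (vtotal \<zeta>)" "?b \<in> topspace (vtotal \<zeta>)" "vproj \<zeta> ?a = x" "vproj \<zeta> ?b = x"
      using inv_in_total vproj_inv x a b by auto
    then have "vadd \<zeta> ?a ?b \<in> topspace (vtotal \<zeta>)" "vproj \<zeta> (vadd \<zeta> ?a ?b) = x"
      using vadd_closed[OF \<zeta> t(1,2)] by auto
    moreover have "c (vadd \<zeta> ?a ?b) = (\<lambda>i. a i + b i)"
      using coord_add[OF t(1,2)] t x coord_inv[OF x a] coord_inv[OF x b] by simp
    ultimately show ?thesis using inv_coord x by metis
  qed
  have \<psi>scale: "\<psi> (x, \<lambda>i. k * a i) = vscale \<zeta> k (\<psi> (x, a))"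
    if x: "x \<in> U" and a: "\<And>i. i \<ge> N \<Longrightarrow> a i = 0" for x k a
  proof -
    let ?a = "\<psi> (x, a)"
    have t: "?a \<in> topspace (vtotal \<zeta>)" "vproj \<zeta> ?a = x"
      using inv_in_total vproj_inv x a by auto
    then have "vscale \<zeta> k ?a \<in> topspace (vtotal \<zeta>)" "vproj \<zeta> (vscale \<zeta> k ?a) = x"
      using vscale_closed[OF \<zeta> t(1)] by auto
    moreover have "c (vscale \<zeta> k ?a) = (\<lambda>i. k * a i)"
      using coord_scale[OF t(1)] t x coord_inv[OF x a] by simp
    ultimately show ?thesis using inv_coord x by metis
  qed
  \<comment> \<open>The image under \<open>h\<close> of the \<open>l\<close>-th unit vector of the
    chart, that is, the \<open>l\<close>-th column of \<open>h\<close> in these coordinates.\<close>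
  define g where "g l x = h (\<psi> (x, \<lambda>i. if i = l then 1 else 0))" for l x
  \<comment> \<open>The induction is on the number of leading coordinates that may be nonzero; in
    the base case the zero vector is reached as a multiple by 0.\<close>
  have h\<psi>_le: "M \<le> N \<Longrightarrow> (\<And>i. i \<ge> M \<Longrightarrow> a i = 0) \<Longrightarrow> h (\<psi> (x, a)) = (\<Sum>l<M. scaleK (a l) (g l x))"
    if x: "x \<in> U" for x M a
  proof (induction M arbitrary: a)
    case 0
    then have "a = (\<lambda>i. 0)" by auto
    moreover have "\<psi> (x, \<lambda>i. 0 * (0::'k)) = vscale \<zeta> 0 (\<psi> (x, \<lambda>i. 0))" by (rule \<psi>scale[OF x]) auto
    moreover have "h (vscale \<zeta> 0 (\<psi> (x, \<lambda>i. 0))) = scaleK 0 (h (\<psi> (x, \<lambda>i. 0)))"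
      by (rule hscale) (use inv_in_total[OF x] in auto)
    ultimately show ?case by simp
  next
    case (Suc M)
    define a' where "a' i = (if i < M then a i else 0)" for i
    define e where "e = (\<lambda>i. if i = M then 1 else 0::'k)"
    have a': "i \<ge> N \<Longrightarrow> a' i = 0" and e: "i \<ge> N \<Longrightarrow> e i = 0" for i using Suc.prems by (auto simp: a'_def e_def)
    have "a = (\<lambda>i. a' i + a M * e i)" using Suc.prems(2) by (auto simp: a'_def e_def fun_eq_iff)
    then have "\<psi> (x, a) = vadd \<zeta> (\<psi> (x, a')) (vscale \<zeta> (a M) (\<psi> (x, e)))"
      using \<psi>add[OF x, of a' "\<lambda>i. a M * e i"] a' e \<psi>scale[OF x, of e "a M"] by simp
    moreover have "\<psi> (x, a') \<in> topspace (vtotal \<zeta>)" "\<psi> (x, e) \<in> topspace (vtotal \<zeta>)"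
      "vproj \<zeta> (\<psi> (x, a')) = x" "vproj \<zeta> (\<psi> (x, e)) = x"
      using inv_in_total vproj_inv x a' e by auto
    ultimately have "h (\<psi> (x, a)) = h (\<psi> (x, a')) + scaleK (a M) (h (\<psi> (x, e)))"
      using hadd hscale vscale_closed[OF \<zeta>] by simp
    moreover have "h (\<psi> (x, a')) = (\<Sum>l<M. scaleK (a' l) (g l x))"
      by (rule Suc.IH) (use Suc.prems in \<open>auto simp: a'_def\<close>)
    ultimately show ?case by (simp add: a'_def g_def e_def)
  qed
  have h\<psi>: "h (\<psi> (x, a)) = (\<Sum>l<N. scaleK (a l) (g l x))" if "x \<in> U" "\<And>i. i \<ge> N \<Longrightarrow> a i = 0" for x a
    by (rule h\<psi>_le) (use that in auto)
  have h_coord: "h e = (\<Sum>l<N. scaleK (c e l) (g l (vproj \<zeta> e)))"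
    if "e \<in> topspace (vtotal \<zeta>)" "vproj \<zeta> e \<in> U" for e
    using h\<psi>[of "vproj \<zeta> e" "c e"] coord_zero inv_coord that by metis
  have gc: "continuous_map (subtopology X U) euclidean (g l)" if "l < N" for l
  proof -
    have "continuous_map (subtopology X U) (prod_topology (subtopology X U) (coord_space N)) (\<lambda>x. (x, \<lambda>i. if i = l then 1 else 0))"
      using that by (auto simp: continuous_map_pairwise o_def continuous_map_coord_space topspace_coord_space)
    from continuous_map_compose[OF continuous_map_compose[OF this continuous_inv] h]
    show ?thesis by (simp add: o_def g_def[abs_def])
  qed
  have gQ: "Q x (g l x) = g l x" if "l < N" "x \<in> U" for l x
    using hQ[of "\<psi> (x, \<lambda>i. if i = l then 1 else 0)"] inv_in_total[of x] vproj_inv[of x] that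
    by (auto simp: g_def)
  let ?G = "(\<lambda>l. g l y) ` {..<N}"
  \<comment> \<open>The basis is selected among the columns themselves so that it is indexed by
    coordinates. Of several equal columns only one index enters \<open>I\<close>; the other indices
    go to \<open>J\<close>.\<close>
  obtain B where B: "B \<subseteq> ?G" "\<not> module.dependent scaleK B" "?G \<subseteq> module.span scaleK B"
    by (rule maximal_independent_subset)
  then obtain I where I: "I \<subseteq> {..<N}" "inj_on (\<lambda>l. g l y) I" "B = (\<lambda>l. g l y) ` I"
    unfolding subset_image_inj by auto
  have finI: "finite I" using I finite_subset by blast
  have spanB: "range (blinfun_apply (Q y)) \<subseteq> module.span scaleK B"
  proof clarify
    fix w
    obtain e where e: "e \<in> topspace (vtotal \<zeta>)" "vproj \<zeta> e = y" "h e = Q y w" using surj[OF y] by blast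
    have "h e \<in> module.span scaleK B"
      using h_coord[OF e(1)] e(2) U(2) B(3) by (auto intro!: span_sum span_scale)
    then show "Q y w \<in> module.span scaleK B" using e by simp
  qed
  have 1: "y \<in> topspace (subtopology X U)" "continuous_map (subtopology X U) euclidean Q"
    using y U Q by (auto intro: continuous_map_from_subtopology)
  have 2: "\<forall>x \<in> topspace (subtopology X U). linear_over scaleK (Q x) \<and> Q x o\<^sub>L Q x = Q x"
    "\<forall>i\<in>I. continuous_map (subtopology X U) euclidean (g i)"
    "\<forall>i\<in>I. \<forall>x \<in> topspace (subtopology X U). Q x (g i x) = g i x"
    using Qlin gc gQ I by auto
  from local_frame[OF ns 1 2(1) finI 2(2,3) I(2), folded I(3), OF B(2) spanB]
  obtain U' \<beta> where U'o: "openin (subtopology X U) U'" and yU': "y \<in> U'"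
    and "frame_coords scaleK (subtopology X U) Q g I U' \<beta>" by blast
  then interpret fr: frame_coords scaleK "subtopology X U" Q g I U' \<beta> by simp
  note \<beta>c = fr.continuous_coeff and Q\<beta> = fr.expansion and \<beta>g = fr.coeff_combination
    and \<beta>a = fr.coeff_add and \<beta>s = fr.coeff_scale
  have U'U: "U' \<subseteq> U" using openin_subset[OF U'o] by auto
  have oU': "openin X U'" using U'o U(1) openin_trans_full by blast
  have subU': "subtopology (subtopology X U) U' = subtopology X U'"
    using U'U by (simp add: subtopology_subtopology Int_absorb1)
  have U't: "U' \<subseteq> topspace X" using U'U base by blast
  have Qsum: "Q x (\<Sum>i\<in>A. scaleK (a i) (g i x)) = (\<Sum>i\<in>A. scaleK (a i) (g i x))" if "x \<in> U'" "A \<subseteq> {..<N}" for x a A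
  proof -
    have "Q x (g i x) = g i x" if "i \<in> A" for i using gQ \<open>A \<subseteq> {..<N}\<close> \<open>x \<in> U'\<close> U'U that by auto
    then show ?thesis using that U't by (simp add: blinfun.sum_right Qk subset_iff)
  qed
  \<comment> \<open>Charts use initial segments of the natural numbers, so the kernel coordinates
    are renumbered by an enumeration \<open>r\<close> of \<open>J\<close>.\<close>
  define J where "J = {..<N} - I"
  define q where "q = card J"
  have finJ: "finite J" by (simp add: J_def)
  obtain r where "bij_betw r {..<q} J"
    using ex_bij_betw_nat_finite[OF finJ] by (auto simp: q_def atLeast0LessThan)
  then have r: "r ` {..<q} = J" "inj_on r {..<q}" by (auto simp: bij_betw_def)
  have rJ: "r i \<in> J" if "i < q" for i using r that by auto
  let ?r' = "inv_into {..<q} r"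
  have r': "?r' l < q" "r (?r' l) = l" if "l \<in> J" for l
    using that r inv_into_into[of l r "{..<q}"] f_inv_into_f[of l r "{..<q}"] by auto
  have r'': "?r' (r i) = i" if "i < q" for i using that r by simp
  have split: "(\<Sum>l<N. f l) = (\<Sum>i<q. f (r i)) + (\<Sum>l\<in>I. f l)" for f :: "nat \<Rightarrow> 'e"
  proof -
    have "(\<Sum>l<N. f l) = (\<Sum>l\<in>J. f l) + (\<Sum>l\<in>I. f l)"
      unfolding J_def by (rule sum.subset_diff) (use I in auto)
    also have "(\<Sum>l\<in>J. f l) = (\<Sum>i<q. f (r i))"
      unfolding r(1)[symmetric] by (simp add: sum.reindex[OF r(2)])
    finally show ?thesis .
  qed
  \<comment> \<open>The \<open>g l x\<close> with \<open>l \<in> I\<close> form a basis of \<open>range (Q x)\<close>, hence the coordinates with index in \<open>J\<close>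
    are free on the kernel and determine the others.\<close>
  define free where "free x a = (\<Sum>j<q. scaleK (a j) (g (r j) x))" for x a
  define ext where "ext x a l = (if l \<in> J then a (?r' l) else if l \<in> I then - \<beta> l x (free x a) else 0)" for x a l
  have ext0: "ext x a l = 0" if "l \<ge> N" for x a l using that I by (auto simp: ext_def J_def)
  have extr: "ext x a (r i) = a i" if "i < q" for x a i using that rJ r'' by (simp add: ext_def)
  have extI: "ext x a l = - \<beta> l x (free x a)" if "l \<in> I" for x a l using that by (simp add: ext_def J_def)
  define c' where "c' e i = (if i < q then c e (r i) else 0)" for e i
  define \<psi>' where "\<psi>' p = \<psi> (fst p, ext (fst p) (snd p))" for p
  let ?K = "kernel_bundle \<zeta> h"
  interpret ch': bundle_chart X \<zeta> U' N c \<psi> by (rule restrict[OF U'U])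
  have free_eq: "free x a = (\<Sum>l\<in>I. scaleK (\<beta> l x (free x a)) (g l x))" if x: "x \<in> U'" for x a
  proof -
    have "free x a = (\<Sum>l\<in>J. scaleK (a (?r' l)) (g l x))"
      unfolding r(1)[symmetric] free_def by (simp add: sum.reindex[OF r(2)] r'')
    then have "Q x (free x a) = free x a" using Qsum[OF x, of J] by (simp add: J_def)
    then show ?thesis using Q\<beta>[OF x] by metis
  qed
  have chK: "bundle_chart X ?K U' q c' \<psi>'"
  proof
    show "U' \<subseteq> topspace X" by (rule U't)
    show "continuous_map (vtotal ?K) X (vproj ?K)"
      using continuous_vproj by (simp add: continuous_map_from_subtopology)
    let ?Z = "subtopology (vtotal ?K) {e. vproj ?K e \<in> U'}"
    have "?Z = subtopology (subtopology (vtotal \<zeta>) {e. vproj \<zeta> e \<in> U'}) {e. h e = 0}"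
      by (simp add: subtopology_subtopology Int_commute)
    then show "continuous_map ?Z euclidean (\<lambda>e. c' e i)" for i
      using ch'.continuous_coord by (simp add: c'_def continuous_map_from_subtopology)
    show "c' e i = 0" if "i \<ge> q" for e i using that by (simp add: c'_def)
    let ?T = "prod_topology (subtopology X U') (coord_space q) :: ('x \<times> (nat \<Rightarrow> 'k)) topology"
    have sndc: "continuous_map ?T euclidean (\<lambda>p. snd p i)" for i
      using continuous_map_compose[OF continuous_map_snd continuous_map_coord, of "subtopology X U'" q i]
      by (simp add: o_def)
    have fstc: "continuous_map ?T (subtopology X U') fst" by (rule continuous_map_fst)
    then have fstc': "continuous_map ?T (subtopology X U) fst"
      using U'U by (auto simp: continuous_map_in_subtopology)
    have freec: "continuous_map ?T euclidean (\<lambda>p. free (fst p) (snd p))"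
      unfolding free_def
    proof (intro continuous_map_sum continuous_map_scale sndc)
      fix j assume "j \<in> {..<q}"
      then have "r j < N" using rJ by (auto simp: J_def)
      from continuous_map_compose[OF fstc' gc[OF this]]
      show "continuous_map ?T euclidean (\<lambda>p. g (r j) (fst p))" by (simp add: o_def)
    qed simp
    have "continuous_map ?T (prod_topology (subtopology X U') euclidean) (\<lambda>p. (fst p, free (fst p) (snd p)))"
      using fstc freec by (simp add: continuous_map_pairwise o_def)
    from continuous_map_compose[OF this \<beta>c[unfolded subU']]
    have \<beta>fc: "continuous_map ?T euclidean (\<lambda>p. \<beta> l (fst p) (free (fst p) (snd p)))" if "l \<in> I" for l
      using that by (simp add: o_def)
    have "continuous_map ?T euclidean (\<lambda>p. ext (fst p) (snd p) l)" for l
      unfolding ext_def using sndc \<beta>fc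
      by (cases "l \<in> J"; cases "l \<in> I") (auto intro: continuous_map_bounded_linear[OF bounded_linear_minus[OF bounded_linear_ident]])
    then have "continuous_map ?T (prod_topology (subtopology X U') (coord_space N)) (\<lambda>p. (fst p, ext (fst p) (snd p)))"
      using fstc ext0 by (simp add: continuous_map_pairwise o_def continuous_map_coord_space)
    from continuous_map_compose[OF this ch'.continuous_inv]
    have "continuous_map ?T (vtotal \<zeta>) \<psi>'" by (simp add: o_def \<psi>'_def[abs_def])
    moreover have "h (\<psi>' p) = 0" if "p \<in> topspace ?T" for p
    proof -
      have x: "fst p \<in> U'" using that by auto
      then have "h (\<psi>' p) = (\<Sum>l<N. scaleK (ext (fst p) (snd p) l) (g l (fst p)))"
        unfolding \<psi>'_def using U'U ext0 by (intro h\<psi>) auto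
      also have "\<dots> = free (fst p) (snd p) + (\<Sum>l\<in>I. scaleK (- \<beta> l (fst p) (free (fst p) (snd p))) (g l (fst p)))"
        unfolding split by (simp add: extr extI free_def)
      also have "\<dots> = 0" using free_eq[OF x, of "snd p"] by (simp add: scale_minus_left sum_negf)
      finally show ?thesis .
    qed
    ultimately show "continuous_map ?T (vtotal ?K) \<psi>'"
      by (simp add: continuous_map_in_subtopology Pi_iff image_subset_iff)
    show "vproj ?K (\<psi>' (x, a)) = x" if "x \<in> U'" for x a
      using ch'.vproj_inv ext0 that by (simp add: \<psi>'_def)
    show "c' (\<psi>' (x, a)) = a" if "x \<in> U'" "\<And>i. i \<ge> q \<Longrightarrow> a i = 0" for x a
    proof -
      have "c (\<psi>' (x, a)) = ext x a" using ch'.coord_inv ext0 that(1) by (simp add: \<psi>'_def)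
      then show ?thesis using extr that(2) by (auto simp: c'_def fun_eq_iff)
    qed
    show "\<psi>' (vproj ?K e, c' e) = e" if "e \<in> topspace (vtotal ?K)" "vproj ?K e \<in> U'" for e
    proof -
      let ?x = "vproj \<zeta> e"
      have e: "e \<in> topspace (vtotal \<zeta>)" "h e = 0" and x: "?x \<in> U'" using that by auto
      \<comment> \<open>This is \<open>h e = 0\<close> with the part over \<open>I\<close> moved to
        the other side. Uniqueness of frame coefficients then shows that \<open>ext\<close> recovers
        the coordinates of \<open>e\<close> with index in \<open>I\<close>.\<close>
      have "free ?x (c' e) = (\<Sum>l\<in>I. scaleK (- c e l) (g l ?x))"
        using h_coord[OF e(1)] e(2) x U'U unfolding split
        by (auto simp: free_def c'_def sum_negf scale_minus_left eq_neg_iff_add_eq_0)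
      then have "\<beta> l ?x (free ?x (c' e)) = - c e l" if "l \<in> I" for l
        using \<beta>g[OF x that, of "\<lambda>l. - c e l"] by simp
      then have "ext ?x (c' e) l = c e l" for l
        using r' ch'.coord_zero[OF e(1) x, of l] by (auto simp: ext_def c'_def J_def)
      then have "ext ?x (c' e) = c e" by auto
      then show ?thesis using ch'.inv_coord[OF e(1) x] by (simp add: \<psi>'_def)
    qed
    show "c' (vscale ?K k e) = (\<lambda>i. k * c' e i)" if "e \<in> topspace (vtotal ?K)" "vproj ?K e \<in> U'" for e k
      using ch'.coord_scale[of e k] that by (auto simp: c'_def fun_eq_iff)
    show "c' (vadd ?K e e') = (\<lambda>i. c' e i + c' e' i)"
      if "e \<in> topspace (vtotal ?K)" "e' \<in> topspace (vtotal ?K)" "vproj ?K e \<in> U'" "vproj ?K e' = vproj ?K e" for e e'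
      using ch'.coord_add[of e e'] that by (auto simp: c'_def fun_eq_iff)
  qed
  \<comment> \<open>The section uses the frame coefficients of \<open>w\<close> as coordinates over
    \<open>I\<close> and zero over \<open>J\<close>, so \<open>h\<close> reproduces the expansion of
    \<open>Q x w\<close>.\<close>
  define b where "b x w l = (if l \<in> I then \<beta> l x w else 0)" for x w l
  have b0: "b x w l = 0" if "l \<ge> N" for x w l using that I by (auto simp: b_def)
  define s where "s p = \<psi> (fst p, b (fst p) (snd p))" for p
  have s1: "continuous_map (prod_topology (subtopology X U') euclidean) (vtotal \<zeta>) s"
  proof -
    let ?T = "prod_topology (subtopology X U') euclidean :: ('x \<times> 'e) topology"
    have "continuous_map ?T euclidean (\<lambda>p. b (fst p) (snd p) l)" for l
      using \<beta>c[of l, unfolded subU'] by (cases "l \<in> I") (auto simp: b_def)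
    then have "continuous_map ?T (prod_topology (subtopology X U') (coord_space N)) (\<lambda>p. (fst p, b (fst p) (snd p)))"
      using b0 by (simp add: continuous_map_pairwise o_def continuous_map_coord_space continuous_map_fst)
    from continuous_map_compose[OF this ch'.continuous_inv] show ?thesis by (simp add: o_def s_def[abs_def])
  qed
  have s2: "vproj \<zeta> (s (x, w)) = x" if "x \<in> U'" for x w
    using ch'.vproj_inv b0 that by (simp add: s_def)
  have s3: "h (s (x, w)) = Q x w" if x: "x \<in> U'" for x w
  proof -
    have "h (s (x, w)) = (\<Sum>l<N. scaleK (b x w l) (g l x))"
      using h\<psi>[of x "b x w"] x U'U b0 by (auto simp: s_def)
    also have "\<dots> = (\<Sum>l\<in>I. scaleK (\<beta> l x w) (g l x))"
      by (rule sum.mono_neutral_cong_right) (use I in \<open>auto simp: b_def\<close>)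
    finally show ?thesis using Q\<beta>[OF x] by simp
  qed
  have s4: "s (x, v + w) = vadd \<zeta> (s (x, v)) (s (x, w))" if x: "x \<in> U'" for x v w
  proof -
    have "b x (v + w) = (\<lambda>l. b x v l + b x w l)" using \<beta>a[OF x] by (auto simp: b_def)
    then show ?thesis using \<psi>add[of x "b x v" "b x w"] x U'U b0 by (auto simp: s_def)
  qed
  have s5: "s (x, scaleK k w) = vscale \<zeta> k (s (x, w))" if x: "x \<in> U'" for x k w
  proof -
    have "b x (scaleK k w) = (\<lambda>l. k * b x w l)" using \<beta>s[OF x] by (auto simp: b_def)
    then show ?thesis using \<psi>scale[of x "b x w" k] x U'U b0 by (auto simp: s_def)
  qed
  show ?thesis
  proof (intro exI[of _ U'] conjI exI[of _ s])
    show "\<exists>n c \<psi>. bundle_chart X ?K U' n c \<psi>" using chK by blast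
  qed (use oU' yU' s1 s2 s3 s4 s5 in auto)
qed

lemma vector_bundle_kernel:
  fixes scaleK :: "'k::real_or_complex \<Rightarrow> 'e::banach \<Rightarrow> 'e" and Q :: "'x \<Rightarrow> 'e \<Rightarrow>\<^sub>L 'e"
    and \<zeta> :: "('x, 'k, 'b) vbundle" and h :: "'b \<Rightarrow> 'e"
  assumes ns: "normed_space_over scaleK" and \<zeta>: "vector_bundle X \<zeta>"
    and Q: "continuous_map X euclidean Q"
    and Qlin: "\<And>x. x \<in> topspace X \<Longrightarrow> linear_over scaleK (Q x) \<and> Q x o\<^sub>L Q x = Q x"
    and h: "continuous_map (vtotal \<zeta>) euclidean h"
    and hscale: "\<And>e k. e \<in> topspace (vtotal \<zeta>) \<Longrightarrow> h (vscale \<zeta> k e) = scaleK k (h e)"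
    and hadd: "\<And>e e'. \<lbrakk>e \<in> topspace (vtotal \<zeta>); e' \<in> topspace (vtotal \<zeta>); vproj \<zeta> e' = vproj \<zeta> e\<rbrakk> \<Longrightarrow>
       h (vadd \<zeta> e e') = h e + h e'"
    and hQ: "\<And>e. e \<in> topspace (vtotal \<zeta>) \<Longrightarrow> Q (vproj \<zeta> e) (h e) = h e"
    and surj: "\<And>x w. x \<in> topspace X \<Longrightarrow> \<exists>e \<in> topspace (vtotal \<zeta>). vproj \<zeta> e = x \<and> h e = Q x w"
  shows "vector_bundle X (kernel_bundle \<zeta> h)"
proof (rule vector_bundleI)
  interpret normed_space_over scaleK by (rule ns)
  let ?K = "kernel_bundle \<zeta> h"
  show "continuous_map (vtotal ?K) X (vproj ?K)"
    using \<zeta> by (simp add: vector_bundle_def continuous_map_from_subtopology)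
  show "vscale ?K k e \<in> topspace (vtotal ?K) \<and> vproj ?K (vscale ?K k e) = vproj ?K e"
    if "e \<in> topspace (vtotal ?K)" for k e
    using that vscale_closed[OF \<zeta>] by (simp add: hscale)
  show "vadd ?K e e' \<in> topspace (vtotal ?K) \<and> vproj ?K (vadd ?K e e') = vproj ?K e"
    if "e \<in> topspace (vtotal ?K)" "e' \<in> topspace (vtotal ?K)" "vproj ?K e' = vproj ?K e" for e e'
    using that vadd_closed[OF \<zeta>] by (simp add: hadd)
  show "\<exists>U n c \<psi>. openin X U \<and> y \<in> U \<and> bundle_chart X ?K U n c \<psi>" if "y \<in> topspace X" for y
    using local_kernel_splitting[OF ns \<zeta> that Q Qlin h hscale hadd hQ surj] by blast
qed

section \<open>Comparison of the two index bundles\<close>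

text \<open>The support condition is stated through an open set \<open>W\<close> on which the
  function vanishes and which together with \<open>U i\<close> covers the space. This is the form in
  which extension by zero can be pasted from two open pieces.\<close>

lemma finite_partition_of_unity:
  assumes X: "compact_space X" "Hausdorff_space X"
    and nbhd: "\<forall>y \<in> topspace X. openin X (U y) \<and> y \<in> U y"
  shows "\<exists>F \<rho>. finite F \<and> F \<subseteq> topspace X \<and>
    (\<forall>i\<in>F. continuous_map X euclideanreal (\<rho> i) \<and>
       (\<exists>W. openin X W \<and> topspace X \<subseteq> U i \<union> W \<and> (\<forall>x\<in>W. \<rho> i x = 0))) \<and>
    (\<forall>x \<in> topspace X. (\<Sum>i\<in>F. \<rho> i x) = 1)"
proof -
  note U = bspec[OF nbhd]
  have nX: "normal_space X" using X by (simp add: compact_Hausdorff_or_regular_imp_normal_space)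
  have "\<exists>f. continuous_map X euclideanreal f \<and> (\<forall>x \<in> topspace X - U y. f x = 0) \<and> f y = 1"
    if y: "y \<in> topspace X" for y
  proof -
    have "closedin X (topspace X - U y)" using U[OF y] by (simp add: openin_closedin_eq)
    moreover have "closedin X {y}" using y X by (simp add: closedin_Hausdorff_singleton)
    moreover have "disjnt (topspace X - U y) {y}" using U[OF y] by (auto simp: disjnt_def)
    ultimately obtain f :: "'a \<Rightarrow> real" where f: "continuous_map X (top_of_set {0..1}) f"
      "f ` (topspace X - U y) \<subseteq> {0}" "f ` {y} \<subseteq> {1}"
      using Urysohn_lemma[OF nX, of _ _ 0 1] by (metis zero_le_one)
    then show ?thesis by (intro exI[of _ f]) (auto simp: continuous_map_in_subtopology)
  qed
  then obtain f where fc: "\<And>y. y \<in> topspace X \<Longrightarrow> continuous_map X euclideanreal (f y)"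
    and f0: "\<And>y x. y \<in> topspace X \<Longrightarrow> x \<in> topspace X - U y \<Longrightarrow> f y x = 0"
    and f1: "\<And>y. y \<in> topspace X \<Longrightarrow> f y y = 1" by metis
  define O' where "O' y = {x \<in> topspace X. f y x \<in> {1/2<..}}" for y
  have oO: "openin X (O' y)" if "y \<in> topspace X" for y
    unfolding O'_def by (rule openin_continuous_map_preimage[OF fc[OF that]]) auto
  have "compactin X (topspace X)" using X by (simp add: compact_space_def)
  then have "\<exists>\<F>. finite \<F> \<and> \<F> \<subseteq> O' ` topspace X \<and> topspace X \<subseteq> \<Union>\<F>"
    by (rule compactinD) (use oO f1 in \<open>auto simp: O'_def\<close>)
  then obtain F where F: "finite F" "F \<subseteq> topspace X" "topspace X \<subseteq> \<Union>(O' ` F)"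
    by (metis finite_subset_image)
  \<comment> \<open>Cutting at 1/2 enlarges the zero set: \<open>r i\<close> vanishes on the open
    set where \<open>f i\<close> is below 1/2, which contains the complement of \<open>U i\<close>.
    The sets where \<open>f i\<close> exceeds 1/2 still cover, so the sum \<open>R\<close> is
    positive.\<close>
  define r where "r i x = max 0 (f i x - 1/2)" for i x
  have rc: "continuous_map X euclideanreal (r i)" if "i \<in> F" for i
    unfolding r_def using fc F that by (intro continuous_map_real_max continuous_map_diff) auto
  define R where "R x = (\<Sum>i\<in>F. r i x)" for x
  have Rpos: "R x > 0" if x: "x \<in> topspace X" for x
  proof -
    obtain i where "i \<in> F" "x \<in> O' i" using F(3) x by blast
    then show ?thesis unfolding R_def
      by (intro sum_pos2[OF F(1), of i]) (auto simp: r_def O'_def)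
  qed
  have Rc: "continuous_map X euclideanreal R" unfolding R_def by (intro continuous_map_sum F rc)
  have W: "\<exists>W. openin X W \<and> topspace X \<subseteq> U i \<union> W \<and> (\<forall>x\<in>W. r i x / R x = 0)" if i: "i \<in> F" for i
  proof (intro exI conjI)
    have it: "i \<in> topspace X" using F i by auto
    show "openin X {x \<in> topspace X. f i x \<in> {..<1/2}}"
      by (rule openin_continuous_map_preimage[OF fc[OF it]]) auto
    show "topspace X \<subseteq> U i \<union> {x \<in> topspace X. f i x \<in> {..<1/2}}" using f0[OF it] by force
  qed (auto simp: r_def)
  have sum1: "(\<Sum>i\<in>F. r i x / R x) = 1" if "x \<in> topspace X" for x
    using Rpos[OF that] by (simp add: R_def flip: sum_divide_distrib)
  have "continuous_map X euclideanreal (\<lambda>x. r i x / R x)" if "i \<in> F" for i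
    by (rule continuous_map_real_divide[OF rc[OF that] Rc]) (use Rpos in force)
  then show ?thesis
    using F W sum1 by (intro exI[of _ F] exI[of _ "\<lambda>i x. r i x / R x"]) auto
qed

lemma continuous_map_prod_fst:
  "continuous_map X Y f \<Longrightarrow> continuous_map (prod_topology X Z) Y (\<lambda>p. f (fst p))"
  using continuous_map_compose[OF continuous_map_fst, of X Y f Z] by (simp add: o_def)

text \<open>The condition on a lift is affine, namely \<open>L x (s (x, w))\<close> equals
  \<open>Q x w\<close> modulo the subspace \<open>V x\<close>, and is therefore preserved by
  averages with weights of sum 1. Since the lifts take values in one fixed space, the averages are
  ordinary sums.\<close>

lemma glue_local_lifts:
  fixes scaleK :: "'k::real_or_complex \<Rightarrow> 'e::banach \<Rightarrow> 'e" and L Q :: "'x \<Rightarrow> 'e \<Rightarrow>\<^sub>L 'e"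
  assumes X: "compact_space X" "Hausdorff_space X" and ns: "normed_space_over scaleK"
    and V: "\<And>x. x \<in> topspace X \<Longrightarrow> module.subspace scaleK (V x)"
    and loc: "\<And>y. y \<in> topspace X \<Longrightarrow> \<exists>U s. openin X U \<and> y \<in> U \<and>
      continuous_map (prod_topology (subtopology X U) euclidean) euclidean s \<and>
      (\<forall>x\<in>U. \<forall>w. L x (s (x, w)) - Q x w \<in> V x) \<and>
      (\<forall>x\<in>U. \<forall>v w. s (x, v + w) = s (x, v) + s (x, w)) \<and>
      (\<forall>x\<in>U. \<forall>k w. s (x, scaleK k w) = scaleK k (s (x, w)))"
  shows "\<exists>\<sigma>. continuous_map (prod_topology X euclidean) euclidean (\<lambda>p. \<sigma> (fst p) (snd p)) \<and>
      (\<forall>x \<in> topspace X. (\<forall>w. L x (\<sigma> x w) - Q x w \<in> V x) \<and> (\<forall>v w. \<sigma> x (v + w) = \<sigma> x v + \<sigma> x w) \<and>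
        (\<forall>k w. \<sigma> x (scaleK k w) = scaleK k (\<sigma> x w)))"
proof -
  interpret normed_space_over scaleK by (rule ns)
  have "\<forall>y. \<exists>U s. y \<in> topspace X \<longrightarrow> openin X U \<and> y \<in> U \<and>
      continuous_map (prod_topology (subtopology X U) euclidean) euclidean s \<and>
      (\<forall>x\<in>U. \<forall>w. L x (s (x, w)) - Q x w \<in> V x) \<and>
      (\<forall>x\<in>U. \<forall>v w. s (x, v + w) = s (x, v) + s (x, w)) \<and>
      (\<forall>x\<in>U. \<forall>k w. s (x, scaleK k w) = scaleK k (s (x, w)))"
    using loc by simp
  then obtain U s where Us: "\<forall>y. y \<in> topspace X \<longrightarrow> openin X (U y) \<and> y \<in> U y \<and>
      continuous_map (prod_topology (subtopology X (U y)) euclidean) euclidean (s y) \<and>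
      (\<forall>x\<in>U y. \<forall>w. L x (s y (x, w)) - Q x w \<in> V x) \<and>
      (\<forall>x\<in>U y. \<forall>v w. s y (x, v + w) = s y (x, v) + s y (x, w)) \<and>
      (\<forall>x\<in>U y. \<forall>k w. s y (x, scaleK k w) = scaleK k (s y (x, w)))"
    by (simp only: choice_iff) blast
  then have nbhd: "\<forall>y \<in> topspace X. openin X (U y) \<and> y \<in> U y" by blast
  note U = bspec[OF nbhd]
  from finite_partition_of_unity[OF X nbhd] obtain F \<rho> where F: "finite F" "F \<subseteq> topspace X"
    and \<rho>: "\<forall>i\<in>F. continuous_map X euclideanreal (\<rho> i) \<and>
       (\<exists>W. openin X W \<and> topspace X \<subseteq> U i \<union> W \<and> (\<forall>x\<in>W. \<rho> i x = 0))"
    and \<rho>_sum: "\<forall>x \<in> topspace X. (\<Sum>i\<in>F. \<rho> i x) = 1"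
    by (elim exE conjE) (rule that)
  note \<rho>1 = bspec[OF \<rho>_sum]
  define t where "t i x w = (if x \<in> U i then \<rho> i x *\<^sub>R s i (x, w) else 0)" for i x w
  define \<sigma> where "\<sigma> x w = (\<Sum>i\<in>F. t i x w)" for x w
  have tc: "continuous_map (prod_topology X euclidean) euclidean (\<lambda>p. t i (fst p) (snd p))" if i: "i \<in> F" for i
  proof -
    have it: "i \<in> topspace X" using F i by auto
    from bspec[OF \<rho> i] obtain W where W: "openin X W" "topspace X \<subseteq> U i \<union> W" "\<forall>x\<in>W. \<rho> i x = 0"
      by (elim conjE exE) (rule that)
    \<comment> \<open>The two formulas for \<open>t i\<close> agree on the overlap of
      \<open>U i\<close> and \<open>W\<close>, where the weight vanishes.\<close>
    let ?T = "\<lambda>b. (if b then U i else W) \<times> (UNIV :: 'e set)"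
    let ?f = "\<lambda>b p. if b then \<rho> i (fst p) *\<^sub>R s i p else 0"
    show ?thesis
    proof (rule pasting_lemma[of UNIV _ ?T _ ?f])
      show "openin (prod_topology X euclidean) (?T b)" for b
        using W U[OF it] by (auto simp: openin_prod_Times_iff)
      show "continuous_map (subtopology (prod_topology X euclidean) (?T b)) euclidean (?f b)" for b
      proof (cases b)
        case True
        have "continuous_map (prod_topology (subtopology X (U i)) euclidean) euclidean (\<lambda>p. \<rho> i (fst p) *\<^sub>R s i p)"
          using \<rho> i Us it
          by (intro continuous_map_scaleR continuous_map_prod_fst continuous_map_from_subtopology) auto
        then show ?thesis using True by (simp add: subtopology_Times)
      qed simp
      show "?f b x = ?f b' x" if "x \<in> topspace (prod_topology X euclidean) \<inter> ?T b \<inter> ?T b'" for b b' x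
        using that W(3) by (auto split: if_splits)
      show "\<exists>j. j \<in> UNIV \<and> x \<in> ?T j \<and> t i (fst x) (snd x) = ?f j x" if "x \<in> topspace (prod_topology X euclidean)" for x
      proof (cases "fst x \<in> U i")
        case True then show ?thesis by (intro exI[of _ True]) (auto simp: t_def mem_Times_iff)
      next
        case False then show ?thesis using that W(2) by (intro exI[of _ False]) (auto simp: t_def mem_Times_iff)
      qed
    qed
  qed
  have "continuous_map (prod_topology X euclidean) euclidean (\<lambda>p. \<sigma> (fst p) (snd p))"
    unfolding \<sigma>_def by (intro continuous_map_sum F tc)
  moreover have "L x (\<sigma> x w) - Q x w \<in> V x" if x: "x \<in> topspace X" for x w
  proof -
    have "Q x w = (\<Sum>i\<in>F. \<rho> i x *\<^sub>R Q x w)" using \<rho>1[OF x] by (simp flip: scaleR_left.sum)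
    then have "L x (\<sigma> x w) - Q x w = (\<Sum>i\<in>F. L x (t i x w) - \<rho> i x *\<^sub>R Q x w)"
      by (simp add: \<sigma>_def blinfun.sum_right sum_subtractf)
    also have "\<dots> \<in> V x"
    proof (rule subspace_sum[OF V[OF x]])
      fix i assume i: "i \<in> F"
      then have it: "i \<in> topspace X" using F by auto
      show "L x (t i x w) - \<rho> i x *\<^sub>R Q x w \<in> V x"
      proof (cases "x \<in> U i")
        case True
        then have "L x (s i (x, w)) - Q x w \<in> V x" using Us it by blast
        then have "scaleK (of_real (\<rho> i x)) (L x (s i (x, w)) - Q x w) \<in> V x"
          using V[OF x] by (intro subspace_scale)
        then show ?thesis using True by (simp add: t_def scale_of_real blinfun.scaleR_right scaleR_diff_right)
      next
        case False
        then have "\<rho> i x = 0" using \<rho> i x by blast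
        then show ?thesis using False V[OF x] by (simp add: t_def subspace_0)
      qed
    qed
    finally show ?thesis .
  qed
  moreover have "\<sigma> x (v + w) = \<sigma> x v + \<sigma> x w" if x: "x \<in> topspace X" for x v w
  proof -
    have "t i x (v + w) = t i x v + t i x w" if "i \<in> F" for i
    proof -
      have "i \<in> topspace X" using F that by auto
      then show ?thesis using Us by (simp add: t_def scaleR_add_right)
    qed
    then show ?thesis by (simp add: \<sigma>_def sum.distrib)
  qed
  moreover have "\<sigma> x (scaleK k w) = scaleK k (\<sigma> x w)" if x: "x \<in> topspace X" for x k w
  proof -
    have "t i x (scaleK k w) = scaleK k (t i x w)" if "i \<in> F" for i
    proof -
      have "i \<in> topspace X" using F that by auto
      then show ?thesis using Us
        by (simp add: t_def bounded_bilinear.scaleR_right[OF bounded_bilinear_scale])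
    qed
    then show ?thesis by (simp add: \<sigma>_def scale_sum_right)
  qed
  ultimately show ?thesis by blast
qed

section \<open>Linearity and finite dimensional ranges over the scalar field\<close>

lemma (in normed_space_over) image_span_subset:
  assumes "linear_over scaleK T" "b \<in> module.span scaleK B"
  shows "T b \<in> module.span scaleK (blinfun_apply T ` B)"
proof -
  have "module.subspace scaleK {b. T b \<in> module.span scaleK (blinfun_apply T ` B)}"
    using assms(1) by (auto simp: subspace_def blinfun.add_right linear_over_def span_zero span_add span_scale)
  moreover have "B \<subseteq> {b. T b \<in> module.span scaleK (blinfun_apply T ` B)}" by (auto intro: span_base)
  ultimately show ?thesis using span_minimal assms(2) by blast
qed

lemma (in normed_space_over) subspace_range:
  "linear_over scaleK T \<Longrightarrow> module.subspace scaleK (range (blinfun_apply T))"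
  unfolding subspace_def linear_over_def
  by (auto simp: image_iff simp flip: blinfun.add_right) (metis blinfun.zero_right, metis+)

lemma (in normed_space_over) finite_dim_rangeI:
  assumes T: "linear_over scaleK T" and "finite B" "range (blinfun_apply T) \<subseteq> module.span scaleK B"
    "B \<subseteq> range (blinfun_apply T)"
  shows "finite_dim scaleK (range (blinfun_apply T))"
  unfolding finite_dim_def
  using assms span_minimal[OF assms(4) subspace_range[OF T]] by blast

text \<open>A bounded operator is real linear by type. Homogeneity over the scalar field follows
  because \<open>S\<close> is determined by \<open>T\<close> and \<open>P\<close>, which are
  homogeneous, and by \<open>E\<close>, which is invariant under scalars.\<close>

lemma (in normed_space_over) partial_inverse_scale:
  assumes E: "module.subspace scaleK E" and T: "linear_over scaleK T" and P: "linear_over scaleK P"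
    and S: "\<And>w. S w \<in> E" "\<And>w. T (S w) = P w" "\<And>e. e \<in> E \<Longrightarrow> S (T e) = e"
  shows "S (scaleK k w) = scaleK k (S w)"
proof -
  have SP: "S (P w) = S w" for w using S(3)[OF S(1)[of w]] by (simp add: S(2))
  have "scaleK k (S w) = S (T (scaleK k (S w)))" using subspace_scale[OF E S(1)] S(3) by simp
  also have "T (scaleK k (S w)) = P (scaleK k w)" using T P S(2) by (simp add: linear_over_def)
  finally show ?thesis using SP by simp
qed

text \<open>The partial inverses \<open>S\<close> and the projection \<open>pr\<close> enter through
  their characteristic properties, independently of how they are chosen. Finite codimension of
  \<open>E1\<close> is recorded as \<open>pr_fin\<close>, and the Fredholm property together with it
  as \<open>coker_fin\<close>.\<close>

locale classical_index_data = normed_space_over scaleK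
  for scaleK :: "'k::real_or_complex \<Rightarrow> 'e::banach \<Rightarrow> 'e" +
  fixes X :: "'x topology" and L P S :: "'x \<Rightarrow> 'e \<Rightarrow>\<^sub>L 'e" and pr :: "'e \<Rightarrow>\<^sub>L 'e" and E1 :: "'e set"
  assumes E1: "module.subspace scaleK E1"
    and L_cont: "continuous_map X euclidean L" and L_lin: "\<And>x. x \<in> topspace X \<Longrightarrow> linear_over scaleK (L x)"
    and P_cont: "continuous_map X euclidean P"
    and P_proj: "\<And>x. x \<in> topspace X \<Longrightarrow> linear_over scaleK (P x) \<and> P x o\<^sub>L P x = P x"
    and S_cont: "continuous_map X euclidean S"
    and S_E1: "\<And>x w. x \<in> topspace X \<Longrightarrow> S x w \<in> E1"
    and L_S: "\<And>x w. x \<in> topspace X \<Longrightarrow> L x (S x w) = P x w"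
    and S_L: "\<And>x e. x \<in> topspace X \<Longrightarrow> e \<in> E1 \<Longrightarrow> S x (L x e) = e"
    and pr_proj: "linear_over scaleK pr" "pr o\<^sub>L pr = pr"
    and pr_ker: "\<And>u. pr u = 0 \<longleftrightarrow> u \<in> E1"
    and pr_fin: "finite_dim scaleK (range (blinfun_apply pr))"
    and coker_fin: "\<And>x. x \<in> topspace X \<Longrightarrow> finite_dim scaleK (range (blinfun_apply (id_blinfun - P x)))"
begin

definition Q :: "'x \<Rightarrow> 'e \<Rightarrow>\<^sub>L 'e" where "Q x = id_blinfun - P x"

lemma Q_apply: "Q x w = w - P x w" by (simp add: Q_def blinfun.diff_left)

lemma P_P: "x \<in> topspace X \<Longrightarrow> P x (P x w) = P x w"
  using P_proj by (metis blinfun_apply_blinfun_compose)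

lemma Q_cont: "continuous_map X euclidean Q"
  unfolding Q_def by (intro continuous_map_diff P_cont continuous_map_canonical_const)

lemma Q_proj: "x \<in> topspace X \<Longrightarrow> linear_over scaleK (Q x) \<and> Q x o\<^sub>L Q x = Q x"
  using P_proj[of x] P_P[of x]
  by (auto simp: linear_over_def Q_apply scale_right_diff_distrib blinfun.diff_right intro!: blinfun_eqI)

lemma Q_Q: "x \<in> topspace X \<Longrightarrow> Q x (Q x w) = Q x w"
  using Q_proj by (metis blinfun_apply_blinfun_compose)

lemma pr_pr: "pr (pr u) = pr u"
  using pr_proj by (metis blinfun_apply_blinfun_compose)

lemma diff_pr: "u - pr u \<in> E1"
  using pr_ker[of "u - pr u"] by (simp add: blinfun.diff_right pr_pr)

lemma pr_S: "x \<in> topspace X \<Longrightarrow> pr (S x w) = 0"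
  by (simp add: pr_ker S_E1)

lemma S_P: "x \<in> topspace X \<Longrightarrow> S x (P x w) = S x w"
  by (metis L_S S_E1 S_L)

text \<open>\<open>L x\<close> maps \<open>E1\<close> into the range of \<open>P x\<close>. This is
  why \<open>pr u\<close> may replace \<open>u\<close> under \<open>Q x\<close> after
  \<open>L x\<close>.\<close>

lemma Q_L: assumes "x \<in> topspace X" "e \<in> E1" shows "Q x (L x e) = 0"
  using L_S[OF assms(1), of "L x e"] S_L[OF assms] by (simp add: Q_apply)

lemma S_scale: assumes x: "x \<in> topspace X" shows "S x (scaleK k w) = scaleK k (S x w)"
  by (rule partial_inverse_scale[OF E1 L_lin[OF x]])
    (use P_proj[OF x] S_E1[OF x] L_S[OF x] S_L[OF x] in auto)

text \<open>The correction added to \<open>r\<close> lies in \<open>E1\<close>, the kernel of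
  \<open>pr\<close>, and removes exactly the \<open>P x\<close> component of
  \<open>L x r - v\<close>.\<close>

definition lift :: "'x \<Rightarrow> 'e \<Rightarrow> 'e \<Rightarrow> 'e" where "lift x r v = r + S x (v - L x r)"

lemma pr_lift: "x \<in> topspace X \<Longrightarrow> pr (lift x r v) = pr r"
  by (simp add: lift_def blinfun.add_right pr_S)

lemma L_lift: "x \<in> topspace X \<Longrightarrow> L x (lift x r v) = v + Q x (L x r - v)"
  by (simp add: lift_def blinfun.add_right blinfun.diff_right L_S Q_apply)

text \<open>The difference \<open>u - pr u\<close> lies in \<open>E1\<close>, where
  \<open>S x\<close> inverts \<open>L x\<close>. The remaining term \<open>L x u - v\<close> is in
  the kernel of \<open>P x\<close>, hence of \<open>S x\<close>.\<close>

lemma lift_pr: assumes x: "x \<in> topspace X" and "Q x (L x u - v) = L x u - v" shows "lift x (pr u) v = u"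
proof -
  let ?e = "u - pr u"
  have "P x (L x u - v) = 0" using assms(2) by (simp add: Q_apply)
  then have 0: "S x (L x u - v) = 0" using S_P[OF x, of "L x u - v"] by simp
  have "v - L x (pr u) = L x ?e - (L x u - v)" by (simp add: blinfun.diff_right)
  then have "S x (v - L x (pr u)) = S x (L x ?e - (L x u - v))" by (simp only:)
  also have "\<dots> = S x (L x ?e) - S x (L x u - v)" by (rule blinfun.diff_right)
  also have "\<dots> = ?e" by (simp only: 0 S_L[OF x diff_pr] diff_0_right)
  finally show ?thesis by (simp add: lift_def)
qed

lemma lift_add: "lift x (r + r') (v + v') = lift x r v + lift x r' v'"
  by (simp add: lift_def blinfun.add_right blinfun.diff_right algebra_simps)

lemma lift_scale: "x \<in> topspace X \<Longrightarrow> lift x (scaleK k r) (scaleK k v) = scaleK k (lift x r v)"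
  using L_lin[of x]
  by (simp add: lift_def scale_right_distrib linear_over_def flip: S_scale scale_right_diff_distrib)

lemma continuous_map_lift:
  assumes "continuous_map Z X a" "continuous_map Z euclidean r" "continuous_map Z euclidean v"
  shows "continuous_map Z euclidean (\<lambda>z. lift (a z) (r z) (v z))"
  unfolding lift_def
  by (intro continuous_map_add continuous_map_blinfun_apply continuous_map_diff assms
      continuous_map_compose[OF assms(1) S_cont, unfolded o_def]
      continuous_map_compose[OF assms(1) L_cont, unfolded o_def])

section \<open>The bundles im pr and im Q and the quotient bundle\<close>

abbreviation pr_bundle :: "('x, 'k, 'x \<times> 'e) vbundle" where
  "pr_bundle \<equiv> restrict_bundle X scaleK (\<lambda>_. range (blinfun_apply pr))"

abbreviation coker_bundle :: "('x, 'k, 'x \<times> 'e) vbundle" where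
  "coker_bundle \<equiv> restrict_bundle X scaleK (\<lambda>x. range (blinfun_apply (Q x)))"

lemma vector_bundle_pr: "vector_bundle X pr_bundle"
  by (rule vector_bundle_range_projection) (use normed_space_over_axioms pr_proj pr_fin in auto)

lemma vector_bundle_coker: "vector_bundle X coker_bundle"
  by (rule vector_bundle_range_projection)
    (use normed_space_over_axioms Q_cont Q_proj coker_fin[folded Q_def] in auto)

text \<open>Shows that the choice made in \<open>index_bundle\<close> is not vacuous: every
  \<open>u\<close> is \<open>L x (S x u) + Q x u\<close>.\<close>

lemma transversal_coker: "transversal_subbundle X scaleK L (\<lambda>x. range (blinfun_apply (Q x)))"
proof -
  have "\<exists>v w. u = L x v + w \<and> w \<in> range (blinfun_apply (Q x))" if "x \<in> topspace X" for x u
    by (rule exI[of _ "S x u"], rule exI[of _ "Q x u"]) (simp add: L_S[OF that] Q_apply)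
  then show ?thesis
    unfolding transversal_subbundle_def finite_dim_subbundle_def
    using vector_bundle_coker coker_fin[folded Q_def] Q_proj subspace_range by auto
qed

text \<open>\<open>pr\<close> is constant on the cosets of its kernel \<open>E1\<close>, so
  evaluating it at an arbitrary representative gives an inverse \<open>g\<close> of the coset map on
  im pr. Continuity of \<open>g\<close> for the quotient topology reduces to continuity of
  \<open>pr\<close>, since \<open>g\<close> after \<open>coset E1\<close> is
  \<open>pr\<close>.\<close>

lemma isomorphic_pr_quotient: "isomorphic_bundles pr_bundle (\<Theta>_quotient X scaleK E1)"
proof -
  have E1_0: "0 \<in> E1" using E1 by (rule subspace_0)
  have coset_eq: "coset E1 u = coset E1 v \<longleftrightarrow> u - v \<in> E1" for u v
  proof
    assume "coset E1 u = coset E1 v"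
    then have "u + 0 \<in> coset E1 v" unfolding coset_def using E1_0 by blast
    then show "u - v \<in> E1" by (auto simp: coset_def)
  next
    assume uv: "u - v \<in> E1"
    have "u + w = v + ((u - v) + w)" "v + w = u + (w - (u - v))" for w by simp_all
    moreover have "(u - v) + w \<in> E1" "w - (u - v) \<in> E1" if "w \<in> E1" for w
      using subspace_add[OF E1 uv that] subspace_diff[OF E1 that uv] by auto
    ultimately show "coset E1 u = coset E1 v" unfolding coset_def by blast
  qed
  have top: "topspace (quotient_top E1) = range (coset E1)"
  proof
    show "topspace (quotient_top E1) \<subseteq> range (coset E1)"
      using openin_topspace[of "quotient_top E1"] unfolding openin_quotient_top by blast
    have "coset E1 -` range (coset E1) = UNIV" by auto
    then show "range (coset E1) \<subseteq> topspace (quotient_top E1)"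
      by (intro openin_subset) (simp add: openin_quotient_top)
  qed
  define g where "g A = pr (SOME a. a \<in> A)" for A
  have g: "g (coset E1 u) = pr u" for u
  proof -
    have "u + 0 \<in> coset E1 u" unfolding coset_def using E1_0 by blast
    then have "(SOME a. a \<in> coset E1 u) \<in> coset E1 u" by (metis someI)
    then obtain w where "w \<in> E1" "(SOME a. a \<in> coset E1 u) = u + w" by (auto simp: coset_def)
    then show ?thesis using pr_ker[of w] by (simp add: g_def blinfun.add_right)
  qed
  have cpr: "coset E1 (pr u) = coset E1 u" for u
    using subspace_neg[OF E1 diff_pr[of u]] by (simp add: coset_eq)
  have coset_cont: "continuous_map euclidean (quotient_top E1) (coset E1)"
    unfolding continuous_map_alt by (auto simp: openin_quotient_top top)
  have g_cont: "continuous_map (quotient_top E1) euclidean g"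
    unfolding continuous_map_alt
  proof (intro conjI allI impI)
    fix W assume "openin euclidean (W :: 'e set)"
    then have "open (blinfun_apply pr -` W)"
      by (intro open_vimage) (auto intro: continuous_intros)
    moreover have "coset E1 -` (g -` W \<inter> range (coset E1)) = blinfun_apply pr -` W" by (auto simp: g)
    ultimately show "openin (quotient_top E1) (g -` W \<inter> topspace (quotient_top E1))"
      by (simp add: openin_quotient_top top)
  qed auto
  have qadd: "quotient_add (coset E1 u) (coset E1 v) = coset E1 (u + v)" for u v
  proof
    show "quotient_add (coset E1 u) (coset E1 v) \<subseteq> coset E1 (u + v)"
    proof
      fix z assume "z \<in> quotient_add (coset E1 u) (coset E1 v)"
      then obtain a b where "a \<in> E1" "b \<in> E1" "z = (u + a) + (v + b)"
        by (auto simp: quotient_add_def coset_def)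
      then show "z \<in> coset E1 (u + v)" unfolding coset_def
        using subspace_add[OF E1] by (intro image_eqI[of _ _ "a + b"]) auto
    qed
    show "coset E1 (u + v) \<subseteq> quotient_add (coset E1 u) (coset E1 v)"
    proof
      fix z assume "z \<in> coset E1 (u + v)"
      then obtain a where "a \<in> E1" "z = (u + a) + (v + 0)" by (auto simp: coset_def)
      then show "z \<in> quotient_add (coset E1 u) (coset E1 v)"
        unfolding quotient_add_def coset_def using E1_0 by blast
    qed
  qed
  have qscale: "quotient_scale scaleK E1 k (coset E1 u) = coset E1 (scaleK k u)" for k u
  proof
    show "quotient_scale scaleK E1 k (coset E1 u) \<subseteq> coset E1 (scaleK k u)"
    proof
      fix z assume "z \<in> quotient_scale scaleK E1 k (coset E1 u)"
      then obtain a b where "a \<in> E1" "b \<in> E1" "z = scaleK k (u + a) + b"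
        by (auto simp: quotient_scale_def coset_def)
      then show "z \<in> coset E1 (scaleK k u)" unfolding coset_def
        using subspace_add[OF E1 subspace_scale[OF E1]]
        by (intro image_eqI[of _ _ "scaleK k a + b"]) (auto simp: scale_right_distrib)
    qed
    show "coset E1 (scaleK k u) \<subseteq> quotient_scale scaleK E1 k (coset E1 u)"
    proof
      fix z assume "z \<in> coset E1 (scaleK k u)"
      then obtain a where "a \<in> E1" "z = scaleK k (u + 0) + a" by (auto simp: coset_def)
      then show "z \<in> quotient_scale scaleK E1 k (coset E1 u)"
        unfolding quotient_scale_def coset_def using E1_0 by blast
    qed
  qed
  let ?f = "\<lambda>p. (fst p, coset E1 (snd p))" and ?g = "\<lambda>p. (fst p, g (snd p))"
  have tq: "vtotal (\<Theta>_quotient X scaleK E1) = prod_topology X (quotient_top E1)"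
    by (simp add: \<Theta>_quotient_def product_bundle_def)
  show ?thesis
  proof (rule bundle_isoI)
    show "homeomorphic_maps (vtotal pr_bundle) (vtotal (\<Theta>_quotient X scaleK E1)) ?f ?g"
      unfolding homeomorphic_maps_def tq
    proof (intro conjI ballI)
      show "continuous_map (vtotal pr_bundle) (prod_topology X (quotient_top E1)) ?f"
        unfolding continuous_map_pairwise o_def fst_conv snd_conv
        by (intro conjI continuous_map_from_restrict_bundle
            continuous_map_compose[OF continuous_map_from_restrict_bundle(2) coset_cont, unfolded o_def])
      show "continuous_map (prod_topology X (quotient_top E1)) (vtotal pr_bundle) ?g"
        unfolding continuous_map_into_restrict_bundle
        using continuous_map_compose[OF continuous_map_snd g_cont, of X]
        by (auto simp: continuous_map_fst o_def g_def)
      show "?g (?f p) = p" if "p \<in> topspace (vtotal pr_bundle)" for p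
        using that by (auto simp: topspace_restrict_bundle g pr_pr)
      show "?f (?g p) = p" if "p \<in> topspace (prod_topology X (quotient_top E1))" for p
        using that by (auto simp: top g cpr)
    qed
  qed (auto simp: restrict_bundle_simps(2-4) \<Theta>_quotient_def product_bundle_def qadd qscale)
qed

end

section \<open>Comparison with an arbitrary transversal subbundle\<close>

locale transversal_data = classical_index_data scaleK X L P S pr E1
  for scaleK :: "'k::real_or_complex \<Rightarrow> 'e::banach \<Rightarrow> 'e" and X :: "'x topology"
    and L P S :: "'x \<Rightarrow> 'e \<Rightarrow>\<^sub>L 'e" and pr :: "'e \<Rightarrow>\<^sub>L 'e" and E1 :: "'e set" +
  fixes V :: "'x \<Rightarrow> 'e set"
  assumes compact: "compact_space X" and Hausdorff: "Hausdorff_space X"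
    and transversal: "transversal_subbundle X scaleK L V"
begin

abbreviation V_bundle :: "('x, 'k, 'x \<times> 'e) vbundle" where
  "V_bundle \<equiv> restrict_bundle X scaleK V"

abbreviation ker_bundle :: "('x, 'k, 'x \<times> 'e) vbundle" where
  "ker_bundle \<equiv> restrict_bundle X scaleK (preimage_family L V)"

lemma V_subspace: "x \<in> topspace X \<Longrightarrow> module.subspace scaleK (V x)"
  using transversal by (simp add: transversal_subbundle_def finite_dim_subbundle_def)

lemma vector_bundle_V: "vector_bundle X V_bundle"
  using transversal by (simp add: transversal_subbundle_def finite_dim_subbundle_def)

text \<open>The kernel of the defect in fibre \<open>x\<close> is the set of \<open>(r, v)\<close> for which \<open>u = lift x r v\<close> satisfies
  \<open>L x u = v\<close>.\<close>

definition defect :: "('x \<times> 'e) \<times> ('x \<times> 'e) \<Rightarrow> 'e" where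
  "defect p = Q (fst (fst p)) (L (fst (fst p)) (snd (fst p)) - snd (snd p))"

abbreviation sum_bundle where "sum_bundle \<equiv> direct_sum pr_bundle V_bundle"

lemma topspace_sum_bundle:
  "topspace (vtotal sum_bundle) =
     {((x, r), (y, v)). x = y \<and> x \<in> topspace X \<and> r \<in> range (blinfun_apply pr) \<and> v \<in> V x}"
  by (auto simp: topspace_direct_sum topspace_restrict_bundle restrict_bundle_simps(2))

lemma vector_bundle_sum: "vector_bundle X sum_bundle"
  by (intro vector_bundle_direct_sum vector_bundle_pr vector_bundle_V)

lemma continuous_map_sum_bundle:
  "continuous_map (vtotal sum_bundle) X (\<lambda>p. fst (fst p))"
  "continuous_map (vtotal sum_bundle) euclidean (\<lambda>p. snd (fst p))"
  "continuous_map (vtotal sum_bundle) euclidean (\<lambda>p. snd (snd p))"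
  using continuous_map_compose[OF continuous_map_from_direct_sum(1) continuous_map_from_restrict_bundle(1)]
    continuous_map_compose[OF continuous_map_from_direct_sum(1) continuous_map_from_restrict_bundle(2)]
    continuous_map_compose[OF continuous_map_from_direct_sum(2) continuous_map_from_restrict_bundle(2)]
  by (simp_all add: o_def)

text \<open>These are the hypotheses on \<open>h\<close> in \<open>local_kernel_splitting\<close>;
  the last one is where transversality enters.\<close>

lemma defect_properties:
  shows "continuous_map (vtotal sum_bundle) euclidean defect"
    and "e \<in> topspace (vtotal sum_bundle) \<Longrightarrow> defect (vscale sum_bundle k e) = scaleK k (defect e)"
    and "e \<in> topspace (vtotal sum_bundle) \<Longrightarrow> e' \<in> topspace (vtotal sum_bundle) \<Longrightarrow>
      vproj sum_bundle e' = vproj sum_bundle e \<Longrightarrow> defect (vadd sum_bundle e e') = defect e + defect e'"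
    and "e \<in> topspace (vtotal sum_bundle) \<Longrightarrow> Q (vproj sum_bundle e) (defect e) = defect e"
    and "x \<in> topspace X \<Longrightarrow> \<exists>e \<in> topspace (vtotal sum_bundle). vproj sum_bundle e = x \<and> defect e = Q x w"
proof -
  show "continuous_map (vtotal sum_bundle) euclidean defect"
    unfolding defect_def
    by (intro continuous_map_blinfun_apply continuous_map_diff continuous_map_sum_bundle
        continuous_map_compose[OF continuous_map_sum_bundle(1) Q_cont, unfolded o_def]
        continuous_map_compose[OF continuous_map_sum_bundle(1) L_cont, unfolded o_def])
  show "defect (vscale sum_bundle k e) = scaleK k (defect e)" if "e \<in> topspace (vtotal sum_bundle)"
    using that Q_proj L_lin
    by (auto simp: topspace_sum_bundle defect_def restrict_bundle_simps(2-4) linear_over_def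
        simp flip: scale_right_diff_distrib)
  show "defect (vadd sum_bundle e e') = defect e + defect e'"
    if "e \<in> topspace (vtotal sum_bundle)" "e' \<in> topspace (vtotal sum_bundle)" "vproj sum_bundle e' = vproj sum_bundle e"
    using that
    by (auto simp: topspace_sum_bundle defect_def restrict_bundle_simps(2-4) blinfun.add_right blinfun.diff_right)
  show "Q (vproj sum_bundle e) (defect e) = defect e" if "e \<in> topspace (vtotal sum_bundle)"
    using that Q_Q by (auto simp: topspace_sum_bundle defect_def restrict_bundle_simps(2))
  show "\<exists>e \<in> topspace (vtotal sum_bundle). vproj sum_bundle e = x \<and> defect e = Q x w" if x: "x \<in> topspace X"
  proof -
    have "w \<in> {L x u + v | u v. v \<in> V x}"
      using transversal x by (simp add: transversal_subbundle_def)
    then obtain u v where uv: "w = L x u + v" "v \<in> V x" by auto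
    \<comment> \<open>The second component of the witness is \<open>- v\<close> because the defect
      subtracts it. Passing from \<open>u\<close> to \<open>pr u\<close> changes the argument by an
      element of the image of \<open>E1\<close>, which \<open>Q x\<close> annihilates.\<close>
    have "L x (pr u) - (- v) = w - L x (u - pr u)" by (simp add: uv blinfun.diff_right)
    then have "Q x (L x (pr u) - (- v)) = Q x w - Q x (L x (u - pr u))" by (simp only: blinfun.diff_right)
    then have "Q x (L x (pr u) - (- v)) = Q x w" using Q_L[OF x diff_pr] by simp
    moreover have "- v \<in> V x" using V_subspace[OF x] uv(2) by (rule subspace_neg)
    ultimately show ?thesis using x
      by (intro bexI[of _ "((x, pr u), (x, - v))"]) (auto simp: topspace_sum_bundle defect_def restrict_bundle_simps(2))
  qed
qed

text \<open>A vector \<open>u\<close> of the fibre of E(L, V) corresponds to the pair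
  \<open>(pr u, L x u)\<close>, and \<open>lift\<close> recovers it. Through this identification
  E(L, V) inherits its local triviality from the kernel of a surjective bundle map.\<close>

lemma isomorphic_kernel: "isomorphic_bundles (kernel_bundle sum_bundle defect) ker_bundle"
proof (rule bundle_isoI)
  let ?K = "kernel_bundle sum_bundle defect"
  let ?f = "\<lambda>p. (fst (fst p), lift (fst (fst p)) (snd (fst p)) (snd (snd p)))"
  let ?g = "\<lambda>q. ((fst q, pr (snd q)), (fst q, L (fst q) (snd q)))"
  have tK: "topspace (vtotal ?K) = {((x, r), (y, v)). x = y \<and> x \<in> topspace X \<and> r \<in> range (blinfun_apply pr) \<and>
      v \<in> V x \<and> Q x (L x r - v) = 0}"
    by (auto simp: topspace_sum_bundle defect_def)
  show "homeomorphic_maps (vtotal ?K) (vtotal ker_bundle) ?f ?g"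
    unfolding homeomorphic_maps_def
  proof (intro conjI ballI)
    show "continuous_map (vtotal ?K) (vtotal ker_bundle) ?f"
      unfolding continuous_map_into_restrict_bundle
      using continuous_map_sum_bundle continuous_map_lift[OF continuous_map_sum_bundle]
      by (auto simp: tK[simplified] continuous_map_from_subtopology preimage_family_def L_lift)
    have "continuous_map (vtotal ker_bundle) euclidean (\<lambda>q. L (fst q) (snd q))"
      by (intro continuous_map_blinfun_apply continuous_map_from_restrict_bundle
          continuous_map_compose[OF continuous_map_from_restrict_bundle(1) L_cont, unfolded o_def])
    moreover have "continuous_map (vtotal ker_bundle) euclidean (\<lambda>q. pr (snd q))"
      by (intro continuous_map_blinfun_apply continuous_map_from_restrict_bundle continuous_map_canonical_const)
    moreover have "Q x (L x (pr u) - L x u) = 0" if "x \<in> topspace X" for x u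
      using Q_L[OF that diff_pr, of u] by (simp add: blinfun.diff_right)
    ultimately show "continuous_map (vtotal ker_bundle) (vtotal ?K) ?g"
      by (auto simp: continuous_map_in_subtopology continuous_map_into_direct_sum continuous_map_into_restrict_bundle
          continuous_map_from_restrict_bundle topspace_restrict_bundle restrict_bundle_simps(2) preimage_family_def defect_def)
    show "?g (?f p) = p" if "p \<in> topspace (vtotal ?K)" for p
      using that unfolding tK by (auto simp: pr_lift L_lift pr_pr)
    show "?f (?g q) = q" if "q \<in> topspace (vtotal ker_bundle)" for q
      using that by (auto simp: topspace_restrict_bundle intro!: lift_pr)
  qed
qed (auto simp: topspace_sum_bundle restrict_bundle_simps(2-4) lift_add lift_scale)

lemma vector_bundle_ker: "vector_bundle X ker_bundle"
proof (rule vector_bundle_isomorphic[OF _ isomorphic_kernel])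
  show "vector_bundle X (kernel_bundle sum_bundle defect)"
    by (rule vector_bundle_kernel[OF normed_space_over_axioms vector_bundle_sum Q_cont])
      (use Q_proj defect_properties in auto)
qed

text \<open>A local section of the defect gives \<open>(r, v)\<close> with
  \<open>Q x (L x r - v) = Q x w\<close>. Then \<open>u = lift x r v\<close> satisfies
  \<open>L x u - Q x w = v\<close>, so the section becomes a lift with values in the ambient space,
  to which \<open>glue_local_lifts\<close> applies.\<close>

lemma ex_global_lift:
  "\<exists>\<sigma>. continuous_map (prod_topology X euclidean) euclidean (\<lambda>p. \<sigma> (fst p) (snd p)) \<and>
      (\<forall>x \<in> topspace X. (\<forall>w. L x (\<sigma> x w) - Q x w \<in> V x) \<and> (\<forall>v w. \<sigma> x (v + w) = \<sigma> x v + \<sigma> x w) \<and>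
        (\<forall>k w. \<sigma> x (scaleK k w) = scaleK k (\<sigma> x w)))"
proof (rule glue_local_lifts[OF compact Hausdorff normed_space_over_axioms V_subspace])
  fix y assume y: "y \<in> topspace X"
  have "\<exists>U. openin X U \<and> y \<in> U \<and> (\<exists>n c \<psi>. bundle_chart X (kernel_bundle sum_bundle defect) U n c \<psi>) \<and>
    (\<exists>s. continuous_map (prod_topology (subtopology X U) euclidean) (vtotal sum_bundle) s \<and>
      (\<forall>x\<in>U. \<forall>w. vproj sum_bundle (s (x, w)) = x \<and> defect (s (x, w)) = Q x w) \<and>
      (\<forall>x\<in>U. \<forall>v w. s (x, v + w) = vadd sum_bundle (s (x, v)) (s (x, w))) \<and>
      (\<forall>x\<in>U. \<forall>k w. s (x, scaleK k w) = vscale sum_bundle k (s (x, w))))"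
    by (rule local_kernel_splitting[OF normed_space_over_axioms vector_bundle_sum y Q_cont])
      (use Q_proj defect_properties in auto)
  then obtain U s where U: "openin X U" "y \<in> U"
    and sc: "continuous_map (prod_topology (subtopology X U) euclidean) (vtotal sum_bundle) s"
    and s: "\<forall>x\<in>U. \<forall>w. vproj sum_bundle (s (x, w)) = x \<and> defect (s (x, w)) = Q x w"
    and sa: "\<forall>x\<in>U. \<forall>v w. s (x, v + w) = vadd sum_bundle (s (x, v)) (s (x, w))"
    and ss: "\<forall>x\<in>U. \<forall>k w. s (x, scaleK k w) = vscale sum_bundle k (s (x, w))" by blast
  have Ut: "x \<in> topspace X" if "x \<in> U" for x using that U openin_subset by blast
  define r where "r p = snd (fst (s p))" for p
  define v where "v p = snd (snd (s p))" for p
  have st: "s (x, w) \<in> topspace (vtotal sum_bundle)" if "x \<in> U" for x w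
    using sc that Ut by (force simp: continuous_map_def)
  have s_eq: "s (x, w) = ((x, r (x, w)), (x, v (x, w)))" and vV: "v (x, w) \<in> V x"
    and dQ: "Q x (L x (r (x, w)) - v (x, w)) = Q x w" if x: "x \<in> U" for x w
  proof -
    have "fst (fst (s (x, w))) = x" using s x by (simp add: vproj_direct_sum restrict_bundle_simps(2))
    then show 1: "s (x, w) = ((x, r (x, w)), (x, v (x, w)))" and "v (x, w) \<in> V x"
      using st[OF x, of w] unfolding topspace_sum_bundle by (auto simp: r_def v_def)
    have "defect (s (x, w)) = Q x w" using s x by blast
    then show "Q x (L x (r (x, w)) - v (x, w)) = Q x w" unfolding 1 defect_def by simp
  qed
  have ra: "r (x, u + w) = r (x, u) + r (x, w)" "v (x, u + w) = v (x, u) + v (x, w)" if x: "x \<in> U" for x u w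
    using sa x s_eq[OF x] by (auto simp: restrict_bundle_simps(2-4))
  have rs: "r (x, scaleK k w) = scaleK k (r (x, w))" "v (x, scaleK k w) = scaleK k (v (x, w))" if x: "x \<in> U" for x k w
    using ss x s_eq[OF x] by (auto simp: restrict_bundle_simps(2-4))
  show "\<exists>U s. openin X U \<and> y \<in> U \<and>
      continuous_map (prod_topology (subtopology X U) euclidean) euclidean s \<and>
      (\<forall>x\<in>U. \<forall>w. L x (s (x, w)) - Q x w \<in> V x) \<and>
      (\<forall>x\<in>U. \<forall>v w. s (x, v + w) = s (x, v) + s (x, w)) \<and>
      (\<forall>x\<in>U. \<forall>k w. s (x, scaleK k w) = scaleK k (s (x, w)))"
  proof (intro exI[of _ U] exI[of _ "\<lambda>p. lift (fst p) (r p) (v p)"] conjI ballI allI)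
    show "continuous_map (prod_topology (subtopology X U) euclidean) euclidean (\<lambda>p. lift (fst p) (r p) (v p))"
    proof (rule continuous_map_lift)
      show "continuous_map (prod_topology (subtopology X U) (euclidean :: 'e topology)) X fst"
        using continuous_map_fst[of "subtopology X U" "euclidean :: 'e topology"] by (simp add: continuous_map_in_subtopology)
      show "continuous_map (prod_topology (subtopology X U) euclidean) euclidean r"
        unfolding r_def using continuous_map_compose[OF sc continuous_map_sum_bundle(2)] by (simp add: o_def)
      show "continuous_map (prod_topology (subtopology X U) euclidean) euclidean v"
        unfolding v_def using continuous_map_compose[OF sc continuous_map_sum_bundle(3)] by (simp add: o_def)
    qed
  qed (use U Ut in \<open>auto simp: L_lift dQ vV ra rs lift_add lift_scale\<close>)
qed

text \<open>Both sides are the bundle of all \<open>(u, v, w)\<close> with \<open>L x u = v + w\<close>, \<open>v \<in> V x\<close> and \<open>w \<in> range (Q x)\<close>: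
  on the left split by means of \<open>\<sigma>\<close>, on the right parametrised by \<open>(pr u, v)\<close>.\<close>

lemma isomorphic_ker_coker: "isomorphic_bundles (direct_sum ker_bundle coker_bundle) sum_bundle"
proof -
  from ex_global_lift obtain \<sigma> where
    \<sigma>c: "continuous_map (prod_topology X euclidean) euclidean (\<lambda>p. \<sigma> (fst p) (snd p))"
    and \<sigma>V: "\<And>x w. x \<in> topspace X \<Longrightarrow> L x (\<sigma> x w) - Q x w \<in> V x"
    and \<sigma>add: "\<And>x v w. x \<in> topspace X \<Longrightarrow> \<sigma> x (v + w) = \<sigma> x v + \<sigma> x w"
    and \<sigma>scale: "\<And>x k w. x \<in> topspace X \<Longrightarrow> \<sigma> x (scaleK k w) = scaleK k (\<sigma> x w)"
    by blast
  let ?D = "direct_sum ker_bundle coker_bundle"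
  define w_of where "w_of x r v = L x (lift x r v) - v" for x r v
  \<comment> \<open>The pair \<open>(u, w)\<close> stands for the triple with first entry
    \<open>u + \<sigma> x w\<close>, second entry its image under \<open>L x\<close> minus
    \<open>w\<close>, and third entry \<open>w\<close>. Conversely \<open>g\<close> recovers the
    third entry as \<open>w_of\<close> and subtracts its lift under \<sigma>.\<close>
  define f where "f p = ((fst (fst p), pr (snd (fst p) + \<sigma> (fst (fst p)) (snd (snd p)))),
    (fst (fst p), L (fst (fst p)) (snd (fst p) + \<sigma> (fst (fst p)) (snd (snd p))) - snd (snd p)))" for p :: "('x \<times> 'e) \<times> ('x \<times> 'e)"
  define g where "g p = ((fst (fst p), lift (fst (fst p)) (snd (fst p)) (snd (snd p))
      - \<sigma> (fst (fst p)) (w_of (fst (fst p)) (snd (fst p)) (snd (snd p)))),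
    (fst (fst p), w_of (fst (fst p)) (snd (fst p)) (snd (snd p))))" for p :: "('x \<times> 'e) \<times> ('x \<times> 'e)"
  have tD: "topspace (vtotal ?D) = {((x, u), (y, w)). x = y \<and> x \<in> topspace X \<and> L x u \<in> V x \<and>
      w \<in> range (blinfun_apply (Q x))}"
    by (auto simp: topspace_direct_sum topspace_restrict_bundle restrict_bundle_simps(2) preimage_family_def)
  have Dc: "continuous_map (vtotal ?D) X (\<lambda>p. fst (fst p))"
    "continuous_map (vtotal ?D) euclidean (\<lambda>p. snd (fst p))"
    "continuous_map (vtotal ?D) euclidean (\<lambda>p. snd (snd p))"
    using continuous_map_compose[OF continuous_map_from_direct_sum(1) continuous_map_from_restrict_bundle(1)]
      continuous_map_compose[OF continuous_map_from_direct_sum(1) continuous_map_from_restrict_bundle(2)]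
      continuous_map_compose[OF continuous_map_from_direct_sum(2) continuous_map_from_restrict_bundle(2)]
    by (simp_all add: o_def)
  have \<sigma>comp: "continuous_map Z euclidean (\<lambda>z. \<sigma> (a z) (b z))"
    if "continuous_map Z X a" "continuous_map Z euclidean b" for Z :: "(('x \<times> 'e) \<times> ('x \<times> 'e)) topology" and a b
  proof -
    have "continuous_map Z (prod_topology X euclidean) (\<lambda>z. (a z, b z))"
      using that by (simp add: continuous_map_pairwise o_def)
    from continuous_map_compose[OF this \<sigma>c] show ?thesis by (simp add: o_def)
  qed
  have Lcomp: "continuous_map Z euclidean (\<lambda>z. L (a z) (b z))"
    if "continuous_map Z X a" "continuous_map Z euclidean b" for Z :: "(('x \<times> 'e) \<times> ('x \<times> 'e)) topology" and a b
    by (intro continuous_map_blinfun_apply that continuous_map_compose[OF that(1) L_cont, unfolded o_def])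
  have w_of_Q: "w_of x r v = Q x (L x r - v)" if "x \<in> topspace X" for x r v
    using L_lift[OF that] by (simp add: w_of_def)
  have fV: "L x (u + \<sigma> x w) - w \<in> V x"
    if x: "x \<in> topspace X" and u: "L x u \<in> V x" and w: "w \<in> range (blinfun_apply (Q x))" for x u w
  proof -
    have "Q x w = w" using w Q_Q[OF x] by auto
    then have "L x (u + \<sigma> x w) - w = L x u + (L x (\<sigma> x w) - Q x w)" by (simp add: blinfun.add_right)
    then show ?thesis using subspace_add[OF V_subspace[OF x] u \<sigma>V[OF x]] by simp
  qed
  have gV: "L x (lift x r v - \<sigma> x (w_of x r v)) \<in> V x" if x: "x \<in> topspace X" and v: "v \<in> V x" for x r v
  proof -
    have "Q x (w_of x r v) = w_of x r v" using Q_Q[OF x] by (simp add: w_of_Q[OF x])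
    then have "L x (lift x r v - \<sigma> x (w_of x r v)) = v - (L x (\<sigma> x (w_of x r v)) - Q x (w_of x r v))"
      by (simp add: blinfun.diff_right) (simp add: w_of_def)
    then show ?thesis using subspace_diff[OF V_subspace[OF x] v \<sigma>V[OF x]] by simp
  qed
  show ?thesis
  proof (rule bundle_isoI)
    show "homeomorphic_maps (vtotal ?D) (vtotal sum_bundle) f g"
      unfolding homeomorphic_maps_def
    proof (intro conjI ballI)
      have "continuous_map (vtotal ?D) euclidean (\<lambda>p. snd (fst p) + \<sigma> (fst (fst p)) (snd (snd p)))"
        by (intro continuous_map_add Dc \<sigma>comp)
      note 1 = continuous_map_diff[OF Lcomp[OF Dc(1) this] Dc(3)]
        continuous_map_blinfun_apply[OF continuous_map_canonical_const[of _ pr] this]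
      show "continuous_map (vtotal ?D) (vtotal sum_bundle) f"
        unfolding continuous_map_into_direct_sum continuous_map_into_restrict_bundle f_def
        using 1 Dc fV by (auto simp: tD restrict_bundle_simps(2))
      have wc: "continuous_map (vtotal sum_bundle) euclidean (\<lambda>p. w_of (fst (fst p)) (snd (fst p)) (snd (snd p)))"
        unfolding w_of_def
        by (intro continuous_map_diff Lcomp continuous_map_lift continuous_map_sum_bundle)
      have "continuous_map (vtotal sum_bundle) euclidean (\<lambda>p. lift (fst (fst p)) (snd (fst p)) (snd (snd p))
          - \<sigma> (fst (fst p)) (w_of (fst (fst p)) (snd (fst p)) (snd (snd p))))"
        by (intro continuous_map_diff \<sigma>comp continuous_map_lift continuous_map_sum_bundle wc)
      then show "continuous_map (vtotal sum_bundle) (vtotal ?D) g"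
        unfolding continuous_map_into_direct_sum continuous_map_into_restrict_bundle g_def
        using wc continuous_map_sum_bundle gV
        by (auto simp: topspace_sum_bundle restrict_bundle_simps(2) preimage_family_def w_of_Q)
      show "g (f p) = p" if p: "p \<in> topspace (vtotal ?D)" for p
      proof -
        obtain x u w where p_eq: "p = ((x, u), (x, w))" and x: "x \<in> topspace X" and w: "w \<in> range (blinfun_apply (Q x))"
          using p unfolding tD by auto
        have "Q x w = w" using w Q_Q[OF x] by auto
        then have "lift x (pr (u + \<sigma> x w)) (L x (u + \<sigma> x w) - w) = u + \<sigma> x w"
          by (intro lift_pr x) simp
        then show ?thesis by (simp add: p_eq f_def g_def w_of_def)
      qed
      show "f (g p) = p" if p: "p \<in> topspace (vtotal sum_bundle)" for p
        using p by (auto simp: topspace_sum_bundle f_def g_def pr_lift pr_pr w_of_def)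
    qed
  qed (auto simp: tD f_def restrict_bundle_simps(2-4) \<sigma>add \<sigma>scale blinfun.add_right algebra_simps
      L_lin[unfolded linear_over_def] pr_proj(1)[unfolded linear_over_def]
      scale_right_distrib scale_right_diff_distrib)
qed

lemma K_diff_eq_quotient:
  "vector_bundle X (\<Theta>_quotient X scaleK E1)"
  "K_diff X ker_bundle V_bundle = K_diff X (\<Theta>_quotient X scaleK E1) coker_bundle"
proof -
  show q: "vector_bundle X (\<Theta>_quotient X scaleK E1)"
    by (rule vector_bundle_isomorphic[OF vector_bundle_pr isomorphic_pr_quotient])
  show "K_diff X ker_bundle V_bundle = K_diff X (\<Theta>_quotient X scaleK E1) coker_bundle"
  proof (rule K_diff_eqI[OF vector_bundle_ker vector_bundle_V q vector_bundle_coker])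
    show "isomorphic_bundles (direct_sum ker_bundle coker_bundle) (direct_sum (\<Theta>_quotient X scaleK E1) V_bundle)"
      by (rule isomorphic_bundles_trans[OF isomorphic_ker_coker
            isomorphic_direct_sum[OF isomorphic_pr_quotient isomorphic_bundles_refl]])
  qed
qed

end

text \<open>Over an empty base there is no point at which to form \<open>pr\<close>; there every
  bundle in question has empty total space, and this lemma and the next settle the case.\<close>

lemma vector_bundle_empty_base:
  assumes "topspace X = {}" "topspace (vtotal \<xi>) = {}"
  shows "vector_bundle X \<xi>"
  by (rule vector_bundleI) (use assms in \<open>auto simp: continuous_map_def\<close>)

lemma isomorphic_bundles_empty_base:
  assumes "topspace (vtotal \<xi>) = {}" "topspace (vtotal \<eta>) = {}"
  shows "isomorphic_bundles \<xi> \<eta>"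
proof (rule bundle_isoI)
  show "homeomorphic_maps (vtotal \<xi>) (vtotal \<eta>) (\<lambda>_. undefined) (\<lambda>_. undefined)"
    using assms by (simp add: homeomorphic_maps_def)
qed (use assms in auto)

theorem mainTheorem6:
  fixes X :: "'x topology"
    and scaleK :: "'k::real_or_complex \<Rightarrow> 'e::banach \<Rightarrow> 'e"
    and L P :: "'x \<Rightarrow> 'e \<Rightarrow>\<^sub>L 'e"
    and E1 :: "'e set"
  assumes "compact_space X" and "Hausdorff_space X"
    and "normed_space_over scaleK"
    and "continuous_map X euclidean L"
    and "\<And>x. x \<in> topspace X \<Longrightarrow> fredholm scaleK (L x)"
    and "closed E1" and "finite_codim scaleK E1"
    and "\<And>x. x \<in> topspace X \<Longrightarrow> {u. blinfun_apply (L x) u = 0} \<inter> E1 = {0}"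
    and "continuous_map X euclidean P"
    and "\<And>x. x \<in> topspace X \<Longrightarrow> linear_over scaleK (P x) \<and> P x o\<^sub>L P x = P x"
    and "\<And>x. x \<in> topspace X \<Longrightarrow> range (blinfun_apply (P x)) = blinfun_apply (L x) ` E1"
  shows "index_bundle X scaleK L \<in> carrier (K_group X) \<and>
    index_bundle X scaleK L =
      K_diff X (\<Theta>_quotient X scaleK E1)
        (restrict_bundle X scaleK (\<lambda>x. range (blinfun_apply (id_blinfun - P x))))"
proof (cases "topspace X = {}")
  case True
  have rb: "topspace (vtotal (restrict_bundle X scaleK V)) = {}" for V
    using True by (simp add: topspace_restrict_bundle)
  have qb: "topspace (vtotal (\<Theta>_quotient X scaleK E1)) = {}"
    using True by (simp add: \<Theta>_quotient_def product_bundle_def)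
  note vb = vector_bundle_empty_base[OF True rb] vector_bundle_empty_base[OF True qb]
  have "topspace (vtotal (direct_sum (restrict_bundle X scaleK V) (restrict_bundle X scaleK V'))) = {}"
    "topspace (vtotal (direct_sum (\<Theta>_quotient X scaleK E1) (restrict_bundle X scaleK V'))) = {}" for V V'
    unfolding topspace_direct_sum rb qb by auto
  then show ?thesis
    unfolding index_bundle_def Let_def
    by (intro conjI K_diff_conv(2) K_diff_eqI vb isomorphic_bundles_empty_base)
next
  case False
  then obtain x1 where x1: "x1 \<in> topspace X" by blast
  interpret normed_space_over scaleK by fact
  have E1: "module.subspace scaleK E1" using assms(7) by (simp add: finite_codim_def)
  have L_lin: "linear_over scaleK (L x)" if "x \<in> topspace X" for x
    using assms(5)[OF that] by (simp add: fredholm_def)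
  have "\<forall>x \<in> topspace X. \<exists>S :: 'e \<Rightarrow>\<^sub>L 'e. (\<forall>w. S w \<in> E1 \<and> L x (S w) = P x w) \<and> (\<forall>e \<in> E1. S (L x e) = e)"
  proof
    fix x assume x: "x \<in> topspace X"
    show "\<exists>S :: 'e \<Rightarrow>\<^sub>L 'e. (\<forall>w. S w \<in> E1 \<and> L x (S w) = P x w) \<and> (\<forall>e \<in> E1. S (L x e) = e)"
      using assms(10)[OF x]
      by (intro ex_partial_inverse[OF assms(6) subspace_imp_real_subspace[OF E1]] assms(8,11) x) simp
  qed
  from bchoice[OF this] obtain S :: "'x \<Rightarrow> 'e \<Rightarrow>\<^sub>L 'e" where
    S0: "\<forall>x \<in> topspace X. (\<forall>w. S x w \<in> E1 \<and> L x (S x w) = P x w) \<and> (\<forall>e \<in> E1. S x (L x e) = e)"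
    by (elim exE) (rule that)
  have S: "S x w \<in> E1 \<and> L x (S x w) = P x w" and SL: "e \<in> E1 \<Longrightarrow> S x (L x e) = e"
    if "x \<in> topspace X" for x w e
    using S0 that by auto
  have S_cont: "continuous_map X euclidean S"
    by (rule continuous_partial_inverse[OF assms(4,9) _ S SL]) (use assms(10) in auto)
  obtain B where B: "finite B" "\<And>u. \<exists>s\<in>E1. \<exists>b\<in>module.span scaleK B. u = s + b"
    using assms(7) by (auto simp: finite_codim_def)
  \<comment> \<open>\<open>S x1 o\<^sub>L L x1\<close> takes values in \<open>E1\<close> and fixes
    \<open>E1\<close> pointwise, so its complement is a projection with kernel
    \<open>E1\<close>.\<close>
  define pr where "pr = id_blinfun - (S x1 o\<^sub>L L x1)"
  have pr: "pr u = u - S x1 (L x1 u)" for u by (simp add: pr_def blinfun.diff_left)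
  have S1: "S x1 w \<in> E1" "L x1 (S x1 w) = P x1 w" "e \<in> E1 \<Longrightarrow> S x1 (L x1 e) = e" for w e
    using S SL x1 by auto
  have pr_E1: "pr u = 0 \<longleftrightarrow> u \<in> E1" for u
    using S1(1)[of "L x1 u"] S1(3)[of u] by (auto simp: pr)
  have pr_lin: "linear_over scaleK pr"
    using partial_inverse_scale[OF E1 L_lin[OF x1] _ S1] L_lin[OF x1] assms(10)[OF x1]
    by (auto simp: linear_over_def pr scale_right_diff_distrib)
  have pr_fin: "finite_dim scaleK (range (blinfun_apply pr))"
  proof (rule finite_dim_rangeI[OF pr_lin])
    show "range (blinfun_apply pr) \<subseteq> module.span scaleK (blinfun_apply pr ` B)"
    proof clarify
      fix u
      obtain s b where "s \<in> E1" "b \<in> module.span scaleK B" "u = s + b" using B(2) by blast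
      then show "pr u \<in> module.span scaleK (blinfun_apply pr ` B)"
        using image_span_subset[OF pr_lin] pr_E1[of s] by (simp add: blinfun.add_right)
    qed
  qed (use B in auto)
  have coker_fin: "finite_dim scaleK (range (blinfun_apply (id_blinfun - P x)))" if x: "x \<in> topspace X" for x
  proof -
    let ?Q = "id_blinfun - P x"
    obtain B' where B': "finite B'" "\<And>u. \<exists>s\<in>range (blinfun_apply (L x)). \<exists>b\<in>module.span scaleK B'. u = s + b"
      using assms(5)[OF x] by (auto simp: fredholm_def finite_codim_def)
    have Q_lin: "linear_over scaleK ?Q"
      using assms(10)[OF x] by (auto simp: linear_over_def blinfun.diff_left scale_right_diff_distrib)
    \<comment> \<open>The space is \<open>E1\<close> plus the span of \<open>B\<close>, and also the
      range of \<open>L x\<close> plus the span of \<open>B'\<close>. As \<open>?Q\<close>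
      annihilates the image of \<open>E1\<close> under \<open>L x\<close>, only the images of
      \<open>B\<close> and the vectors of \<open>B'\<close> contribute to its range.\<close>
    let ?B = "blinfun_apply ?Q ` (blinfun_apply (L x) ` B \<union> B')"
    show ?thesis
    proof (rule finite_dim_rangeI[OF Q_lin])
      show "range (blinfun_apply ?Q) \<subseteq> module.span scaleK ?B"
      proof clarify
        fix u
        obtain v b' where v: "b' \<in> module.span scaleK B'" "u = L x v + b'" using B'(2) by blast
        obtain e b where e: "e \<in> E1" "b \<in> module.span scaleK B" "v = e + b" using B(2) by blast
        have "L x (S x (L x e)) = P x (L x e)" using S[OF x] by blast
        then have "?Q (L x e) = 0" using SL[OF x e(1)] by (simp add: blinfun.diff_left)
        then have "?Q u = ?Q (L x b + b')" by (simp add: v e blinfun.add_right)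
        moreover have "L x b \<in> module.span scaleK (blinfun_apply (L x) ` B)"
          by (rule image_span_subset[OF L_lin[OF x] e(2)])
        then have "L x b + b' \<in> module.span scaleK (blinfun_apply (L x) ` B \<union> B')"
          using v(1) span_mono[of "blinfun_apply (L x) ` B" "blinfun_apply (L x) ` B \<union> B'"]
            span_mono[of B' "blinfun_apply (L x) ` B \<union> B'"] by (intro span_add) auto
        ultimately show "?Q u \<in> module.span scaleK ?B"
          using image_span_subset[OF Q_lin] by simp
      qed
    qed (use B B' in auto)
  qed
  interpret D: classical_index_data scaleK X L P S pr E1
  proof
    show "pr o\<^sub>L pr = pr"
    proof (rule blinfun_eqI)
      fix u
      have "S x1 (L x1 (S x1 (L x1 u))) = S x1 (L x1 u)" using S1 by blast
      then show "(pr o\<^sub>L pr) u = pr u" by (simp add: pr blinfun.diff_right)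
    qed
  qed (use E1 assms(4,9,10) L_lin S_cont S SL pr_lin pr_E1 pr_fin coker_fin in auto)
  define V where "V = (SOME V. transversal_subbundle X scaleK L V)"
  have "transversal_subbundle X scaleK L V"
    unfolding V_def by (rule someI[where P = "transversal_subbundle X scaleK L", OF D.transversal_coker])
  then interpret T: transversal_data scaleK X L P S pr E1 V
    by unfold_locales (use assms(1,2) in auto)
  have "index_bundle X scaleK L = K_diff X T.ker_bundle T.V_bundle"
    by (simp add: index_bundle_def V_def Let_def)
  then show ?thesis
    using T.K_diff_eq_quotient(2) K_diff_conv(2)[OF T.vector_bundle_ker T.vector_bundle_V]
    by (simp add: D.Q_def)
qed

end
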